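(* Let $k$ be a Hilbertian field, $L/k$ a finite Galois extension, $G$ a finite group, and $\alpha : G \rightarrow \mathrm{Aut}(L/k)$ an epimorphism that has a section, i.e., there exists an embedding (injective group homomorphism) $\alpha' : \mathrm{Aut}(L/k) \rightarrow G$ such that $\alpha \circ \alpha' = \mathrm{id}_{\mathrm{Aut}(L/k)}$. Then there exist a finite separable extension $F/L$ and an isomorphism $\beta : \mathrm{Aut}(F/k) \rightarrow G$ such that $\alpha \circ \beta$ is the restriction map $\mathrm{Aut}(F/k) \rightarrow \mathrm{Aut}(L/k)$, $\sigma \mapsto \sigma|_L$.
   Context: For a field extension $F/K$, $\mathrm{Aut}(F/K)$ denotes the group of all field automorphisms of $F$ fixing $K$ pointwise. A field $k$ is Hilbertian if Hilbert's irreducibility theorem holds for it (in the sense of Fried–Jarden, Field Arithmetic): for all $n, m\geq 1$, algebraically independent indeterminates $\mathbf{T}=(T_1,\dots,T_n)$, polynomials $f_1,\dots,f_m \in k(\mathbf{T})[X]$ that are irreducible and separable over $k(\mathbf{T})$, and nonzero $g\in k[\mathbf{T}]$, there is $\mathbf{t}\in k^n$ with $g(\mathbf{t})\neq 0$ such that each $f_i(\mathbf{t},X)$ is defined and irreducible in $k[X]$. *)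

theory Defs
  imports
    "HOL-Algebra.Algebraic_Closure_Type"
    "HOL-Algebra.Bij"
    "HOL-Library.Poly_Mapping"
begin

text \<open>
  Fields are subsets of a type of class \<^class>\<open>field\<close>; a field extension is an inclusion of
  such subsets. Groups are records in the style of HOL-Algebra.
\<close>

abbreviation is_subfield :: "'a::field set \<Rightarrow> bool" where
  "is_subfield K \<equiv> subfield K (ring_of_type_algebra :: 'a ring)"

lemma is_subfield_iff:
  fixes K :: "'a::field set"
  shows "is_subfield K \<longleftrightarrow> 0 \<in> K \<and> 1 \<in> K \<and> (\<forall>x\<in>K. \<forall>y\<in>K. x + y \<in> K \<and> x * y \<in> K) \<and>
           (\<forall>x\<in>K. - x \<in> K) \<and> (\<forall>x\<in>K. inverse x \<in> K)"
proof -
  let ?R = "ring_of_type_algebra :: 'a ring"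
  interpret R: Ring.field ?R by (rule field_from_type_algebra)
  have sel: "carrier ?R = UNIV" "\<zero>\<^bsub>?R\<^esub> = 0" "\<one>\<^bsub>?R\<^esub> = 1"
    "\<And>x y. x \<oplus>\<^bsub>?R\<^esub> y = x + y" "\<And>x y. x \<otimes>\<^bsub>?R\<^esub> y = x * y"
    by (simp_all add: ring_of_type_algebra_def)
  have neg: "\<ominus>\<^bsub>?R\<^esub> x = - x" for x
    by (rule R.minus_equality) (simp_all add: sel)
  have inv: "inv\<^bsub>?R\<^esub> x = inverse x" if "x \<noteq> 0" for x
    using that R.inv_char[of x "inverse x"] by (simp add: sel)
  show ?thesis
  proof
    assume K: "is_subfield K"
    have sr: "subring K ?R" using subfieldE(1)[OF K] .
    have "inverse x \<in> K" if "x \<in> K" for x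
      using that R.subfield_m_inv(1)[OF K, of x] inv[of x] subringE(2)[OF sr]
      by (cases "x = 0") (auto simp: sel)
    then show "0 \<in> K \<and> 1 \<in> K \<and> (\<forall>x\<in>K. \<forall>y\<in>K. x + y \<in> K \<and> x * y \<in> K) \<and>
           (\<forall>x\<in>K. - x \<in> K) \<and> (\<forall>x\<in>K. inverse x \<in> K)"
      using subringE(2,3,5,6,7)[OF sr] by (auto simp: sel neg)
  next
    assume *: "0 \<in> K \<and> 1 \<in> K \<and> (\<forall>x\<in>K. \<forall>y\<in>K. x + y \<in> K \<and> x * y \<in> K) \<and>
           (\<forall>x\<in>K. - x \<in> K) \<and> (\<forall>x\<in>K. inverse x \<in> K)"
    have "subring K ?R"
      by (rule R.subringI) (use * in \<open>auto simp: sel neg\<close>)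
    then show "is_subfield K"
      by (rule R.subfieldI') (use * in \<open>auto simp: sel inv\<close>)
  qed
qed

definition poly_over :: "'a::field set \<Rightarrow> 'a poly set" where
  "poly_over K = {p. \<forall>i. Polynomial.coeff p i \<in> K}"

text \<open>
  Irreducibility in the ring $K[X]$. For \<^term>\<open>p \<in> poly_over K\<close> and a subfield \<open>K\<close>, the condition
  \<open>p dvd 1\<close> does not depend on whether it is read over \<open>K\<close> or over the ambient field.
\<close>

definition irreducible_over :: "'a::field set \<Rightarrow> 'a poly \<Rightarrow> bool" where
  "irreducible_over K p \<longleftrightarrow>
     p \<in> poly_over K \<and> p \<noteq> 0 \<and> \<not> p dvd 1 \<and>
     (\<forall>a\<in>poly_over K. \<forall>b\<in>poly_over K. p = a * b \<longrightarrow> a dvd 1 \<or> b dvd 1)"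

lemma irreducible_over_UNIV: "irreducible_over UNIV p \<longleftrightarrow> Factorial_Ring.irreducible p"
  by (simp add: irreducible_over_def poly_over_def Factorial_Ring.irreducible_def)

text \<open>
  A polynomial is separable if it has no multiple roots in an algebraic closure. The algebraic
  closure of the ambient field contains one of every subfield over which the polynomial is defined.
\<close>

definition separable_poly :: "'a::field poly \<Rightarrow> bool" where
  "separable_poly p \<longleftrightarrow> rsquarefree (map_poly to_ac p)"

definition splits_over :: "'a::field set \<Rightarrow> 'a poly \<Rightarrow> bool" where
  "splits_over L p \<longleftrightarrow>
     (\<exists>c xs. c \<in> L \<and> set xs \<subseteq> L \<and> p = Polynomial.smult c (\<Prod>x\<leftarrow>xs. [:- x, 1:]))"

definition finite_ext :: "'a::field set \<Rightarrow> 'a set \<Rightarrow> bool" where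
  "finite_ext K F \<longleftrightarrow> ring.finite_dimension (ring_of_type_algebra :: 'a ring) K F"

text \<open>
  The irreducible polynomials over \<open>K\<close> that vanish at \<open>x\<close> are the nonzero constant multiples of the
  minimal polynomial of \<open>x\<close>.
\<close>

definition separable_ext :: "'a::field set \<Rightarrow> 'a set \<Rightarrow> bool" where
  "separable_ext K F \<longleftrightarrow>
     (\<forall>x\<in>F. \<exists>p. irreducible_over K p \<and> poly p x = 0 \<and> separable_poly p)"

definition normal_ext :: "'a::field set \<Rightarrow> 'a set \<Rightarrow> bool" where
  "normal_ext K F \<longleftrightarrow>
     (\<forall>x\<in>F. \<exists>p. irreducible_over K p \<and> poly p x = 0) \<and>
     (\<forall>p. irreducible_over K p \<and> (\<exists>x\<in>F. poly p x = 0) \<longrightarrow> splits_over F p)"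

definition galois_ext :: "'a::field set \<Rightarrow> 'a set \<Rightarrow> bool" where
  "galois_ext K F \<longleftrightarrow> separable_ext K F \<and> normal_ext K F"

text \<open>
  $\mathrm{Aut}(F/K)$. As in \<^const>\<open>AutoGroup\<close>, automorphisms are extensional functions
  (\<^term>\<open>undefined\<close> outside \<open>F\<close>), so that each one is represented exactly once.
\<close>

definition field_auts :: "'a::field set \<Rightarrow> 'a set \<Rightarrow> ('a \<Rightarrow> 'a) set" where
  "field_auts F K =
     {\<sigma> \<in> Bij F. (\<forall>x\<in>F. \<forall>y\<in>F. \<sigma> (x + y) = \<sigma> x + \<sigma> y \<and> \<sigma> (x * y) = \<sigma> x * \<sigma> y) \<and>
                  (\<forall>x\<in>K. \<sigma> x = x)}"

definition Aut :: "'a::field set \<Rightarrow> 'a set \<Rightarrow> ('a \<Rightarrow> 'a) monoid" where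
  "Aut F K = BijGroup F \<lparr>carrier := field_auts F K\<rparr>"

lemma group_Aut:
  fixes F K :: "'a::field set"
  assumes F: "is_subfield F" and KF: "K \<subseteq> F"
  shows "group (Aut F K)"
proof -
  interpret B: group "BijGroup F" by (rule group_BijGroup)
  have cl: "x + y \<in> F" "x * y \<in> F" if "x \<in> F" "y \<in> F" for x y
    using F that by (auto simp: is_subfield_iff)
  have sub: "field_auts F K \<subseteq> Bij F" by (auto simp: field_auts_def)
  have "subgroup (field_auts F K) (BijGroup F)"
  proof (rule B.subgroupI)
    show "field_auts F K \<subseteq> carrier (BijGroup F)"
      using sub by (simp add: BijGroup_def)
    have "(\<lambda>x\<in>F. x) \<in> field_auts F K"
      using KF by (auto simp: field_auts_def id_Bij cl)
    then show "field_auts F K \<noteq> {}" by blast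
  next
    fix s assume s: "s \<in> field_auts F K"
    then have sB: "s \<in> Bij F" using sub by blast
    have inj: "inj_on s F" and im: "s ` F = F" using sB by (auto simp: Bij_def bij_betw_def)
    have plus: "inv_into F s (x + y) = inv_into F s x + inv_into F s y" if "x \<in> F" "y \<in> F" for x y
      by (rule Bij_inv_into_lemma[OF _ sB, where g = "(+)"]) (use s that cl in \<open>auto simp: field_auts_def\<close>)
    have times: "inv_into F s (x * y) = inv_into F s x * inv_into F s y" if "x \<in> F" "y \<in> F" for x y
      by (rule Bij_inv_into_lemma[OF _ sB, where g = "(*)"]) (use s that cl in \<open>auto simp: field_auts_def\<close>)
    have fix_K: "inv_into F s x = x" if "x \<in> K" for x
      using s that KF inj by (auto simp: field_auts_def intro!: inv_into_f_eq)
    show "inv\<^bsub>BijGroup F\<^esub> s \<in> field_auts F K"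
      unfolding inv_BijGroup[OF sB] using restrict_inv_into_Bij[OF sB] plus times fix_K KF
      by (auto simp: field_auts_def cl subset_iff)
  next
    fix s t assume st: "s \<in> field_auts F K" "t \<in> field_auts F K"
    then have B: "s \<in> Bij F" "t \<in> Bij F" using sub by blast+
    then have "t x \<in> F" if "x \<in> F" for x
      using Bij_imp_funcset[OF B(2)] that by blast
    then show "s \<otimes>\<^bsub>BijGroup F\<^esub> t \<in> field_auts F K"
      using st compose_Bij[OF B] KF B
      by (auto simp: field_auts_def BijGroup_def compose_def cl subset_iff)
  qed
  then show ?thesis
    unfolding Aut_def by (rule B.subgroup_imp_group)
qed

type_synonym 'a mpoly = "(nat \<Rightarrow>\<^sub>0 nat) \<Rightarrow>\<^sub>0 'a"

text \<open>
  A monomial maps each variable index to its exponent, so \<^typ>\<open>'a mpoly\<close> is the polynomial ring in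
  the variables $T_0, T_1, \dots$; the subring $K[T_0,\dots,T_{n-1}]$ and the subfield
  $K(T_0,\dots,T_{n-1})$ of its field of fractions are carved out as sets.
\<close>

definition mpoly_over :: "'a::field set \<Rightarrow> nat \<Rightarrow> 'a mpoly set" where
  "mpoly_over K n =
     {p. (\<forall>m. Poly_Mapping.lookup p m \<in> K) \<and>
         (\<forall>m\<in>Poly_Mapping.keys p. Poly_Mapping.keys m \<subseteq> {..<n})}"

definition mpoly_eval :: "(nat \<Rightarrow> 'a::field) \<Rightarrow> 'a mpoly \<Rightarrow> 'a" where
  "mpoly_eval t p =
     (\<Sum>m\<in>Poly_Mapping.keys p.
        Poly_Mapping.lookup p m * (\<Prod>i\<in>Poly_Mapping.keys m. t i ^ Poly_Mapping.lookup m i))"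

definition ratfun_over :: "'a::field set \<Rightarrow> nat \<Rightarrow> 'a mpoly fract set" where
  "ratfun_over K n = {Fract a b | a b. a \<in> mpoly_over K n \<and> b \<in> mpoly_over K n \<and> b \<noteq> 0}"

text \<open>
  \<open>ratfun_value K n t r v\<close>: the rational function \<open>r\<close> is defined at \<open>t\<close>, with value \<open>v\<close>.
  Accordingly \<open>specializes K n t f q\<close>: $f(t,X)$ is defined and equal to \<open>q\<close>.
\<close>

definition ratfun_value :: "'a::field set \<Rightarrow> nat \<Rightarrow> (nat \<Rightarrow> 'a) \<Rightarrow> 'a mpoly fract \<Rightarrow> 'a \<Rightarrow> bool" where
  "ratfun_value K n t r v \<longleftrightarrow>
     (\<exists>a\<in>mpoly_over K n. \<exists>b\<in>mpoly_over K n.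
        r = Fract a b \<and> mpoly_eval t b \<noteq> 0 \<and> v = mpoly_eval t a / mpoly_eval t b)"

definition specializes ::
    "'a::field set \<Rightarrow> nat \<Rightarrow> (nat \<Rightarrow> 'a) \<Rightarrow> 'a mpoly fract poly \<Rightarrow> 'a poly \<Rightarrow> bool" where
  "specializes K n t f q \<longleftrightarrow>
     (\<forall>i. ratfun_value K n t (Polynomial.coeff f i) (Polynomial.coeff q i))"

definition hilbertian :: "'a::field set \<Rightarrow> bool" where
  "hilbertian K \<longleftrightarrow>
     (\<forall>n m. \<forall>f :: nat \<Rightarrow> 'a mpoly fract poly. \<forall>g.
        n \<ge> 1 \<longrightarrow> m \<ge> 1 \<longrightarrow>
        (\<forall>i<m. irreducible_over (ratfun_over K n) (f i) \<and> separable_poly (f i)) \<longrightarrow>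
        g \<in> mpoly_over K n \<longrightarrow> g \<noteq> 0 \<longrightarrow>
        (\<exists>t. (\<forall>j<n. t j \<in> K) \<and> mpoly_eval t g \<noteq> 0 \<and>
             (\<forall>i<m. \<exists>q. specializes K n t (f i) q \<and> irreducible_over K q)))"

end

theory Submission imports Defs begin

text \<open>
  Let \<open>n = |G|\<close> and let \<open>G\<close> act on the rational function field \<open>L(x\<^sub>1,\<dots>,x\<^sub>n,y)\<close> through \<open>\<alpha>\<close> on \<open>L\<close> and
  through its regular representation on the \<open>x\<^sub>i\<close>, fixing \<open>y\<close>. Choose a polynomial \<open>e\<close> in the \<open>x\<^sub>i\<close>
  whose stabilizer in \<open>Sym(n) \<times> Aut(L/k)\<close> is exactly \<open>G\<close>, and let \<open>K\<close> be generated over \<open>k\<close> by the elementary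
  symmetric polynomials in the \<open>x\<^sub>i\<close> and by \<open>y\<^sup>3 + y\<^sup>2 - e\<close>; it is purely transcendental over \<open>k\<close>. A
  \<open>K\<close>-automorphism permutes the \<open>x\<^sub>i\<close>, acts on \<open>L\<close>, and sends \<open>y\<close> to some \<open>y'\<close> with
  \<open>y'\<^sup>3 + y'\<^sup>2 = y\<^sup>3 + y\<^sup>2 + c\<close> and \<open>c\<close> free of \<open>y\<close>. In every characteristic this forces \<open>y' = y\<close> and \<open>c = 0\<close>, so
  it fixes \<open>e\<close> and comes from \<open>G\<close>: the automorphism group over \<open>K\<close> is \<open>G\<close>.

  Hilbert irreducibility, applied to a primitive element of the normal closure over \<open>K\<close>, yields a
  place of \<open>K\<close> that preserves the Galois group of the normal closure, hence also the automorphism group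
  of the subextension. The place may twist \<open>L\<close> by an element of \<open>Aut(L/k)\<close>; this is undone by an inner
  automorphism of \<open>G\<close>.
\<close>

section \<open>Polynomials over subrings\<close>

text \<open>For L = k the direct route, specializing k(x_1,...,x_n) over its fixed field under
  \<open>G\<close>, would need that fixed field to be purely transcendental over \<open>k\<close>.
  This is Noether's problem, whose answer is negative in general. The field of symmetric functions
  is always rational, but over it the automorphisms form all of Sym(n) x Aut(L/k). The variable
  \<open>y\<close> removes the surplus: adjoining \<open>y^3 + y^2 - e\<close> instead of
  \<open>e\<close> keeps \<open>K\<close> rational, and an automorphism that moves \<open>e\<close>
  would have to move \<open>y\<close> in a way that the cubic forbids. The price is an extension of
  degree 3 n! [L:k] with only n automorphisms; it is never normal, so the specialization has to be
  controlled in the normal closure.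

  The cubic is chosen for all characteristics at once. A pure power \<open>y^2\<close> or
  \<open>y^3\<close> would admit a sign or a cube root of unity, and it is additive in
  characteristic 2 or 3. For \<open>y^3 + y^2\<close> both defects disappear, and the derivative
  \<open>3 y^2 + 2 y\<close> is never the zero polynomial, which keeps the extension
  separable.\<close>

abbreviation "pdeg \<equiv> Polynomial.degree"
abbreviation "pcoeff \<equiv> Polynomial.coeff"
abbreviation "plead p \<equiv> Polynomial.lead_coeff p"
abbreviation "psmult \<equiv> Polynomial.smult"
abbreviation "pmonom \<equiv> Polynomial.monom"
abbreviation "lookup \<equiv> Poly_Mapping.lookup"
abbreviation "keys \<equiv> Poly_Mapping.keys"
abbreviation "single \<equiv> Poly_Mapping.single"

text \<open>Places live on subrings that are not fields, so coefficients, adjunction and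
  homomorphisms are set up over subrings given as plain sets.\<close>

definition subring_set :: "'a::comm_ring_1 set \<Rightarrow> bool" where
  "subring_set S \<longleftrightarrow> 1 \<in> S \<and> (\<forall>x\<in>S. \<forall>y\<in>S. x - y \<in> S \<and> x * y \<in> S)"

lemma subring_set_1: "subring_set S \<Longrightarrow> 1 \<in> S"
  and subring_set_mult: "subring_set S \<Longrightarrow> x \<in> S \<Longrightarrow> y \<in> S \<Longrightarrow> x * y \<in> S"
  and subring_set_diff: "subring_set S \<Longrightarrow> x \<in> S \<Longrightarrow> y \<in> S \<Longrightarrow> x - y \<in> S"
  by (auto simp: subring_set_def)

lemma subring_set_0: "subring_set S \<Longrightarrow> 0 \<in> S"
  using subring_set_diff[OF _ subring_set_1 subring_set_1, of S] by simp

lemma subring_set_minus: "subring_set S \<Longrightarrow> x \<in> S \<Longrightarrow> - x \<in> S"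
  using subring_set_diff[OF _ subring_set_0, of S x] by simp

lemma subring_set_add: "subring_set S \<Longrightarrow> x \<in> S \<Longrightarrow> y \<in> S \<Longrightarrow> x + y \<in> S"
  using subring_set_diff[of S x "- y"] subring_set_minus[of S y] by simp

lemma subring_set_sum: "subring_set S \<Longrightarrow> (\<And>i. i \<in> A \<Longrightarrow> f i \<in> S) \<Longrightarrow> sum f A \<in> S"
  by (induction A rule: infinite_finite_induct) (auto simp: subring_set_0 subring_set_add)

lemma subring_set_prod: "subring_set S \<Longrightarrow> (\<And>i. i \<in> A \<Longrightarrow> f i \<in> S) \<Longrightarrow> prod f A \<in> S"
  by (induction A rule: infinite_finite_induct) (auto simp: subring_set_1 subring_set_mult)

lemma subring_set_power: "subring_set S \<Longrightarrow> x \<in> S \<Longrightarrow> x ^ n \<in> S"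
  by (induction n) (auto simp: subring_set_1 subring_set_mult)

lemma subring_set_of_nat: "subring_set S \<Longrightarrow> of_nat n \<in> S"
  by (induction n) (auto simp: subring_set_0 subring_set_1 subring_set_add)

lemmas subring_set_closed = subring_set_0 subring_set_1 subring_set_add subring_set_minus
  subring_set_diff subring_set_mult subring_set_sum subring_set_prod subring_set_power
  subring_set_of_nat

lemma subring_set_UNIV: "subring_set UNIV"
  by (simp add: subring_set_def)

text \<open>Embeddings and places are partial maps: \<open>f\<close> is a total function that is
  controlled on \<open>S\<close> only.\<close>

locale ring_hom_on =
  fixes S :: "'a::comm_ring_1 set" and f :: "'a \<Rightarrow> 'b::comm_ring_1"
  assumes subring: "subring_set S"
    and hom_1: "f 1 = 1"
    and hom_add: "x \<in> S \<Longrightarrow> y \<in> S \<Longrightarrow> f (x + y) = f x + f y"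
    and hom_mult: "x \<in> S \<Longrightarrow> y \<in> S \<Longrightarrow> f (x * y) = f x * f y"
begin

lemma hom_0: "f 0 = 0"
  using hom_add[of 0 0] subring_set_0[OF subring] by simp

lemma hom_minus: "x \<in> S \<Longrightarrow> f (- x) = - f x"
  using hom_add[of x "- x"] subring_set_minus[OF subring] hom_0 by (simp add: eq_neg_iff_add_eq_0 add.commute)

lemma hom_diff: "x \<in> S \<Longrightarrow> y \<in> S \<Longrightarrow> f (x - y) = f x - f y"
  using hom_add[of x "- y"] subring_set_minus[OF subring] hom_minus[of y] by simp

lemma hom_sum: "(\<And>i. i \<in> A \<Longrightarrow> g i \<in> S) \<Longrightarrow> f (sum g A) = (\<Sum>i\<in>A. f (g i))"
  by (induction A rule: infinite_finite_induct)
     (auto simp: hom_0 hom_add subring_set_sum[OF subring])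

lemma hom_prod: "(\<And>i. i \<in> A \<Longrightarrow> g i \<in> S) \<Longrightarrow> f (prod g A) = (\<Prod>i\<in>A. f (g i))"
  by (induction A rule: infinite_finite_induct)
     (auto simp: hom_1 hom_mult subring_set_prod[OF subring])

lemma hom_power: "x \<in> S \<Longrightarrow> f (x ^ n) = f x ^ n"
  by (induction n) (auto simp: hom_1 hom_mult subring_set_power[OF subring])

lemma hom_image_subring: "subring_set (f ` S)"
  unfolding subring_set_def
proof (intro conjI ballI)
  show "1 \<in> f ` S" using hom_1 subring_set_1[OF subring] by (metis imageI)
next
  fix x y assume "x \<in> f ` S" "y \<in> f ` S"
  then obtain a b where ab: "a \<in> S" "b \<in> S" "x = f a" "y = f b" by auto
  then show "x - y \<in> f ` S" "x * y \<in> f ` S"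
    using hom_diff[of a b] hom_mult[of a b] subring_set_diff[OF subring, of a b]
      subring_set_mult[OF subring, of a b] by (metis imageI)+
qed

end

lemma ring_hom_on_comp:
  "ring_hom_on S f \<Longrightarrow> ring_hom_on T g \<Longrightarrow> f ` S \<subseteq> T \<Longrightarrow> ring_hom_on S (\<lambda>x. g (f x))"
  unfolding ring_hom_on_def by (auto simp: image_subset_iff)

lemma ring_hom_on_subset:
  "ring_hom_on S f \<Longrightarrow> subring_set T \<Longrightarrow> T \<subseteq> S \<Longrightarrow> ring_hom_on T f"
  unfolding ring_hom_on_def by (auto simp: subset_iff)

lemma ring_hom_on_id: "subring_set S \<Longrightarrow> ring_hom_on S (\<lambda>x. x)"
  by unfold_locales auto

definition polys :: "'a::comm_ring_1 set \<Rightarrow> 'a poly set" where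
  "polys S = {p. \<forall>i. pcoeff p i \<in> S}"

lemma poly_over_eq_polys: "poly_over K = polys K"
  by (simp add: poly_over_def polys_def)

lemma coeff_polys: "p \<in> polys S \<Longrightarrow> pcoeff p i \<in> S"
  by (simp add: polys_def)

lemma polys_mono: "S \<subseteq> T \<Longrightarrow> polys S \<subseteq> polys T"
  by (auto simp: polys_def)

lemma subring_set_polys: assumes S: "subring_set S" shows "subring_set (polys S)"
proof -
  have "1 \<in> polys S"
    using subring_set_0[OF S] subring_set_1[OF S] by (auto simp: polys_def coeff_1)
  moreover have "p - q \<in> polys S" "p * q \<in> polys S" if "p \<in> polys S" "q \<in> polys S" for p q
    using that S by (auto simp: polys_def coeff_mult intro!: subring_set_closed)
  ultimately show ?thesis by (simp add: subring_set_def)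
qed

lemma polys_pCons: "subring_set S \<Longrightarrow> a \<in> S \<Longrightarrow> p \<in> polys S \<Longrightarrow> pCons a p \<in> polys S"
  by (auto simp: polys_def coeff_pCons split: nat.splits)

lemma polys_pCons_iff: "pCons a p \<in> polys S \<longleftrightarrow> a \<in> S \<and> p \<in> polys S"
proof
  assume *: "pCons a p \<in> polys S"
  show "a \<in> S \<and> p \<in> polys S"
    using coeff_polys[OF *, of 0] coeff_polys[OF *, of "Suc _"] by (auto simp: polys_def)
qed (auto simp: polys_def coeff_pCons split: nat.splits)

lemma polys_0: "subring_set S \<Longrightarrow> 0 \<in> polys S"
  by (rule subring_set_0[OF subring_set_polys])

lemma polys_const: "subring_set S \<Longrightarrow> a \<in> S \<Longrightarrow> [:a:] \<in> polys S"
  by (simp add: polys_pCons polys_0)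

lemma polys_linear: "subring_set S \<Longrightarrow> a \<in> S \<Longrightarrow> b \<in> S \<Longrightarrow> [:a, b:] \<in> polys S"
  by (simp add: polys_pCons polys_0)

lemma polys_smult: "subring_set S \<Longrightarrow> a \<in> S \<Longrightarrow> p \<in> polys S \<Longrightarrow> psmult a p \<in> polys S"
  by (auto simp: polys_def subring_set_mult)

lemma polys_monom: "subring_set S \<Longrightarrow> a \<in> S \<Longrightarrow> pmonom a n \<in> polys S"
  by (auto simp: polys_def subring_set_0)

lemma polys_pderiv:
  fixes p :: "'a::idom poly"
  shows "subring_set S \<Longrightarrow> p \<in> polys S \<Longrightarrow> pderiv p \<in> polys S"
  unfolding polys_def
  by (simp only: mem_Collect_eq coeff_pderiv) (blast intro: subring_set_mult subring_set_of_nat)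

lemma polys_pcompose:
  assumes S: "subring_set S" and p: "p \<in> polys S" and q: "q \<in> polys S"
  shows "pcompose p q \<in> polys S"
  using p
proof (induction p)
  case (pCons a p)
  then show ?case
    using S q subring_set_closed(3,6)[OF subring_set_polys[OF S]]
    by (auto simp: pcompose_pCons polys_pCons_iff intro: polys_const)
qed (simp add: polys_0[OF S])

lemma poly_in_subring:
  assumes S: "subring_set S" and p: "p \<in> polys S" and x: "x \<in> S"
  shows "poly p x \<in> S"
  unfolding poly_altdef using S p x by (auto intro!: subring_set_closed coeff_polys)

lemma polys_UNIV: "polys UNIV = UNIV"
  by (simp add: polys_def)

context ring_hom_on
begin

lemma coeff_map_poly_hom: "pcoeff (map_poly f p) i = f (pcoeff p i)"
  by (simp add: coeff_map_poly hom_0)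

lemma map_poly_hom: "ring_hom_on (polys S) (map_poly f)"
proof
  show "subring_set (polys S)" by (rule subring_set_polys[OF subring])
  show "map_poly f 1 = 1" by (simp add: hom_1)
  fix p q assume pq: "p \<in> polys S" "q \<in> polys S"
  show "map_poly f (p + q) = map_poly f p + map_poly f q"
    using pq by (intro poly_eqI) (simp add: coeff_map_poly_hom hom_add coeff_polys)
  show "map_poly f (p * q) = map_poly f p * map_poly f q"
    using pq by (intro poly_eqI)
      (simp add: coeff_map_poly_hom coeff_mult hom_sum hom_mult coeff_polys
        subring_set_mult[OF subring])
qed

lemma map_poly_pCons_hom: "map_poly f (pCons a p) = pCons (f a) (map_poly f p)"
  by (rule poly_eqI) (auto simp: coeff_map_poly_hom coeff_pCons split: nat.splits)

lemma poly_map_poly_hom: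
  assumes p: "p \<in> polys S" and x: "x \<in> S"
  shows "poly (map_poly f p) (f x) = f (poly p x)"
  using p
proof (induction p)
  case (pCons a p)
  then have "a \<in> S" "p \<in> polys S" by (auto simp: polys_pCons_iff)
  then show ?case using pCons x poly_in_subring[OF subring, of p x]
    by (simp add: map_poly_pCons_hom hom_add hom_mult subring_set_mult[OF subring])
qed (simp add: hom_0)

end

lemma map_poly_pderiv_hom:
  fixes f :: "'a::idom \<Rightarrow> 'b::idom"
  assumes f: "ring_hom_on S f" and p: "p \<in> polys S"
  shows "map_poly f (pderiv p) = pderiv (map_poly f p)"
proof -
  interpret ring_hom_on S f by (rule f)
  have "f (of_nat n) = of_nat n" for n
    by (induction n) (auto simp: hom_0 hom_1 hom_add subring_set_closed[OF subring])
  then show ?thesis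
    using p by (intro poly_eqI)
      (simp add: coeff_map_poly_hom coeff_pderiv hom_mult coeff_polys subring_set_of_nat[OF subring]
        del: of_nat_Suc)
qed

text \<open>Cancelling the leading term of \<open>p\<close> by a multiple of the monic
  \<open>m\<close> inverts no coefficient, so quotient and remainder stay over the subring. This
  serves over a field for minimal polynomials and over the domain of a place in
  \<open>extend_place\<close>.\<close>

lemma monic_division:
  fixes m p :: "'a::comm_ring_1 poly"
  assumes S: "subring_set S" and m: "m \<in> polys S" "plead m = 1" and p: "p \<in> polys S"
  shows "\<exists>q\<in>polys S. \<exists>r\<in>polys S. p = m * q + r \<and> (r = 0 \<or> pdeg r < pdeg m)"
  using p
proof (induction "pdeg p" arbitrary: p rule: less_induct)
  case (less p)
  show ?case
  proof (cases "p = 0 \<or> pdeg p < pdeg m")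
    case True
    then show ?thesis using less.prems polys_0[OF S] by (intro bexI[of _ 0] bexI[of _ p]) auto
  next
    case False
    define n where "n = pdeg p - pdeg m"
    define h where "h = pmonom (plead p) n"
    define p' where "p' = p - m * h"
    have h: "h \<in> polys S" unfolding h_def
      by (intro polys_monom S coeff_polys less.prems)
    have p': "p' \<in> polys S" unfolding p'_def
      by (intro subring_set_closed(5,6)[OF subring_set_polys[OF S]] less.prems m h)
    have le: "pdeg (m * h) \<le> pdeg p"
    proof -
      have "pdeg (m * h) \<le> pdeg m + pdeg h" by (rule degree_mult_le)
      also have "pdeg h \<le> n" unfolding h_def by (rule degree_monom_le)
      finally show ?thesis using False unfolding n_def by auto
    qed
    have "pcoeff (m * h) (pdeg p) = plead p"
    proof -
      have "pcoeff (h * m) (n + pdeg m) = plead p * plead m"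
        unfolding h_def by (simp add: coeff_monom_mult)
      moreover have "n + pdeg m = pdeg p" using False by (simp add: n_def)
      ultimately show ?thesis using m by (simp add: mult.commute)
    qed
    then have c0: "pcoeff p' (pdeg p) = 0" by (simp add: p'_def)
    have "pdeg p' \<le> pdeg p" unfolding p'_def using le by (simp add: degree_diff_le)
    then have "p' = 0 \<or> pdeg p' < pdeg p"
      using c0 by (metis le_neq_implies_less leading_coeff_0_iff)
    then have "\<exists>q\<in>polys S. \<exists>r\<in>polys S. p' = m * q + r \<and> (r = 0 \<or> pdeg r < pdeg m)"
    proof
      assume "p' = 0" then show ?thesis using polys_0[OF S] by (intro bexI[of _ 0] bexI[of _ 0]) auto
    qed (use less.hyps p' in blast)
    then obtain q r where qr: "q \<in> polys S" "r \<in> polys S" "p' = m * q + r"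
      "r = 0 \<or> pdeg r < pdeg m" by blast
    then have "p = m * (q + h) + r" by (simp add: p'_def algebra_simps)
    then show ?thesis using qr subring_set_add[OF subring_set_polys[OF S] qr(1) h] by blast
  qed
qed

text \<open>The ring S[a]. For a subfield \<open>S\<close> and an algebraic \<open>a\<close> it is
  the field S(a), by \<open>adj_subfield\<close>.\<close>

definition adj :: "'a::comm_ring_1 set \<Rightarrow> 'a \<Rightarrow> 'a set" where
  "adj S a = (\<lambda>p. poly p a) ` polys S"

lemma adjI: "p \<in> polys S \<Longrightarrow> poly p a \<in> adj S a"
  by (simp add: adj_def)

lemma adjE: assumes "x \<in> adj S a" obtains p where "p \<in> polys S" "x = poly p a"
  using assms by (auto simp: adj_def)

lemma subring_set_adj: assumes S: "subring_set S" shows "subring_set (adj S a)"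
proof -
  have "ring_hom_on (polys S) (\<lambda>p. poly p a)"
    by unfold_locales (auto simp: subring_set_polys[OF S])
  then show ?thesis unfolding adj_def by (rule ring_hom_on.hom_image_subring)
qed

lemma adj_self: "subring_set S \<Longrightarrow> a \<in> adj S a"
  using adjI[OF polys_linear[of S 0 1], of a] by (simp add: subring_set_closed)

lemma adj_base: "subring_set S \<Longrightarrow> x \<in> S \<Longrightarrow> x \<in> adj S a"
  using adjI[OF polys_const[of S x], of a] by simp

lemma adj_least: "subring_set T \<Longrightarrow> S \<subseteq> T \<Longrightarrow> a \<in> T \<Longrightarrow> adj S a \<subseteq> T"
  unfolding adj_def using poly_in_subring[of T] polys_mono[of S T] by blast

section \<open>Algebraic and separable elements\<close>

lemma subfield_subring: "is_subfield K \<Longrightarrow> subring_set K"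
  unfolding is_subfield_iff subring_set_def
  by (intro conjI ballI) (simp_all only: diff_conv_add_uminus)

lemma subfield_inverse: "is_subfield K \<Longrightarrow> x \<in> K \<Longrightarrow> inverse x \<in> K"
  by (simp add: is_subfield_iff)

lemma subfield_divide: "is_subfield K \<Longrightarrow> x \<in> K \<Longrightarrow> y \<in> K \<Longrightarrow> x / y \<in> K"
  by (simp add: divide_inverse subfield_inverse subring_set_mult subfield_subring)

lemma is_subfieldI: "subring_set K \<Longrightarrow> (\<And>x. x \<in> K \<Longrightarrow> inverse x \<in> K) \<Longrightarrow> is_subfield K"
  by (simp add: is_subfield_iff subring_set_closed)

definition alg :: "'a::field set \<Rightarrow> 'a \<Rightarrow> bool" where
  "alg K a \<longleftrightarrow> (\<exists>p\<in>polys K. p \<noteq> 0 \<and> poly p a = 0)"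

text \<open>A simple root of some polynomial, not necessarily the minimal one: in this form
  separability passes to larger base fields and along homomorphisms at once, and
  \<open>sep_minpoly\<close> recovers the usual form.\<close>

definition sep :: "'a::field set \<Rightarrow> 'a \<Rightarrow> bool" where
  "sep K a \<longleftrightarrow> (\<exists>p\<in>polys K. poly p a = 0 \<and> poly (pderiv p) a \<noteq> 0)"

lemma sep_imp_alg: "sep K a \<Longrightarrow> alg K a"
  unfolding sep_def alg_def by (metis pderiv_0 poly_0)

lemma sep_mono: "sep K a \<Longrightarrow> K \<subseteq> K' \<Longrightarrow> sep K' a"
  unfolding sep_def using polys_mono by blast

lemma alg_mono: "alg K a \<Longrightarrow> K \<subseteq> K' \<Longrightarrow> alg K' a"
  unfolding alg_def using polys_mono by blast

lemma sep_base: "subring_set K \<Longrightarrow> a \<in> K \<Longrightarrow> sep K a"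
  unfolding sep_def
  by (rule bexI[of _ "[:- a, 1:]"]) (simp_all add: pderiv_pCons polys_linear subring_set_minus subring_set_1)

text \<open>Bridge to HOL-Algebra, from which \<open>algebraic_closed\<close> takes that the
  algebraic elements form a field. Polynomials there are lists with the leading coefficient first,
  hence the \<open>rev\<close>.\<close>

lemma algebraic_iff_alg:
  fixes x :: "'a::field"
  assumes K: "is_subfield K"
  shows "\<not> ring.transcendental (ring_of_type_algebra :: 'a ring) K x \<longleftrightarrow> alg K x"
proof -
  let ?R = "ring_of_type_algebra :: 'a ring"
  interpret R: Ring.field ?R by (rule field_from_type_algebra)
  have sel: "carrier ?R = UNIV" "\<zero>\<^bsub>?R\<^esub> = 0" "\<one>\<^bsub>?R\<^esub> = 1"
    "\<And>x y. x \<oplus>\<^bsub>?R\<^esub> y = x + y" "\<And>x y. x \<otimes>\<^bsub>?R\<^esub> y = x * y"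
    by (simp_all add: ring_of_type_algebra_def)
  have pow: "x [^]\<^bsub>?R\<^esub> (n::nat) = x ^ n" for x n
    by (induction n) (simp_all add: sel mult.commute)
  have eval: "R.eval p x = poly (Poly (rev p)) x" for p
    by (induction p) (simp_all add: sel pow Poly_append poly_monom mult.commute)
  show ?thesis
  proof
    assume "R.algebraic K x"
    then obtain p where p: "p \<in> carrier (K [X]\<^bsub>?R\<^esub>)" "p \<noteq> []" "R.eval p x = \<zero>\<^bsub>?R\<^esub>"
      using R.algebraicE[OF subfieldE(1)[OF K], of x] sel by (auto simp: over_def)
    from p(1,2) have p': "set p \<subseteq> K" "hd p \<noteq> 0"
      by (auto simp: univ_poly_def polynomial_def sel)
    have "pcoeff (Poly (rev p)) i \<in> K" for i
      using p'(1) subring_set_0[OF subfield_subring[OF K]] nth_mem[of i "rev p"]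
      by (auto simp: nth_default_def simp del: nth_mem)
    moreover have "pcoeff (Poly (rev p)) (length p - 1) \<noteq> 0"
      using p' p(2) by (simp add: nth_default_def rev_nth hd_conv_nth)
    then have "Poly (rev p) \<noteq> 0" by (metis coeff_0)
    moreover have "poly (Poly (rev p)) x = 0" using p(3) by (simp add: eval sel)
    ultimately show "alg K x" unfolding alg_def polys_def by blast
  next
    assume "alg K x"
    then obtain p where p: "p \<in> polys K" "p \<noteq> 0" "poly p x = 0" by (auto simp: alg_def)
    let ?p = "rev (coeffs p)"
    have "hd ?p \<noteq> 0" using p(2) by (simp add: hd_rev last_coeffs_eq_coeff_degree)
    then have "?p \<in> carrier (K [X]\<^bsub>?R\<^esub>)"
      using p by (auto simp: univ_poly_def polynomial_def sel coeffs_def coeff_polys)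
    moreover have "?p \<noteq> []" using p by simp
    moreover have "R.eval ?p x = \<zero>\<^bsub>?R\<^esub>" using p by (simp add: eval sel)
    ultimately show "R.algebraic K x" using R.algebraicI by (metis over_def)
  qed
qed

lemma algebraic_closed:
  fixes K :: "'a::field set"
  assumes K: "is_subfield K"
  shows "is_subfield {x. alg K x}"
proof -
  let ?R = "ring_of_type_algebra :: 'a ring"
  interpret R: Ring.field ?R by (rule field_from_type_algebra)
  have "{x \<in> carrier ?R. (R.algebraic over K) x} = {x. alg K x}"
    unfolding over_def using algebraic_iff_alg[OF K] by (simp add: ring_of_type_algebra_def)
  then show ?thesis using R.subfield_of_algebraics[OF K] by simp
qed

lemma alg_base: "subring_set K \<Longrightarrow> a \<in> K \<Longrightarrow> alg K a"
  by (intro sep_imp_alg sep_base)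

lemma alg_adj:
  assumes K: "is_subfield K" and a: "alg K a" and x: "x \<in> adj K a"
  shows "alg K x"
  using adj_least[of "{x. alg K x}" K a] a x alg_base[OF subfield_subring[OF K]]
    subfield_subring[OF algebraic_closed[OF K]] by blast

definition minpoly :: "'a::field set \<Rightarrow> 'a \<Rightarrow> 'a poly" where
  "minpoly K a = (SOME m. m \<in> polys K \<and> plead m = 1 \<and> poly m a = 0 \<and>
     (\<forall>p\<in>polys K. p \<noteq> 0 \<and> poly p a = 0 \<longrightarrow> pdeg m \<le> pdeg p))"

lemma minpoly_props:
  assumes K: "is_subfield K" and a: "alg K a"
  shows "minpoly K a \<in> polys K" "plead (minpoly K a) = 1" "poly (minpoly K a) a = 0"
    "\<And>p. p \<in> polys K \<Longrightarrow> p \<noteq> 0 \<Longrightarrow> poly p a = 0 \<Longrightarrow> pdeg (minpoly K a) \<le> pdeg p"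
proof -
  let ?P = "\<lambda>p. p \<in> polys K \<and> p \<noteq> 0 \<and> poly p a = 0"
  obtain p0 where p0: "?P p0" using a by (auto simp: alg_def)
  define p where "p = arg_min pdeg ?P"
  have p: "?P p" and min: "\<And>q. ?P q \<Longrightarrow> pdeg p \<le> pdeg q"
    unfolding p_def using arg_min_natI[of ?P, OF p0] arg_min_nat_le[of ?P] by blast+
  define m where "m = psmult (inverse (plead p)) p"
  have "m \<in> polys K \<and> plead m = 1 \<and> poly m a = 0 \<and>
     (\<forall>p\<in>polys K. p \<noteq> 0 \<and> poly p a = 0 \<longrightarrow> pdeg m \<le> pdeg p)"
    using p min K unfolding m_def
    by (auto intro!: polys_smult subfield_subring subfield_inverse coeff_polys)
  then have "minpoly K a \<in> polys K \<and> plead (minpoly K a) = 1 \<and> poly (minpoly K a) a = 0 \<and>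
     (\<forall>p\<in>polys K. p \<noteq> 0 \<and> poly p a = 0 \<longrightarrow> pdeg (minpoly K a) \<le> pdeg p)"
    unfolding minpoly_def by (rule someI)
  then show "minpoly K a \<in> polys K" "plead (minpoly K a) = 1" "poly (minpoly K a) a = 0"
    "\<And>p. p \<in> polys K \<Longrightarrow> p \<noteq> 0 \<Longrightarrow> poly p a = 0 \<Longrightarrow> pdeg (minpoly K a) \<le> pdeg p"
    by auto
qed

lemma minpoly_nonzero: "is_subfield K \<Longrightarrow> alg K a \<Longrightarrow> minpoly K a \<noteq> 0"
  using minpoly_props(2) by fastforce

lemma minpoly_divides:
  assumes K: "is_subfield K" and a: "alg K a" and p: "p \<in> polys K" "poly p a = 0"
  shows "\<exists>q\<in>polys K. p = minpoly K a * q"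
proof -
  note m = minpoly_props[OF K a]
  obtain q r where qr: "q \<in> polys K" "r \<in> polys K" "p = minpoly K a * q + r"
    "r = 0 \<or> pdeg r < pdeg (minpoly K a)"
    using monic_division[OF subfield_subring[OF K] m(1,2) p(1)] by blast
  have "poly r a = 0" using p(2) m(3) unfolding qr(3) by simp
  then have "r = 0" using m(4)[OF qr(2)] qr(4) by fastforce
  then show ?thesis using qr by auto
qed

lemma minpoly_dvd: "is_subfield K \<Longrightarrow> alg K a \<Longrightarrow> p \<in> polys K \<Longrightarrow> poly p a = 0 \<Longrightarrow> minpoly K a dvd p"
  using minpoly_divides by fastforce

lemma minpoly_degree_pos:
  assumes "is_subfield K" "alg K a" shows "pdeg (minpoly K a) > 0"
proof (rule ccontr)
  assume "\<not> ?thesis"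
  then obtain c where "minpoly K a = [:c:]" by (metis bot_nat_0.not_eq_extremum degree_0_id)
  then show False using minpoly_props(2,3)[OF assms] by auto
qed

lemma poly_dvd_1_iff: "(p::'a::field poly) dvd 1 \<longleftrightarrow> p \<noteq> 0 \<and> pdeg p = 0"
  using is_unit_iff_degree[of p] by (metis dvd_0_left_iff zero_neq_one)

lemma minpoly_irreducible:
  assumes K: "is_subfield K" and a: "alg K a"
  shows "irreducible_over K (minpoly K a)"
  unfolding irreducible_over_def poly_over_eq_polys
proof (intro conjI ballI impI)
  note m = minpoly_props[OF K a]
  show "minpoly K a \<in> polys K" by (rule m)
  show nz: "minpoly K a \<noteq> 0" by (rule minpoly_nonzero[OF K a])
  show "\<not> minpoly K a dvd 1" using minpoly_degree_pos[OF K a] by (simp add: poly_dvd_1_iff)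
  fix p q assume pq: "p \<in> polys K" "q \<in> polys K" "minpoly K a = p * q"
  then have nz': "p \<noteq> 0" "q \<noteq> 0" using nz by auto
  have deg: "pdeg (minpoly K a) = pdeg p + pdeg q"
    using pq(3) nz' by (simp add: degree_mult_eq)
  have "poly p a = 0 \<or> poly q a = 0" using m(3) pq(3) by simp
  then show "p dvd 1 \<or> q dvd 1"
    using m(4)[OF pq(1) nz'(1)] m(4)[OF pq(2) nz'(2)] deg nz' by (auto simp: poly_dvd_1_iff)
qed

lemma irreducible_over_root:
  assumes K: "is_subfield K" and p: "irreducible_over K p" and a: "poly p a = 0"
  shows "alg K a" "p = psmult (plead p) (minpoly K a)"
proof -
  have p': "p \<in> polys K" "p \<noteq> 0" using p by (auto simp: irreducible_over_def poly_over_eq_polys)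
  then show alg: "alg K a" using a by (auto simp: alg_def)
  obtain q where q: "q \<in> polys K" "p = minpoly K a * q"
    using minpoly_divides[OF K alg p'(1) a] by blast
  have "\<not> minpoly K a dvd 1" using minpoly_degree_pos[OF K alg] by (simp add: poly_dvd_1_iff)
  then have "q dvd 1"
    using p q minpoly_props(1)[OF K alg] unfolding irreducible_over_def poly_over_eq_polys by blast
  then have "pdeg q = 0" by (simp add: poly_dvd_1_iff)
  then obtain c where c: "q = [:c:]" by (metis degree_0_id)
  then have pc: "p = psmult c (minpoly K a)" using q by simp
  have "plead p = c" using lead_coeff_smult[of c "minpoly K a"] minpoly_props(2)[OF K alg] pc by (metis mult.right_neutral)
  then show "p = psmult (plead p) (minpoly K a)"
    by (subst \<open>plead p = c\<close>) (rule pc)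
qed

lemma irreducible_over_monic_root:
  assumes "is_subfield K" "irreducible_over K p" "poly p a = 0" "plead p = 1"
  shows "p = minpoly K a"
  using irreducible_over_root[OF assms(1-3)] assms(4) by simp

lemma minpoly_conjugate:
  assumes K: "is_subfield K" and a: "alg K a" and b: "poly (minpoly K a) b = 0"
  shows "alg K b" "minpoly K b = minpoly K a"
  using irreducible_over_root(1)[OF K minpoly_irreducible[OF K a] b]
    irreducible_over_monic_root[OF K minpoly_irreducible[OF K a] b] minpoly_props(2)[OF K a] by auto

lemma sep_minpoly:
  assumes K: "is_subfield K" and a: "sep K a"
  shows "poly (pderiv (minpoly K a)) a \<noteq> 0"
proof -
  obtain p where p: "p \<in> polys K" "poly p a = 0" "poly (pderiv p) a \<noteq> 0" using a by (auto simp: sep_def)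
  obtain q where "p = minpoly K a * q" using minpoly_divides[OF K sep_imp_alg[OF a] p(1,2)] by blast
  then show ?thesis using p(3) minpoly_props(3)[OF K sep_imp_alg[OF a]]
    by (auto simp: pderiv_mult)
qed

text \<open>All roots share one minimal polynomial, so a multiple root would make it divide its own
  derivative, which is nonzero and of smaller degree.\<close>

lemma sep_minpoly_roots:
  assumes K: "is_subfield K" and a: "sep K a" and b: "poly (minpoly K a) b = 0"
  shows "sep K b" "poly (pderiv (minpoly K a)) b \<noteq> 0"
proof -
  note al = sep_imp_alg[OF a]
  show "poly (pderiv (minpoly K a)) b \<noteq> 0"
  proof
    assume 0: "poly (pderiv (minpoly K a)) b = 0"
    have "minpoly K b dvd pderiv (minpoly K a)"
      by (rule minpoly_dvd[OF K minpoly_conjugate(1)[OF K al b] _ 0])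
         (intro polys_pderiv subfield_subring K minpoly_props al)
    then have dvd: "minpoly K a dvd pderiv (minpoly K a)" using minpoly_conjugate(2)[OF K al b] by simp
    have "pderiv (minpoly K a) \<noteq> 0" using sep_minpoly[OF K a] by auto
    then have "pdeg (minpoly K a) \<le> pdeg (pderiv (minpoly K a))"
      by (rule dvd_imp_degree_le[OF dvd])
    also have "\<dots> \<le> pdeg (minpoly K a) - 1"
      by (rule degree_le) (auto simp: coeff_pderiv coeff_eq_0)
    finally show False using minpoly_degree_pos[OF K al] by simp
  qed
  then show "sep K b" using b minpoly_props(1)[OF K al] by (auto simp: sep_def)
qed

text \<open>Write the minimal polynomial of \<open>x\<close> as \<open>c + X q\<close>. Minimality
  of the degree gives \<open>c \<noteq> 0\<close>, and then \<open>- q(x) / c\<close> is the inverse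
  of \<open>x\<close>.\<close>

lemma adj_subfield:
  assumes K: "is_subfield K" and a: "alg K a"
  shows "is_subfield (adj K a)"
proof (rule is_subfieldI)
  note sr = subfield_subring[OF K]
  show sra: "subring_set (adj K a)" by (rule subring_set_adj[OF sr])
  fix x assume x: "x \<in> adj K a"
  show "inverse x \<in> adj K a"
  proof (cases "x = 0")
    case False
    have al: "alg K x" by (rule alg_adj[OF K a x])
    note m = minpoly_props[OF K al]
    obtain c q where cq: "minpoly K x = pCons c q" by (rule pCons_cases)
    then have q: "q \<in> polys K" "c \<in> K" using m(1) by (auto simp: polys_pCons_iff)
    have "q \<noteq> 0" using cq minpoly_degree_pos[OF K al] by auto
    have e: "c + x * poly q x = 0" using m(3) cq by simp
    have "c \<noteq> 0"
    proof
      assume "c = 0"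
      then have "poly q x = 0" using e False by simp
      then have "pdeg (minpoly K x) \<le> pdeg q" by (rule m(4)[OF q(1) \<open>q \<noteq> 0\<close>])
      then show False using cq \<open>q \<noteq> 0\<close> by simp
    qed
    then have "inverse x = - inverse c * poly q x"
      using e False by (simp add: field_simps eq_neg_iff_add_eq_0)
    moreover have "\<dots> \<in> adj K a"
      using adj_base[OF sr, of _ a] subfield_inverse[OF K q(2)] q
      by (intro subring_set_closed[OF sra] poly_in_subring sra x) (auto simp: polys_def)
    ultimately show ?thesis by simp
  qed (simp add: subring_set_0[OF sra])
qed

lemma infinite_avoid_finite: "infinite J \<Longrightarrow> finite B \<Longrightarrow> \<exists>c\<in>J. c \<notin> B"
  by (meson finite_subset subsetI)

lemma hom_poly_fixed:
  assumes f: "ring_hom_on S f" and fix_K: "\<And>x. x \<in> K \<Longrightarrow> f x = x" and KS: "K \<subseteq> S"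
    and p: "p \<in> polys K" and a: "a \<in> S"
  shows "f (poly p a) = poly p (f a)"
proof -
  interpret ring_hom_on S f by (rule f)
  have "map_poly f p = p"
    using p fix_K by (intro poly_eqI) (simp add: coeff_map_poly_hom polys_def)
  then show ?thesis using poly_map_poly_hom[of p a] p polys_mono[OF KS] a by auto
qed

lemma hom_field_inj:
  fixes f :: "'a::field \<Rightarrow> 'b::field"
  assumes f: "ring_hom_on S f" and S: "is_subfield S" and x: "x \<in> S" "y \<in> S" and "f x = f y"
  shows "x = y"
proof (rule ccontr)
  interpret ring_hom_on S f by (rule f)
  assume "x \<noteq> y"
  have d: "x - y \<in> S" "inverse (x - y) \<in> S"
    using x S subfield_subring[OF S] by (auto intro!: subfield_inverse subring_set_diff)
  have "1 = f ((x - y) * inverse (x - y))" using \<open>x \<noteq> y\<close> by (simp add: hom_1)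
  also have "\<dots> = f (x - y) * f (inverse (x - y))" using d by (rule hom_mult)
  also have "f (x - y) = 0" using x \<open>f x = f y\<close> by (simp add: hom_diff)
  finally show False by simp
qed

section \<open>Conjugates\<close>

text \<open>The homomorphism \<open>K[a] \<rightarrow> K[b]\<close> over \<open>K\<close> with \<open>a \<mapsto> b\<close>; it only makes sense for \<open>b\<close> conjugate to \<open>a\<close>.\<close>

definition emb :: "'a::field set \<Rightarrow> 'a \<Rightarrow> 'a \<Rightarrow> 'a \<Rightarrow> 'a" where
  "emb K a b x = poly (SOME p. p \<in> polys K \<and> x = poly p a) b"

lemma emb_poly:
  assumes K: "is_subfield K" and a: "alg K a" and b: "poly (minpoly K a) b = 0" and p: "p \<in> polys K"
  shows "emb K a b (poly p a) = poly p b"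
proof -
  define p' where "p' = (SOME q. q \<in> polys K \<and> poly p a = poly q a)"
  have "p' \<in> polys K \<and> poly p a = poly p' a"
    unfolding p'_def by (rule someI[of _ p]) (simp add: p)
  then have p': "p' \<in> polys K" "poly (p - p') a = 0" by auto
  have "minpoly K a dvd p - p'"
    by (rule minpoly_dvd[OF K a _ p'(2)])
       (intro subring_set_diff[OF subring_set_polys] subfield_subring K p p')
  then have "poly (p - p') b = 0" using b by (meson poly_eq_0_iff_dvd dvd_trans)
  then show ?thesis by (simp add: emb_def p'_def)
qed

lemma emb_hom:
  assumes K: "is_subfield K" and a: "alg K a" and b: "poly (minpoly K a) b = 0"
  shows "ring_hom_on (adj K a) (emb K a b)"
proof
  note sr = subfield_subring[OF K]
  note pr = subring_set_polys[OF sr]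
  note e = emb_poly[OF K a b]
  show "subring_set (adj K a)" by (rule subring_set_adj[OF sr])
  show "emb K a b 1 = 1" using e[OF subring_set_1[OF pr]] by simp
  fix x y assume "x \<in> adj K a" "y \<in> adj K a"
  then obtain p q where pq: "p \<in> polys K" "x = poly p a" "q \<in> polys K" "y = poly q a" by (metis adjE)
  show "emb K a b (x + y) = emb K a b x + emb K a b y"
    using e[OF subring_set_add[OF pr pq(1,3)]] e[OF pq(1)] e[OF pq(3)] pq by simp
  show "emb K a b (x * y) = emb K a b x * emb K a b y"
    using e[OF subring_set_mult[OF pr pq(1,3)]] e[OF pq(1)] e[OF pq(3)] pq by simp
qed

lemma emb_base:
  assumes K: "is_subfield K" and a: "alg K a" and b: "poly (minpoly K a) b = 0" and x: "x \<in> K"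
  shows "emb K a b x = x"
  using emb_poly[OF K a b polys_const[OF subfield_subring[OF K] x]] by simp

lemma emb_gen:
  assumes K: "is_subfield K" and a: "alg K a" and b: "poly (minpoly K a) b = 0"
  shows "emb K a b a = b"
  using emb_poly[OF K a b polys_linear[OF subfield_subring[OF K], of 0 1]] subfield_subring[OF K]
  by (simp add: subring_set_closed)

lemma emb_in:
  assumes K: "is_subfield K" and a: "alg K a" and b: "poly (minpoly K a) b = 0"
    and x: "x \<in> adj K a" and T: "subring_set T" "K \<subseteq> T" "b \<in> T"
  shows "emb K a b x \<in> T"
proof -
  obtain p where p: "p \<in> polys K" "x = poly p a" using x by (rule adjE)
  then show ?thesis using emb_poly[OF K a b p(1)] poly_in_subring[OF T(1) _ T(3)] polys_mono[OF T(2)] by auto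
qed

lemma emb_minpoly:
  assumes K: "is_subfield K" and a: "alg K a" and b: "poly (minpoly K a) b = 0"
    and x: "x \<in> adj K a"
  shows "poly (minpoly K x) (emb K a b x) = 0"
proof -
  note m = minpoly_props[OF K alg_adj[OF K a x]]
  have "emb K a b (poly (minpoly K x) x) = poly (minpoly K x) (emb K a b x)"
    by (rule hom_poly_fixed[OF emb_hom[OF K a b] emb_base[OF K a b] _ m(1) x])
       (auto intro: adj_base subfield_subring K)
  then show ?thesis using m(3) ring_hom_on.hom_0[OF emb_hom[OF K a b]] by simp
qed

text \<open>A homomorphism over \<open>K\<close> is determined by the image of the generator, which
  must be a conjugate. Automorphisms of K(a) can therefore be replaced by the conjugates of
  \<open>a\<close> in K(a): elements, unlike maps, can be sent through a place.\<close>

lemma hom_eq_emb: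
  assumes K: "is_subfield K" and a: "alg K a" and f: "ring_hom_on S f"
    and S: "adj K a \<subseteq> S" and fix_K: "\<And>x. x \<in> K \<Longrightarrow> f x = x"
  shows "poly (minpoly K a) (f a) = 0" "x \<in> adj K a \<Longrightarrow> f x = emb K a (f a) x"
proof -
  note sr = subfield_subring[OF K]
  have KS: "K \<subseteq> S" and aS: "a \<in> S" using S adj_base[OF sr] adj_self[OF sr] by blast+
  have fp: "f (poly p a) = poly p (f a)" if "p \<in> polys K" for p
    by (rule hom_poly_fixed[OF f _ KS that aS]) (rule fix_K)
  show 0: "poly (minpoly K a) (f a) = 0"
    using fp[OF minpoly_props(1)[OF K a]] minpoly_props(3)[OF K a] ring_hom_on.hom_0[OF f] by simp
  assume "x \<in> adj K a"
  then obtain p where "p \<in> polys K" "x = poly p a" by (rule adjE)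
  then show "f x = emb K a (f a) x" using fp emb_poly[OF K a 0] by simp
qed

text \<open>Both sides fix \<open>K\<close> and agree at \<open>a\<close>. In terms of conjugates,
  the composite of the embeddings belonging to \<open>b\<close> and \<open>c\<close> belongs to
  \<open>emb K a b c\<close>.\<close>

lemma emb_comp:
  assumes K: "is_subfield K" and a: "alg K a" and b: "poly (minpoly K a) b = 0"
    and c: "poly (minpoly K a) c = 0" "c \<in> adj K a" and x: "x \<in> adj K a"
  shows "poly (minpoly K a) (emb K a b c) = 0"
    "emb K a b (emb K a c x) = emb K a (emb K a b c) x"
proof -
  note sr = subfield_subring[OF K]
  have "(emb K a c) ` adj K a \<subseteq> adj K a"
    using emb_in[OF K a c(1) _ subring_set_adj[OF sr] _ c(2)] adj_base[OF sr] by blast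
  then have h: "ring_hom_on (adj K a) (\<lambda>x. emb K a b (emb K a c x))"
    by (rule ring_hom_on_comp[OF emb_hom[OF K a c(1)] emb_hom[OF K a b]])
  have fx: "emb K a b (emb K a c x) = x" if "x \<in> K" for x
    using that by (simp add: emb_base[OF K a] b c)
  show "poly (minpoly K a) (emb K a b c) = 0"
    using hom_eq_emb(1)[OF K a h subset_refl] fx by (simp add: emb_gen[OF K a c(1)])
  show "emb K a b (emb K a c x) = emb K a (emb K a b c) x"
    using hom_eq_emb(2)[OF K a h subset_refl _ x] fx by (simp add: emb_gen[OF K a c(1)])
qed

section \<open>The primitive element theorem\<close>

lemma simple_roots_factorization:
  fixes p :: "'a::alg_closed_field poly"
  assumes p: "p \<noteq> 0" and simple: "\<And>r. poly p r = 0 \<Longrightarrow> poly (pderiv p) r \<noteq> 0"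
  shows "p = psmult (plead p) (\<Prod>r\<in>{r. poly p r = 0}. [:- r, 1:])"
proof -
  obtain A where A: "p = psmult (plead p) (\<Prod>x\<in>#A. [:- x, 1:])"
    using alg_closed_imp_factorization[OF p] by blast
  have lc: "plead p \<noteq> 0" using p by simp
  have root: "poly p r = 0 \<longleftrightarrow> r \<in># A" for r
  proof -
    have "poly (\<Prod>x\<in>#A. [:- x, 1:]) r = 0 \<longleftrightarrow> r \<in># A"
      by (induction A) auto
    then show ?thesis using lc by (subst A) simp
  qed
  have "count A r = 1" if r: "r \<in># A" for r
  proof -
    obtain B where B: "A = add_mset r B" using r by (metis insert_DiffM)
    have "r \<notin># B"
    proof
      assume "r \<in># B"
      then obtain C where C: "A = add_mset r (add_mset r C)" using B by (metis insert_DiffM)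
      define q where "q = psmult (plead p) (\<Prod>x\<in>#C. [:- x, 1:])"
      define l where "l = [:- r, 1:]"
      have "p = l * (l * q)"
        by (subst A) (simp add: C q_def l_def[symmetric] mult_smult_right)
      moreover have "poly l r = 0" by (simp add: l_def)
      ultimately have "poly (pderiv p) r = 0" by (simp add: pderiv_mult)
      then show False using simple r root by blast
    qed
    then show ?thesis using B by (simp add: not_in_iff)
  qed
  then have "A = mset_set (set_mset A)" by (intro multiset_eqI) (metis count_mset_set(1,3) finite_set_mset not_in_iff)
  moreover have "set_mset A = {r. poly p r = 0}" using root by auto
  ultimately have "A = mset_set {r. poly p r = 0}" by simp
  then show ?thesis using A by (simp add: prod_unfold_prod_mset)
qed

lemma minpoly_factorization:
  fixes a :: "'a::alg_closed_field"
  assumes K: "is_subfield K" and a: "sep K a"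
  shows "minpoly K a = (\<Prod>r\<in>{r. poly (minpoly K a) r = 0}. [:- r, 1:])"
  using simple_roots_factorization[OF minpoly_nonzero[OF K sep_imp_alg[OF a]]]
    sep_minpoly_roots(2)[OF K a] minpoly_props(2)[OF K sep_imp_alg[OF a]] by simp

lemma finite_minpoly_roots:
  "is_subfield K \<Longrightarrow> alg K a \<Longrightarrow> finite {r. poly (minpoly K a) r = 0}"
  by (simp add: poly_roots_finite minpoly_nonzero)

text \<open>If \<open>v\<close> were inseparable,
  \<open>poly P v \<mapsto> poly (pderiv P) v\<close> would be a well-defined derivation of K(v)
  over \<open>K\<close>. It kills separable elements such as \<open>a\<close> and \<open>b\<close>,
  hence also \<open>v = a + c * b\<close>, although it sends \<open>v\<close> to 1.\<close>

lemma sep_generator: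
  assumes K: "is_subfield K" and v: "alg K v" "v = a + c * b" "c \<in> K"
    and a: "sep K a" "a \<in> adj K v" and b: "sep K b" "b \<in> adj K v"
  shows "sep K v"
proof (rule ccontr)
  note sr = subfield_subring[OF K]
  assume not_sep: "\<not> sep K v"
  have D: "poly (pderiv q) v = 0" if "q \<in> polys K" "poly q v = 0" for q
    using that not_sep by (auto simp: sep_def)
  \<comment> \<open>Chain rule: the composite of \<open>p\<close> with \<open>P\<close> vanishes at
    \<open>v\<close>, and its derivative there is P'(v) times the nonzero value of p' at
    P(v).\<close>
  have *: "poly (pderiv P) v = 0" if P: "P \<in> polys K" and s: "sep K (poly P v)" for P
  proof -
    obtain p where p: "p \<in> polys K" "poly p (poly P v) = 0" "poly (pderiv p) (poly P v) \<noteq> 0"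
      using s by (auto simp: sep_def)
    have "poly (pderiv (pcompose p P)) v = 0"
      by (rule D) (auto intro!: polys_pcompose sr p P simp: poly_pcompose p)
    then show ?thesis using p by (simp add: pderiv_pcompose poly_pcompose)
  qed
  obtain P where P: "P \<in> polys K" "a = poly P v" using a by (auto elim: adjE)
  obtain Q where Q: "Q \<in> polys K" "b = poly Q v" using b by (auto elim: adjE)
  have "poly (pderiv ([:0, 1:] - P - psmult c Q)) v = 0"
  proof (rule D)
    show "[:0, 1:] - P - psmult c Q \<in> polys K"
      by (intro subring_set_diff[OF subring_set_polys] sr P Q polys_smult v polys_linear
            subring_set_0 subring_set_1)
    show "poly ([:0, 1:] - P - psmult c Q) v = 0"
    proof -
      have "poly ([:0, 1:] - P - psmult c Q) v = v - a - c * b" using P Q by simp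
      then show ?thesis using v(2) by (simp add: algebra_simps)
    qed
  qed
  then show False using *[OF P(1)] *[OF Q(1)] a b P Q
    by (simp add: pderiv_diff pderiv_smult pderiv_pCons)
qed

text \<open>For all but finitely many \<open>c\<close>, the element \<open>b\<close> is the only
  common root of its minimal polynomial and of \<open>minpoly K a\<close> composed with
  \<open>v - c X\<close>. Then \<open>b\<close> has degree one over K(v). The multiplier is taken
  from a prescribed infinite \<open>J\<close>, which limits the shape of the generator.\<close>

lemma primitive_element_two:
  fixes a b :: "'a::alg_closed_field"
  assumes K: "is_subfield K" and J: "J \<subseteq> K" "infinite J" and a: "alg K a" and b: "sep K b"
  shows "\<exists>c\<in>J. alg K (a + c * b) \<and> a \<in> adj K (a + c * b) \<and> b \<in> adj K (a + c * b)"
proof -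
  note sr = subfield_subring[OF K]
  let ?Ra = "{r. poly (minpoly K a) r = 0}" and ?Rb = "{r. poly (minpoly K b) r = 0}"
  \<comment> \<open>The excluded values are those for which some \<open>s \<noteq> b\<close> becomes
    a second common root. For \<open>s = b\<close> division by zero only adds the value 0.\<close>
  have "finite ((\<lambda>(r, s). (r - a) / (b - s)) ` (?Ra \<times> ?Rb))"
    using finite_minpoly_roots[OF K a] finite_minpoly_roots[OF K sep_imp_alg[OF b]] by simp
  then obtain c where c: "c \<in> J" "c \<notin> (\<lambda>(r, s). (r - a) / (b - s)) ` (?Ra \<times> ?Rb)"
    using infinite_avoid_finite[OF J(2)] by blast
  define v where "v = a + c * b"
  have cK: "c \<in> K" using c J by blast
  have alv: "alg K v"
    using subfield_subring[OF algebraic_closed[OF K]] a sep_imp_alg[OF b] alg_base[OF sr cK]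
    unfolding v_def by (metis mem_Collect_eq subring_set_add subring_set_mult)
  define F where "F = adj K v"
  have F: "is_subfield F" unfolding F_def by (rule adj_subfield[OF K alv])
  have KF: "K \<subseteq> F" unfolding F_def using adj_base[OF sr] by blast
  have vF: "v \<in> F" unfolding F_def by (rule adj_self[OF sr])
  note srF = subfield_subring[OF F]
  have sepF: "sep F b" by (rule sep_mono[OF b KF])
  note alF = sep_imp_alg[OF sepF]
  have d1: "minpoly F b dvd minpoly K b"
    using minpoly_props(1,3)[OF K sep_imp_alg[OF b]] polys_mono[OF KF] by (intro minpoly_dvd[OF F alF]) auto
  have d2: "minpoly F b dvd pcompose (minpoly K a) [:v, - c:]"
    using minpoly_props(1,3)[OF K a] polys_mono[OF KF] vF cK KF
    by (intro minpoly_dvd[OF F alF] polys_pcompose srF polys_linear subring_set_minus)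
       (auto simp: poly_pcompose v_def algebra_simps)
  have roots: "s = b" if s: "poly (minpoly F b) s = 0" for s
  proof (rule ccontr)
    assume "s \<noteq> b"
    have "poly (minpoly K b) s = 0" using s d1 by (meson poly_eq_0_iff_dvd dvd_trans)
    moreover have "poly (pcompose (minpoly K a) [:v, - c:]) s = 0"
      using s d2 by (meson poly_eq_0_iff_dvd dvd_trans)
    then have "poly (minpoly K a) (v - c * s) = 0" by (simp add: poly_pcompose mult.commute)
    moreover have "c = ((v - c * s) - a) / (b - s)" using \<open>s \<noteq> b\<close> by (simp add: v_def field_simps)
    ultimately have "c \<in> (\<lambda>(r, s). (r - a) / (b - s)) ` (?Ra \<times> ?Rb)"
      by (intro image_eqI[of _ _ "(v - c * s, s)"]) auto
    then show False using c by blast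
  qed
  have "{r. poly (minpoly F b) r = 0} = {b}" using roots minpoly_props(3)[OF F alF] by blast
  then have "minpoly F b = [:- b, 1:]" using minpoly_factorization[OF F sepF] by simp
  then have "- b \<in> F" using coeff_polys[OF minpoly_props(1)[OF F alF], of 0] by simp
  then have bF: "b \<in> F" using subring_set_minus[OF srF, of "- b"] by simp
  have "v - c * b \<in> F" using bF vF cK KF by (intro subring_set_closed srF) auto
  then have "a \<in> F" by (simp add: v_def)
  then show ?thesis using bF c alv by (auto simp: F_def v_def)
qed

text \<open>Records what a primitive element is built from. Whatever these combinations preserve
  passes from \<open>A\<close> to it: being sent into a given field by an embedding, lying in
  \<open>L\<close>, or being a polynomial in the variables.\<close>

inductive_set lin_combs :: "'a::comm_ring_1 set \<Rightarrow> 'a set \<Rightarrow> 'a set" for J A where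
  lin_combs_base: "a \<in> A \<Longrightarrow> a \<in> lin_combs J A"
| lin_combs_0: "0 \<in> lin_combs J A"
| lin_combs_add: "x \<in> lin_combs J A \<Longrightarrow> y \<in> lin_combs J A \<Longrightarrow> c \<in> J \<Longrightarrow> x + c * y \<in> lin_combs J A"

lemma lin_combs_mono: "x \<in> lin_combs J A \<Longrightarrow> A \<subseteq> B \<Longrightarrow> x \<in> lin_combs J B"
  by (induction rule: lin_combs.induct) (auto intro: lin_combs.intros)

lemma primitive_element:
  fixes A :: "'a::alg_closed_field set"
  assumes K: "is_subfield K" and J: "J \<subseteq> K" "infinite J" and "finite A" and "\<And>a. a \<in> A \<Longrightarrow> sep K a"
  shows "\<exists>v. sep K v \<and> A \<subseteq> adj K v \<and> v \<in> lin_combs J A"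
  using assms(4,5)
proof (induction A rule: finite_induct)
  case empty
  then show ?case using sep_base[OF subfield_subring[OF K] subring_set_0[OF subfield_subring[OF K]]]
    by (intro exI[of _ 0]) (auto intro: lin_combs_0)
next
  case (insert a A)
  note sr = subfield_subring[OF K]
  obtain w where w: "sep K w" "A \<subseteq> adj K w" "w \<in> lin_combs J A"
    using insert by blast
  have a: "sep K a" using insert by blast
  obtain c where c: "c \<in> J" "alg K (a + c * w)" "a \<in> adj K (a + c * w)" "w \<in> adj K (a + c * w)"
    using primitive_element_two[OF K J sep_imp_alg[OF a] w(1)] by blast
  have "sep K (a + c * w)"
    by (rule sep_generator[OF K c(2) refl _ a c(3) w(1) c(4)]) (use c J in blast)
  moreover have "adj K w \<subseteq> adj K (a + c * w)"
    using adj_base[OF sr] by (intro adj_least subring_set_adj sr c) auto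
  moreover have "a + c * w \<in> lin_combs J (insert a A)"
    using c(1) lin_combs_mono[OF w(3), of "insert a A"] by (auto intro: lin_combs.intros)
  ultimately show ?case using w c by (intro exI[of _ "a + c * w"]) auto
qed

section \<open>Normal extensions\<close>

text \<open>Says that K(w)/K is finite Galois, in terms of a generator.\<close>

definition normal_gen :: "'a::field set \<Rightarrow> 'a \<Rightarrow> bool" where
  "normal_gen K w \<longleftrightarrow> sep K w \<and> (\<forall>r. poly (minpoly K w) r = 0 \<longrightarrow> r \<in> adj K w)"

lemma card_minpoly_roots:
  fixes a :: "'a::alg_closed_field"
  assumes K: "is_subfield K" and a: "sep K a"
  shows "card {r. poly (minpoly K a) r = 0} = pdeg (minpoly K a)"
proof -
  have "pdeg (minpoly K a) = pdeg (\<Prod>r\<in>{r. poly (minpoly K a) r = 0}. [:- r, 1:])"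
    using minpoly_factorization[OF K a] by simp
  also have "\<dots> = (\<Sum>r\<in>{r. poly (minpoly K a) r = 0}. pdeg [:- r, 1:])"
    by (rule degree_prod_eq_sum_degree) auto
  finally show ?thesis by simp
qed

text \<open>Write \<open>u\<close> as Q(w) with \<open>Q\<close> of degree below that of the minimal
  polynomial. Then \<open>Q - u\<close> vanishes at every conjugate of \<open>w\<close>, which is
  more often than its degree allows, so \<open>Q\<close> is the constant \<open>u\<close>. The
  embeddings may lead out of K(w).\<close>

lemma fixed_by_conjugates:
  fixes w :: "'a::alg_closed_field"
  assumes K: "is_subfield K" and w: "sep K w" and u: "u \<in> adj K w"
    and fixed: "\<And>r. poly (minpoly K w) r = 0 \<Longrightarrow> emb K w r u = u"
  shows "u \<in> K"
proof -
  note sr = subfield_subring[OF K]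
  note al = sep_imp_alg[OF w]
  note m = minpoly_props[OF K al]
  obtain Q0 where Q0: "Q0 \<in> polys K" "u = poly Q0 w" using u by (rule adjE)
  obtain q Q where Q: "Q \<in> polys K" "Q0 = minpoly K w * q + Q"
    "Q = 0 \<or> pdeg Q < pdeg (minpoly K w)"
    using monic_division[OF sr m(1,2) Q0(1)] by blast
  have uQ: "u = poly Q w" using Q0 Q m(3) by simp
  have "Q - [:u:] = 0"
  proof (rule ccontr)
    assume nz: "Q - [:u:] \<noteq> 0"
    have "{r. poly (minpoly K w) r = 0} \<subseteq> {r. poly (Q - [:u:]) r = 0}"
      using fixed emb_poly[OF K al _ Q(1)] uQ by auto
    then have "card {r. poly (minpoly K w) r = 0} \<le> card {r. poly (Q - [:u:]) r = 0}"
      by (rule card_mono[OF poly_roots_finite[OF nz]])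
    also have "\<dots> \<le> pdeg (Q - [:u:])" by (rule card_poly_roots_bound[OF nz])
    also have "\<dots> \<le> pdeg Q" by (metis degree_diff_le degree_pCons_0 le_refl zero_le)
    finally show False using Q(3) minpoly_degree_pos[OF K al] card_minpoly_roots[OF K w] by auto
  qed
  then have "u = pcoeff Q 0" by (metis coeff_pCons_0 eq_iff_diff_eq_0)
  then show ?thesis using coeff_polys[OF Q(1)] by simp
qed

text \<open>The product of \<open>X - x\<close> over the orbit of \<open>u\<close> is invariant
  under all embeddings, hence has coefficients in \<open>K\<close>. Since the factors are distinct,
  \<open>u\<close> is a simple root; since the minimal polynomial of \<open>u\<close> divides the
  product, the conjugates of \<open>u\<close> lie in the orbit.\<close>

lemma normal_gen_conjugates:
  fixes w :: "'a::alg_closed_field"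
  assumes K: "is_subfield K" and w: "normal_gen K w" and u: "u \<in> adj K w"
  shows "sep K u" "poly (minpoly K u) r = 0 \<Longrightarrow> \<exists>s. poly (minpoly K w) s = 0 \<and> emb K w s u = r"
proof -
  note sr = subfield_subring[OF K]
  have sw: "sep K w" and N: "\<And>r. poly (minpoly K w) r = 0 \<Longrightarrow> r \<in> adj K w"
    using w by (auto simp: normal_gen_def)
  note al = sep_imp_alg[OF sw]
  have sra: "subring_set (adj K w)" by (rule subring_set_adj[OF sr])
  have fa: "is_subfield (adj K w)" by (rule adj_subfield[OF K al])
  let ?R = "{r. poly (minpoly K w) r = 0}"
  define Orb where "Orb = (\<lambda>s. emb K w s u) ` ?R"
  have finOrb: "finite Orb" unfolding Orb_def using finite_minpoly_roots[OF K al] by simp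
  have Xa: "Orb \<subseteq> adj K w"
    unfolding Orb_def using emb_in[OF K al _ u sra] N adj_base[OF sr] by blast
  define h where "h = (\<Prod>x\<in>Orb. [:- x, 1:])"
  have ha: "h \<in> polys (adj K w)" unfolding h_def
    using Xa by (intro subring_set_prod[OF subring_set_polys[OF sra]] polys_linear sra)
      (auto intro: subring_set_closed sra)
  have perm: "emb K w r ` Orb = Orb" if r: "r \<in> ?R" for r
  proof (rule endo_inj_surj[OF finOrb])
    have r': "poly (minpoly K w) r = 0" using r by simp
    show "emb K w r ` Orb \<subseteq> Orb"
    proof
      fix y assume "y \<in> emb K w r ` Orb"
      then obtain s where s: "poly (minpoly K w) s = 0" "y = emb K w r (emb K w s u)"
        by (auto simp: Orb_def)
      then show "y \<in> Orb" using emb_comp[OF K al r' s(1) N[OF s(1)] u] by (auto simp: Orb_def)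
    qed
    show "inj_on (emb K w r) Orb"
      using hom_field_inj[OF emb_hom[OF K al r'] fa] Xa by (meson inj_onI subsetD)
  qed
  have "h \<in> polys K" unfolding polys_def
  proof (intro CollectI allI)
    fix i
    show "pcoeff h i \<in> K"
    proof (rule fixed_by_conjugates[OF K sw coeff_polys[OF ha]])
      fix r assume r: "poly (minpoly K w) r = 0"
      interpret e: ring_hom_on "adj K w" "emb K w r" by (rule emb_hom[OF K al r])
      interpret mp: ring_hom_on "polys (adj K w)" "map_poly (emb K w r)" by (rule e.map_poly_hom)
      have "map_poly (emb K w r) h = (\<Prod>x\<in>Orb. map_poly (emb K w r) [:- x, 1:])"
        unfolding h_def using Xa
        by (intro mp.hom_prod polys_linear sra) (auto intro: subring_set_closed sra)
      also have "\<dots> = (\<Prod>x\<in>Orb. [:- emb K w r x, 1:])"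
        using Xa by (intro prod.cong refl) (auto simp: e.map_poly_pCons_hom e.hom_minus e.hom_1 subsetD)
      also have "\<dots> = (\<Prod>y\<in>emb K w r ` Orb. [:- y, 1:])"
        using hom_field_inj[OF emb_hom[OF K al r] fa] Xa
        by (subst prod.reindex) (auto intro!: inj_onI)
      also have "\<dots> = h" using perm r by (simp add: h_def)
      finally show "emb K w r (pcoeff h i) = pcoeff h i"
        using e.coeff_map_poly_hom[of h i] by simp
    qed
  qed
  moreover have "u \<in> Orb"
  proof -
    have "emb K w w u = u"
      using u emb_poly[OF K al minpoly_props(3)[OF K al]] by (auto elim: adjE)
    then show ?thesis unfolding Orb_def using minpoly_props(3)[OF K al] by (metis (mono_tags) image_eqI mem_Collect_eq)
  qed
  moreover have hOrb: "poly h y = 0 \<longleftrightarrow> y \<in> Orb" for y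
    unfolding h_def using finOrb by (auto simp: poly_prod)
  moreover have "poly (pderiv h) u \<noteq> 0"
  proof -
    define l where "l = [:- u, 1:]"
    have l: "poly l u = 0" "pderiv l = 1" by (simp_all add: l_def pderiv_pCons)
    have "h = l * (\<Prod>x\<in>Orb - {u}. [:- x, 1:])"
      unfolding h_def l_def using finOrb \<open>u \<in> Orb\<close> by (rule prod.remove)
    then have "poly (pderiv h) u = poly (\<Prod>x\<in>Orb - {u}. [:- x, 1:]) u"
      by (simp add: pderiv_mult l)
    also have "\<dots> \<noteq> 0" using finOrb by (auto simp: poly_prod)
    finally show ?thesis .
  qed
  ultimately show su: "sep K u" by (auto simp: sep_def)
  assume "poly (minpoly K u) r = 0"
  moreover have "minpoly K u dvd h"
    by (rule minpoly_dvd[OF K sep_imp_alg[OF su] \<open>h \<in> polys K\<close>]) (simp add: hOrb \<open>u \<in> Orb\<close>)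
  ultimately have "poly h r = 0" by (meson poly_eq_0_iff_dvd dvd_trans)
  then show "\<exists>s. poly (minpoly K w) s = 0 \<and> emb K w s u = r" using hOrb by (auto simp: Orb_def)
qed

text \<open>By \<open>conj\<close>, an embedding of K(w) sends \<open>A\<close> into itself and
  therefore combinations of elements of \<open>A\<close> into K(w). The primitive element
  \<open>w\<close> is such a combination.\<close>

lemma normal_gen_exists:
  fixes A :: "'a::alg_closed_field set"
  assumes K: "is_subfield K" "infinite K" and A: "finite A" "\<And>a. a \<in> A \<Longrightarrow> sep K a"
    and conj: "\<And>a r. a \<in> A \<Longrightarrow> poly (minpoly K a) r = 0 \<Longrightarrow> r \<in> A"
  shows "\<exists>w. normal_gen K w \<and> A \<subseteq> adj K w"
proof -
  note sr = subfield_subring[OF K(1)]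
  obtain w where w: "sep K w" "A \<subseteq> adj K w"
    "w \<in> lin_combs K A"
    using primitive_element[OF K(1) subset_refl K(2) A] by blast
  note al = sep_imp_alg[OF w(1)]
  have sra: "subring_set (adj K w)" by (rule subring_set_adj[OF sr])
  have "r \<in> adj K w" if r: "poly (minpoly K w) r = 0" for r
  proof -
    interpret e: ring_hom_on "adj K w" "emb K w r" by (rule emb_hom[OF K(1) al r])
    have "x \<in> adj K w \<and> emb K w r x \<in> adj K w" if "x \<in> lin_combs K A" for x
      using that
    proof (induction rule: lin_combs.induct)
      case (lin_combs_base a)
      then show ?case using w(2) emb_minpoly[OF K(1) al r] conj by blast
    next
      case lin_combs_0
      then show ?case using subring_set_0[OF sra] by (simp add: e.hom_0)
    next
      case (lin_combs_add x y c)
      then show ?case using adj_base[OF sr, of c w] emb_base[OF K(1) al r, of c]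
        by (simp add: e.hom_add e.hom_mult subring_set_add[OF sra] subring_set_mult[OF sra])
    qed
    from this[OF w(3)]
    show ?thesis by (simp add: emb_gen[OF K(1) al r])
  qed
  then show ?thesis using w by (auto simp: normal_gen_def)
qed

lemma normal_closure_exists:
  fixes z :: "'a::alg_closed_field"
  assumes K: "is_subfield K" "infinite K" and z: "sep K z"
  shows "\<exists>w. normal_gen K w \<and> {r. poly (minpoly K z) r = 0} \<subseteq> adj K w"
proof (rule normal_gen_exists[OF K finite_minpoly_roots[OF K(1) sep_imp_alg[OF z]]])
  fix a r assume "a \<in> {r. poly (minpoly K z) r = 0}"
  then show "sep K a" "poly (minpoly K a) r = 0 \<Longrightarrow> r \<in> {r. poly (minpoly K z) r = 0}"
    using sep_minpoly_roots(1)[OF K(1) z] minpoly_conjugate(2)[OF K(1) sep_imp_alg[OF z]] by auto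
qed

text \<open>Inside a finite Galois extension that contains \<open>z\<close>, every element is a
  simple root of its orbit polynomial.\<close>

lemma sep_adj:
  fixes z :: "'a::alg_closed_field"
  assumes K: "is_subfield K" "infinite K" and z: "sep K z" and u: "u \<in> adj K z"
  shows "sep K u"
proof -
  note sr = subfield_subring[OF K(1)]
  obtain w where w: "normal_gen K w" "{r. poly (minpoly K z) r = 0} \<subseteq> adj K w"
    using normal_closure_exists[OF K z] by blast
  then have "z \<in> adj K w" using minpoly_props(3)[OF K(1) sep_imp_alg[OF z]] by blast
  then have "adj K z \<subseteq> adj K w" using adj_base[OF sr] by (intro adj_least subring_set_adj sr) auto
  then show ?thesis using normal_gen_conjugates(1)[OF K(1) w(1)] u by blast
qed

text \<open>The part of the Galois correspondence on which the specialization rests: an element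
  outside K(v) is moved by an automorphism over K(v). It is \<open>fixed_by_conjugates\<close> with
  K(v) as base field.\<close>

lemma normal_gen_moves:
  fixes w :: "'a::alg_closed_field"
  assumes K: "is_subfield K" and w: "normal_gen K w" and v: "v \<in> adj K w"
    and u: "u \<in> adj K w" "u \<notin> adj K v"
  shows "\<exists>s. poly (minpoly K w) s = 0 \<and> emb K w s v = v \<and> emb K w s u \<noteq> u"
proof -
  note sr = subfield_subring[OF K]
  have sw: "sep K w" using w by (simp add: normal_gen_def)
  note al = sep_imp_alg[OF sw]
  define F where "F = adj K v"
  have F: "is_subfield F" unfolding F_def by (rule adj_subfield[OF K alg_adj[OF K al v]])
  have KF: "K \<subseteq> F" unfolding F_def using adj_base[OF sr] by blast
  have swF: "sep F w" by (rule sep_mono[OF sw KF])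
  note alF = sep_imp_alg[OF swF]
  have dvd: "minpoly F w dvd minpoly K w"
    using minpoly_props(1,3)[OF K al] polys_mono[OF KF] by (intro minpoly_dvd[OF F alF]) auto
  have sub: "adj K w \<subseteq> adj F w" using polys_mono[OF KF] by (auto simp: adj_def)
  obtain s where s: "poly (minpoly F w) s = 0" "emb F w s u \<noteq> u"
    using fixed_by_conjugates[OF F swF, of u] u sub by (auto simp: F_def)
  have s': "poly (minpoly K w) s = 0" using s(1) dvd by (meson poly_eq_0_iff_dvd dvd_trans)
  \<comment> \<open>Both embeddings substitute \<open>s\<close> for \<open>w\<close> in a polynomial
    over \<open>K\<close>.\<close>
  have eq: "emb F w s x = emb K w s x" if x: "x \<in> adj K w" for x
  proof -
    obtain p where "p \<in> polys K" "x = poly p w" using x by (rule adjE)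
    then show ?thesis using emb_poly[OF F alF s(1)] emb_poly[OF K al s'] polys_mono[OF KF] by auto
  qed
  have "v \<in> F" unfolding F_def by (rule adj_self[OF sr])
  then have "emb K w s v = v" using eq[OF v] emb_base[OF F alF s(1)] by simp
  then show ?thesis using s s' eq u by auto
qed

section \<open>Specialization of automorphism groups\<close>

lemma hom_image_subfield:
  fixes f :: "'a::field \<Rightarrow> 'b::field"
  assumes f: "ring_hom_on K f" and K: "is_subfield K"
  shows "is_subfield (f ` K)"
proof (rule is_subfieldI)
  interpret ring_hom_on K f by (rule f)
  show "subring_set (f ` K)" by (rule hom_image_subring)
  fix x assume "x \<in> f ` K"
  then obtain y where y: "y \<in> K" "x = f y" by blast
  show "inverse x \<in> f ` K"
  proof (cases "y = 0")
    case False
    have "f y * f (inverse y) = 1"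
      using hom_mult[OF y(1) subfield_inverse[OF K y(1)]] False by (simp add: hom_1)
    then have "inverse x = f (inverse y)" using y by (simp add: inverse_unique)
    then show ?thesis using subfield_inverse[OF K y(1)] by blast
  qed (use y in \<open>auto simp: hom_0 image_iff intro!: bexI[of _ 0]\<close>)
qed

lemma map_poly_inj_on:
  fixes f :: "'a::field \<Rightarrow> 'b::field"
  assumes f: "ring_hom_on K f" and K: "is_subfield K" and p: "p \<in> polys K" "q \<in> polys K"
    and eq: "map_poly f p = map_poly f q"
  shows "p = q"
proof (rule poly_eqI)
  fix i
  have "f (pcoeff p i) = f (pcoeff q i)"
    using ring_hom_on.coeff_map_poly_hom[OF f] eq by metis
  then show "pcoeff p i = pcoeff q i"
    using hom_field_inj[OF f K] coeff_polys p by blast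
qed

lemma map_poly_degree_hom:
  fixes f :: "'a::field \<Rightarrow> 'b::field"
  assumes f: "ring_hom_on K f" and K: "is_subfield K" and p: "p \<in> polys K"
  shows "pdeg (map_poly f p) = pdeg p"
proof (cases "p = 0")
  case False
  interpret ring_hom_on K f by (rule f)
  have "f (plead p) \<noteq> 0"
    using hom_field_inj[OF f K coeff_polys[OF p] subring_set_0[OF subring]] hom_0 False
      leading_coeff_0_iff[of p] by metis
  then show ?thesis by (rule map_poly_degree_eq)
qed simp

lemma polys_image:
  fixes f :: "'a::field \<Rightarrow> 'b::field"
  assumes f: "ring_hom_on K f" and p: "p \<in> polys (f ` K)"
  shows "\<exists>q\<in>polys K. p = map_poly f q"
proof -
  interpret ring_hom_on K f by (rule f)
  \<comment> \<open>The preimage of 0 has to be 0, because \<open>map_poly\<close> leaves the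
    coefficients beyond the degree at zero.\<close>
  define g where "g x = (if x = 0 then 0 else SOME y. y \<in> K \<and> f y = x)" for x
  have g: "g x \<in> K \<and> f (g x) = x" if "x \<in> f ` K" for x
  proof -
    have "\<exists>y. y \<in> K \<and> f y = x" using that by blast
    then show ?thesis unfolding g_def using someI_ex[of "\<lambda>y. y \<in> K \<and> f y = x"] subring_set_0[OF subring] hom_0 by auto
  qed
  have "g 0 = 0" by (simp add: g_def)
  then have "map_poly g p \<in> polys K" using g p by (auto simp: polys_def coeff_map_poly)
  moreover have "p = map_poly f (map_poly g p)"
    using g p \<open>g 0 = 0\<close> by (intro poly_eqI) (auto simp: polys_def coeff_map_poly hom_0)
  ultimately show ?thesis by blast
qed

text \<open>A homomorphism is injective on a field and polynomials over the image lift, so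
  factorizations over \<open>K\<close> and over its image correspond.\<close>

lemma irreducible_over_map_poly:
  fixes f :: "'a::field \<Rightarrow> 'b::field"
  assumes f: "ring_hom_on K f" and K: "is_subfield K" and p: "irreducible_over K p"
  shows "irreducible_over (f ` K) (map_poly f p)"
proof -
  interpret ring_hom_on K f by (rule f)
  have pK: "p \<in> polys K" "p \<noteq> 0" "\<not> p dvd 1" using p by (auto simp: irreducible_over_def poly_over_eq_polys)
  note deg = map_poly_degree_hom[OF f K]
  have unit: "map_poly f q dvd 1 \<longleftrightarrow> q dvd 1" if "q \<in> polys K" for q
    using deg[OF that] map_poly_inj_on[OF f K that polys_0[OF subring]]
    by (auto simp: poly_dvd_1_iff)
  show ?thesis
    unfolding irreducible_over_def poly_over_eq_polys
  proof (intro conjI ballI impI)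
    show "map_poly f p \<in> polys (f ` K)" using pK by (auto simp: polys_def coeff_map_poly_hom)
    show "map_poly f p \<noteq> 0" using map_poly_inj_on[OF f K pK(1) polys_0[OF subring]] pK by auto
    show "\<not> map_poly f p dvd 1" using unit pK by blast
    fix a b assume ab: "a \<in> polys (f ` K)" "b \<in> polys (f ` K)" "map_poly f p = a * b"
    obtain a' b' where a': "a' \<in> polys K" "a = map_poly f a'" and b': "b' \<in> polys K" "b = map_poly f b'"
      using polys_image[OF f ab(1)] polys_image[OF f ab(2)] by blast
    interpret mp: ring_hom_on "polys K" "map_poly f" by (rule map_poly_hom)
    have "map_poly f p = map_poly f (a' * b')" using ab a' b' by (simp add: mp.hom_mult)
    then have "p = a' * b'"
      by (rule map_poly_inj_on[OF f K pK(1) subring_set_mult[OF subring_set_polys[OF subring] a'(1) b'(1)]])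
    then have "a' dvd 1 \<or> b' dvd 1" using p a' b' unfolding irreducible_over_def poly_over_eq_polys by blast
    then show "a dvd 1 \<or> b dvd 1" using unit a' b' by blast
  qed
qed

lemma irreducible_over_simple_roots:
  assumes K: "is_subfield K" and p: "irreducible_over K p" and d: "pderiv p \<noteq> 0" and r: "poly p r = 0"
  shows "poly (pderiv p) r \<noteq> 0"
proof
  assume 0: "poly (pderiv p) r = 0"
  have pK: "p \<in> polys K" "p \<noteq> 0" using p by (auto simp: irreducible_over_def poly_over_eq_polys)
  note al = irreducible_over_root(1)[OF K p r]
  have deg: "pdeg p = pdeg (minpoly K r)"
    using irreducible_over_root(2)[OF K p r] pK by (metis degree_smult_eq leading_coeff_0_iff)
  have "minpoly K r dvd pderiv p"
    by (rule minpoly_dvd[OF K al polys_pderiv[OF subfield_subring[OF K] pK(1)] 0])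
  then have "pdeg p \<le> pdeg (pderiv p)"
    unfolding deg using d by (rule dvd_imp_degree_le)
  also have "\<dots> \<le> pdeg p - 1" by (rule degree_le) (auto simp: coeff_pderiv coeff_eq_0)
  finally show False using minpoly_degree_pos[OF K al] deg by simp
qed

lemma rsquarefreeI_simple_roots:
  fixes p :: "'a::field poly"
  assumes p: "p \<noteq> 0" and simple: "\<And>r. poly p r = 0 \<Longrightarrow> poly (pderiv p) r \<noteq> 0"
  shows "rsquarefree p"
  unfolding rsquarefree_def
proof (intro conjI allI p)
  fix a
  show "order a p = 0 \<or> order a p = 1"
  proof (rule ccontr)
    assume "\<not> ?thesis"
    then have "2 \<le> order a p" by simp
    then have "[:- a, 1:] ^ 2 dvd p" by (meson order_1 le_imp_power_dvd dvd_trans)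
    then obtain q where q: "p = [:- a, 1:] ^ 2 * q" by (rule dvdE)
    define l where "l = [:- a, 1:]"
    have "p = l * (l * q)" using q by (simp only: l_def power2_eq_square mult.assoc)
    moreover have "poly l a = 0" by (simp add: l_def)
    ultimately have "poly p a = 0" "poly (pderiv p) a = 0" by (simp_all add: pderiv_mult)
    then show False using simple by blast
  qed
qed

lemma rsquarefree_imp_simple_roots:
  fixes p :: "'a::field poly"
  assumes p: "rsquarefree p" and r: "poly p r = 0"
  shows "poly (pderiv p) r \<noteq> 0"
proof
  assume 0: "poly (pderiv p) r = 0"
  obtain q where q: "p = [:- r, 1:] * q" using r by (metis poly_eq_0_iff_dvd dvdE)
  define l where "l = [:- r, 1:]"
  have l: "poly l r = 0" "pderiv l = 1" by (simp_all add: l_def pderiv_pCons)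
  have pl: "p = l * q" using q by (simp add: l_def)
  have "poly q r = 0" using 0 by (simp add: pl pderiv_mult l)
  then obtain q' where "q = l * q'" unfolding l_def by (metis poly_eq_0_iff_dvd dvdE)
  then have "l ^ 2 dvd p" using pl by (simp add: power2_eq_square mult.assoc[symmetric])
  then have "2 \<le> order r p" using p unfolding l_def rsquarefree_def by (meson order_divides)
  then show False using p unfolding rsquarefree_def by (metis numeral_le_one_iff not_numeral_le_zero semiring_norm(69))
qed

text \<open>Division by the monic minimal polynomial works over \<open>V\<close>, so this polynomial
  generates the kernel of V[X] \<rightarrow> V[w]. Sending \<open>X\<close> to a root
  \<open>w0\<close> of its image therefore induces a map on V[w].\<close>

lemma extend_place:
  fixes K :: "'c::field set" and s :: "'c \<Rightarrow> 'd::field"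
  assumes K: "is_subfield K" and s: "ring_hom_on V s" and OK: "V \<subseteq> K" and w: "alg K w"
    and m: "minpoly K w \<in> polys V" and w0: "poly (map_poly s (minpoly K w)) w0 = 0"
  shows "\<exists>psi. ring_hom_on (adj V w) psi \<and> (\<forall>p\<in>polys V. psi (poly p w) = poly (map_poly s p) w0)"
proof -
  interpret s: ring_hom_on V s by (rule s)
  interpret mp: ring_hom_on "polys V" "map_poly s" by (rule s.map_poly_hom)
  note pr = subring_set_polys[OF s.subring]
  define psi where "psi x = poly (map_poly s (SOME p. p \<in> polys V \<and> x = poly p w)) w0" for x
  have psi: "psi (poly p w) = poly (map_poly s p) w0" if p: "p \<in> polys V" for p
  proof -
    define q where "q = (SOME q. q \<in> polys V \<and> poly p w = poly q w)"
    have q: "q \<in> polys V \<and> poly p w = poly q w" unfolding q_def by (rule someI[of _ p]) (simp add: p)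
    then have d: "p - q \<in> polys V" using p pr subring_set_diff by blast
    obtain u r where ur: "u \<in> polys V" "r \<in> polys V" "p - q = minpoly K w * u + r"
      "r = 0 \<or> pdeg r < pdeg (minpoly K w)"
      using monic_division[OF s.subring m minpoly_props(2)[OF K w] d] by blast
    have "poly (p - q) w = 0" using q by simp
    then have "poly r w = 0" using minpoly_props(3)[OF K w] unfolding ur(3) by simp
    then have "r = 0" using minpoly_props(4)[OF K w, of r] ur(2,4) polys_mono[OF OK] by fastforce
    then have "map_poly s (p - q) = map_poly s (minpoly K w) * map_poly s u"
      using ur m by (simp add: mp.hom_mult)
    then have "poly (map_poly s p - map_poly s q) w0 = 0"
      using mp.hom_diff[of p q] p q w0 by simp
    then show ?thesis unfolding psi_def q_def by simp
  qed
  have "ring_hom_on (adj V w) psi"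
  proof
    show "subring_set (adj V w)" by (rule subring_set_adj[OF s.subring])
    show "psi 1 = 1" using psi[OF subring_set_1[OF pr]] by (simp add: mp.hom_1)
    fix x y assume "x \<in> adj V w" "y \<in> adj V w"
    then obtain p q where pq: "p \<in> polys V" "x = poly p w" "q \<in> polys V" "y = poly q w" by (metis adjE)
    show "psi (x + y) = psi x + psi y"
      using psi[OF subring_set_add[OF pr pq(1,3)]] psi[OF pq(1)] psi[OF pq(3)] pq
      by (simp add: mp.hom_add)
    show "psi (x * y) = psi x * psi y"
      using psi[OF subring_set_mult[OF pr pq(1,3)]] psi[OF pq(1)] psi[OF pq(3)] pq
      by (simp add: mp.hom_mult)
  qed
  then show ?thesis using psi by blast
qed

lemma polysI_coeffs:
  assumes V: "subring_set V" and "set (coeffs p) \<subseteq> V"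
  shows "p \<in> polys V"
  unfolding polys_def
proof (intro CollectI allI)
  fix i
  show "pcoeff p i \<in> V"
  proof (cases "p = 0 \<or> pdeg p < i")
    case True
    then show ?thesis using subring_set_0[OF V] by (auto simp: coeff_eq_0)
  next
    case False
    then show ?thesis using coeff_in_coeffs[of p i] assms(2) by auto
  qed
qed

text \<open>A finite set of elements of K(a) involves finitely many coefficients. This turns demands
  on an extension of the place into the finite set \<open>C\<close> on which the place itself has to
  be defined.\<close>

lemma finite_coeff_support:
  assumes "finite E" "E \<subseteq> adj K a"
  shows "\<exists>C. finite C \<and> C \<subseteq> K \<and> (\<forall>V. subring_set V \<and> C \<subseteq> V \<longrightarrow> E \<subseteq> adj V a)"
  using assms
proof (induction E rule: finite_induct)
  case empty
  show ?case by (intro exI[of _ "{}"]) auto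
next
  case (insert e E)
  then have "E \<subseteq> adj K a" by simp
  from insert.IH[OF this]
  obtain C where C: "finite C \<and> C \<subseteq> K \<and> (\<forall>V. subring_set V \<and> C \<subseteq> V \<longrightarrow> E \<subseteq> adj V a)"
    by (elim exE) (rule that)
  obtain p where p: "p \<in> polys K" "e = poly p a" using insert by (auto elim: adjE)
  have "e \<in> adj V a" if "subring_set V" "set (coeffs p) \<subseteq> V" for V
    using polysI_coeffs[OF that] p(2) adjI by blast
  moreover have "set (coeffs p) \<subseteq> K" using p by (auto simp: coeffs_def polys_def split: if_splits)
  ultimately show ?case using C
    by (intro exI[of _ "C \<union> set (coeffs p)"]) simp
qed

text \<open>The hypothesis \<open>hilbert\<close> is what Hilbert irreducibility provides: a place of \<open>K\<close> with residue
  field in \<open>k0\<close>, defined on \<open>C\<close>, that keeps the minimal polynomial of \<open>w\<close> irreducible. It is used for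
  a generator \<open>w\<close> of the normal closure of \<open>K(v)\<close>, whose Galois group is then preserved.\<close>

theorem specialize_automorphisms:
  fixes K k1 :: "'c::alg_closed_field set" and k0 :: "'d::alg_closed_field set"
  assumes K: "is_subfield K" "infinite K" and k0: "is_subfield k0"
    and hilbert: "\<And>w C. sep K w \<Longrightarrow> finite C \<Longrightarrow> C \<subseteq> K \<Longrightarrow>
      \<exists>V s. ring_hom_on V s \<and> V \<subseteq> K \<and> C \<subseteq> V \<and> k1 \<subseteq> V \<and> (\<forall>x\<in>k1. s x = kap x) \<and> s ` V \<subseteq> k0 \<and>
        minpoly K w \<in> polys V \<and> irreducible_over k0 (map_poly s (minpoly K w))"
    and v: "sep K v" and Z: "finite Z" "Z \<subseteq> adj K v"
  defines "Cj \<equiv> {r \<in> adj K v. poly (minpoly K v) r = 0}"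
  obtains D psi where "ring_hom_on D psi" "k1 \<subseteq> D" "\<And>x. x \<in> k1 \<Longrightarrow> psi x = kap x" "Z \<subseteq> D"
    "sep k0 (psi v)" "\<And>z. z \<in> Z \<Longrightarrow> psi z \<in> adj k0 (psi v)"
    "\<And>r. r \<in> Cj \<Longrightarrow> poly (minpoly k0 (psi v)) (psi r) = 0 \<and> psi r \<in> adj k0 (psi v)"
    "\<And>r z. r \<in> Cj \<Longrightarrow> z \<in> Z \<Longrightarrow> psi (emb K v r z) = emb k0 (psi v) (psi r) (psi z)"
    "\<And>x. x \<in> adj k0 (psi v) \<Longrightarrow> poly (minpoly k0 (psi v)) x = 0 \<Longrightarrow> \<exists>r\<in>Cj. x = psi r"
    "inj_on psi Cj"
proof -
  note sr = subfield_subring[OF K(1)]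
  note alv = sep_imp_alg[OF v]
  let ?Rv = "{r. poly (minpoly K v) r = 0}"
  have finRv: "finite ?Rv" by (rule finite_minpoly_roots[OF K(1) alv])
  obtain w where w: "normal_gen K w" and Rvw: "?Rv \<subseteq> adj K w"
    using normal_closure_exists[OF K v] by blast
  have sw: "sep K w" using w by (simp add: normal_gen_def)
  note alw = sep_imp_alg[OF sw]
  let ?Rw = "{r. poly (minpoly K w) r = 0}"
  have finRw: "finite ?Rw" by (rule finite_minpoly_roots[OF K(1) alw])
  have Rww: "?Rw \<subseteq> adj K w" using w by (auto simp: normal_gen_def)
  have fw: "is_subfield (adj K w)" by (rule adj_subfield[OF K(1) alw])
  note srw = subfield_subring[OF fw]
  have Kw: "K \<subseteq> adj K w" using adj_base[OF sr] by blast
  define dw where "dw = poly (pderiv (minpoly K w)) w"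
  have dw: "dw \<noteq> 0" unfolding dw_def by (rule sep_minpoly[OF K(1) sw])
  have dww: "dw \<in> adj K w" unfolding dw_def
    by (rule adjI[OF polys_pderiv[OF sr minpoly_props(1)[OF K(1) alw]]])
  \<comment> \<open>Besides the conjugates, the place has to be defined on inverses:
    \<open>inverse dw\<close> keeps the reduced generator a simple root, and the inverses of
    differences keep the conjugates of \<open>v\<close> distinct. Pairs with \<open>x = y\<close>
    contribute only 0.\<close>
  define E where "E = ?Rv \<union> ?Rw \<union> {inverse dw} \<union> (\<lambda>(x, y). inverse (x - y)) ` (?Rv \<times> ?Rv)"
  have finE: "finite E" unfolding E_def using finRv finRw by simp
  have Ew: "E \<subseteq> adj K w" unfolding E_def
    using Rvw Rww subfield_inverse[OF fw] dww subring_set_diff[OF srw] by (auto simp: subset_iff)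
  obtain C1 where "finite C1 \<and> C1 \<subseteq> K \<and> (\<forall>V. subring_set V \<and> C1 \<subseteq> V \<longrightarrow> E \<subseteq> adj V w)"
    using finite_coeff_support[OF finE Ew] by (elim exE) (rule that)
  then have C1: "finite C1" "C1 \<subseteq> K" "\<And>V. subring_set V \<Longrightarrow> C1 \<subseteq> V \<Longrightarrow> E \<subseteq> adj V w"
    by simp_all
  have finCj: "finite (Cj \<union> Z)" unfolding Cj_def using finRv Z by (auto intro: finite_subset[OF _ finRv])
  have CjZ: "Cj \<union> Z \<subseteq> adj K v" using Z by (auto simp: Cj_def)
  obtain C2 where "finite C2 \<and> C2 \<subseteq> K \<and> (\<forall>V. subring_set V \<and> C2 \<subseteq> V \<longrightarrow> Cj \<union> Z \<subseteq> adj V v)"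
    using finite_coeff_support[OF finCj CjZ] by (elim exE) (rule that)
  then have C2: "finite C2" "C2 \<subseteq> K" "\<And>V. subring_set V \<Longrightarrow> C2 \<subseteq> V \<Longrightarrow> Cj \<union> Z \<subseteq> adj V v"
    by simp_all
  define C3 where "C3 = set (coeffs (minpoly K v))"
  have C3: "finite C3" "C3 \<subseteq> K"
    unfolding C3_def using minpoly_props(1)[OF K(1) alv] by (auto simp: coeffs_def polys_def split: if_splits)
  have C: "finite (C1 \<union> C2 \<union> C3)" "C1 \<union> C2 \<union> C3 \<subseteq> K" using C1 C2 C3 by auto
  obtain V s where H: "ring_hom_on V s \<and> V \<subseteq> K \<and> C1 \<union> C2 \<union> C3 \<subseteq> V \<and> k1 \<subseteq> V \<and>
      (\<forall>x\<in>k1. s x = kap x) \<and> s ` V \<subseteq> k0 \<and>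
      minpoly K w \<in> polys V \<and> irreducible_over k0 (map_poly s (minpoly K w))"
    using hilbert[OF sw C] by (elim exE) (rule that)
  then have s: "ring_hom_on V s" and OK: "V \<subseteq> K" and CO: "C1 \<union> C2 \<union> C3 \<subseteq> V" and k1O: "k1 \<subseteq> V"
    and sk1: "\<And>x. x \<in> k1 \<Longrightarrow> s x = kap x" and sO: "s ` V \<subseteq> k0" and mO: "minpoly K w \<in> polys V"
    and irr: "irreducible_over k0 (map_poly s (minpoly K w))"
    by simp_all
  interpret s: ring_hom_on V s by (rule s)
  interpret smp: ring_hom_on "polys V" "map_poly s" by (rule s.map_poly_hom)
  have sp: "map_poly s p \<in> polys k0" if "p \<in> polys V" for p
    using that sO by (auto simp: polys_def s.coeff_map_poly_hom)
  define D where "D = adj V w"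
  have srD: "subring_set D" unfolding D_def by (rule subring_set_adj[OF s.subring])
  have ED: "E \<subseteq> D" unfolding D_def using CO by (intro C1(3) s.subring) simp
  have OD: "V \<subseteq> D" unfolding D_def using adj_base[OF s.subring] by blast
  have vRv: "v \<in> ?Rv" using minpoly_props(3)[OF K(1) alv] by simp
  have RvD: "?Rv \<subseteq> D" and RwD: "?Rw \<subseteq> D" using ED by (auto simp: E_def)
  have vD: "v \<in> D" using vRv RvD by blast
  have ZO: "Cj \<union> Z \<subseteq> adj V v" using CO by (intro C2(3) s.subring) simp
  have mvO: "minpoly K v \<in> polys V"
    using CO by (intro polysI_coeffs s.subring) (auto simp: C3_def)
  define m0 where "m0 = map_poly s (minpoly K w)"
  have m0_nc: "pdeg m0 > 0"
    using irr by (auto simp: m0_def irreducible_over_def poly_dvd_1_iff)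
  \<comment> \<open>Every root is admissible and gives an extension of the place to V[w]. This
    freedom is the source of the twist that is undone at the end.\<close>
  then obtain w0 where w0: "poly m0 w0 = 0" using alg_closed_imp_poly_has_root by blast
  obtain psi where psi_hom: "ring_hom_on D psi"
    and psi: "\<And>p. p \<in> polys V \<Longrightarrow> psi (poly p w) = poly (map_poly s p) w0"
    using extend_place[OF K(1) s OK alw mO] w0 unfolding m0_def D_def by blast
  interpret psi: ring_hom_on D psi by (rule psi_hom)
  interpret pmp: ring_hom_on "polys D" "map_poly psi" by (rule psi.map_poly_hom)
  have psiO: "psi x = s x" if "x \<in> V" for x
    using psi[OF polys_const[OF s.subring that]] by (simp add: s.map_poly_pCons_hom)
  have psi_mp: "map_poly psi p = map_poly s p" if "p \<in> polys V" for p
    using that psiO by (intro poly_eqI) (simp add: psi.coeff_map_poly_hom s.coeff_map_poly_hom polys_def)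
  have psi_poly: "psi (poly p x) = poly (map_poly s p) (psi x)" if "p \<in> polys V" "x \<in> D" for p x
    using psi.poly_map_poly_hom[of p x] that psi_mp[OF that(1)] polys_mono[OF OD] by auto
  have wD: "w \<in> D" unfolding D_def by (rule adj_self[OF s.subring])
  have psiw: "psi w = w0"
    using psi[OF polys_linear[OF s.subring, of 0 1]] s.subring
    by (simp add: s.map_poly_pCons_hom s.hom_0 s.hom_1 subring_set_closed)
  have alw0: "alg k0 w0" using irreducible_over_root(1)[OF k0 irr] w0 by (simp add: m0_def)
  have lead: "plead m0 = 1"
  proof -
    let ?d = "pdeg (minpoly K w)"
    have c: "pcoeff m0 ?d = 1"
      using minpoly_props(2)[OF K(1) alw] by (simp add: m0_def s.coeff_map_poly_hom s.hom_1)
    have "pdeg m0 \<le> ?d" unfolding m0_def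
      by (rule degree_le) (auto simp: s.coeff_map_poly_hom s.hom_0 coeff_eq_0)
    then have "pdeg m0 = ?d" using c le_degree[of m0 ?d] by simp
    then show ?thesis using c by simp
  qed
  have m0: "m0 = minpoly k0 w0"
    using irreducible_over_monic_root[OF k0 _ w0 lead] irr by (simp add: m0_def)
  have psi_adj: "psi x \<in> adj k0 w0" if "x \<in> D" for x
    using that psi sp by (auto simp: D_def adj_def)
  have sw0: "sep k0 w0"
  proof -
    have pd: "pderiv (minpoly K w) \<in> polys V" by (rule polys_pderiv[OF s.subring mO])
    have dwD: "dw \<in> D" unfolding D_def dw_def by (rule adjI[OF pd])
    have "psi dw * psi (inverse dw) = 1"
      using psi.hom_mult[OF dwD, of "inverse dw"] ED dw psi.hom_1 by (simp add: E_def)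
    then have "psi dw \<noteq> 0" by auto
    moreover have "psi dw = poly (pderiv m0) w0"
      unfolding dw_def psi[OF pd] m0_def by (simp add: map_poly_pderiv_hom[OF s mO])
    ultimately show ?thesis using w0 minpoly_props(1)[OF k0 alw0] by (auto simp: sep_def m0)
  qed
  \<comment> \<open>Reduction of the linear factors: the roots of the reduced minimal polynomial are
    exactly the reductions of the conjugates of \<open>a\<close>.\<close>
  have factor: "poly (map_poly s (minpoly K a)) x = (\<Prod>r\<in>{r. poly (minpoly K a) r = 0}. x - psi r)"
    if a: "sep K a" "{r. poly (minpoly K a) r = 0} \<subseteq> D" "minpoly K a \<in> polys V" for a x
  proof -
    have "map_poly s (minpoly K a) = map_poly psi (\<Prod>r\<in>{r. poly (minpoly K a) r = 0}. [:- r, 1:])"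
      using psi_mp[OF a(3)] minpoly_factorization[OF K(1) a(1)] by simp
    also have "\<dots> = (\<Prod>r\<in>{r. poly (minpoly K a) r = 0}. map_poly psi [:- r, 1:])"
      using a(2) by (intro pmp.hom_prod polys_linear srD subring_set_minus subring_set_1) auto
    also have "\<dots> = (\<Prod>r\<in>{r. poly (minpoly K a) r = 0}. [:- psi r, 1:])"
      using a(2) by (intro prod.cong refl) (auto simp: psi.map_poly_pCons_hom psi.hom_minus psi.hom_1)
    finally show ?thesis by (simp add: poly_prod)
  qed
  have nw0: "normal_gen k0 w0" unfolding normal_gen_def
  proof (intro conjI allI impI sw0)
    fix x assume "poly (minpoly k0 w0) x = 0"
    then have "(\<Prod>r\<in>?Rw. x - psi r) = 0" using factor[OF sw RwD mO] m0 by (simp add: m0_def)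
    then obtain r where "r \<in> ?Rw" "x = psi r" using finRw by auto
    then show "x \<in> adj k0 w0" using psi_adj RwD by blast
  qed
  have root_w0: "poly (minpoly k0 w0) (psi r) = 0" if "r \<in> ?Rw" for r
    using factor[OF sw RwD mO, of "psi r"] finRw that m0 by (auto simp: m0_def)
  \<comment> \<open>The place intertwines the two Galois actions, because \<open>emb\<close>
    substitutes \<open>r\<close> into a polynomial over \<open>V\<close> and reduction commutes with
    substitution.\<close>
  have transfer: "emb K w r x \<in> D \<and> psi (emb K w r x) = emb k0 w0 (psi r) (psi x)"
    if r: "r \<in> ?Rw" and x: "x \<in> D" for r x
  proof -
    obtain p where p: "p \<in> polys V" "x = poly p w" using x by (auto simp: D_def elim: adjE)
    have e: "emb K w r x = poly p r" using emb_poly[OF K(1) alw, of r p] r p polys_mono[OF OK] by auto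
    have "r \<in> D" using r RwD by blast
    then have "emb K w r x \<in> D" unfolding e using poly_in_subring[OF srD] p polys_mono[OF OD] by blast
    moreover have "psi (emb K w r x) = poly (map_poly s p) (psi r)"
      unfolding e by (rule psi_poly[OF p(1) \<open>r \<in> D\<close>])
    moreover have "emb k0 w0 (psi r) (psi x) = poly (map_poly s p) (psi r)"
      unfolding p(2) psi[OF p(1)] by (rule emb_poly[OF k0 alw0 root_w0[OF r] sp[OF p(1)]])
    ultimately show ?thesis by simp
  qed
  \<comment> \<open>The difference of two distinct conjugates is a unit of \<open>D\<close>, so its
    image cannot vanish.\<close>
  have inj: "inj_on psi ?Rv"
  proof (rule inj_onI, rule ccontr)
    fix x y assume xy: "x \<in> ?Rv" "y \<in> ?Rv" "psi x = psi y" "x \<noteq> y"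
    have iD: "inverse (x - y) \<in> D" using xy ED by (auto simp: E_def)
    have "psi ((x - y) * inverse (x - y)) = psi (x - y) * psi (inverse (x - y))"
      using xy RvD by (intro psi.hom_mult iD subring_set_diff[OF srD]) auto
    moreover have "psi (x - y) = 0" using xy RvD by (subst psi.hom_diff) auto
    ultimately show False using xy(4) psi.hom_1 by simp
  qed
  have psiv: "psi v \<in> adj k0 w0" by (rule psi_adj[OF vD])
  have sv0: "sep k0 (psi v)" by (rule normal_gen_conjugates(1)[OF k0 nw0 psiv])
  note alv0 = sep_imp_alg[OF sv0]
  have ZD: "z \<in> D \<and> psi z \<in> adj k0 (psi v)" if "z \<in> Cj \<union> Z" for z
  proof -
    have "z \<in> adj V v" using that ZO by blast
    then obtain p where p: "p \<in> polys V" "z = poly p v" by (rule adjE)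
    then show ?thesis using psi_poly[OF p(1) vD] poly_in_subring[OF srD _ vD] polys_mono[OF OD] adjI[OF sp[OF p(1)]]
      by auto
  qed
  \<comment> \<open>\<open>r\<close> is the image of \<open>v\<close> under an automorphism of K(w),
    and the transferred automorphism sends \<open>psi v\<close> to \<open>psi r\<close>.\<close>
  have root_v0: "poly (minpoly k0 (psi v)) (psi r) = 0" if r: "r \<in> ?Rv" for r
  proof -
    have vw: "v \<in> adj K w" using vRv Rvw by blast
    obtain r' where "r' \<in> ?Rw" "emb K w r' v = r"
      using normal_gen_conjugates(2)[OF K(1) w vw] r by auto
    then show ?thesis
      using transfer[of r' v] vD emb_minpoly[OF k0 alw0 root_w0 psiv] by auto
  qed
  show thesis
  proof (rule that[OF psi_hom])
    show "k1 \<subseteq> D" using k1O OD by blast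
    show "psi x = kap x" if "x \<in> k1" for x using that k1O psiO sk1 by auto
    show "Z \<subseteq> D" using ZD by blast
    show "sep k0 (psi v)" by (rule sv0)
    show "psi z \<in> adj k0 (psi v)" if "z \<in> Z" for z using ZD that by blast
    show "poly (minpoly k0 (psi v)) (psi r) = 0 \<and> psi r \<in> adj k0 (psi v)" if "r \<in> Cj" for r
      using that ZD root_v0 by (auto simp: Cj_def)
    show "psi (emb K v r z) = emb k0 (psi v) (psi r) (psi z)" if r: "r \<in> Cj" and z: "z \<in> Z" for r z
    proof -
      have "z \<in> adj V v" using z ZO by blast
      then obtain p where p: "p \<in> polys V" "z = poly p v" by (rule adjE)
      have r': "r \<in> ?Rv" "r \<in> D" using r ZD by (auto simp: Cj_def)
      have "emb K v r z = poly p r" using emb_poly[OF K(1) alv, of r p] r' p polys_mono[OF OK] by auto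
      then show ?thesis
        using psi_poly[OF p(1) r'(2)] psi_poly[OF p(1) vD] p emb_poly[OF k0 alv0 root_v0[OF r'(1)] sp[OF p(1)]]
        by simp
    qed
    show "inj_on psi Cj" using inj by (rule inj_on_subset) (auto simp: Cj_def)
    fix x assume x: "x \<in> adj k0 (psi v)" "poly (minpoly k0 (psi v)) x = 0"
    have "poly (map_poly s (minpoly K v)) (psi v) = 0"
      using psi_poly[OF mvO vD] minpoly_props(3)[OF K(1) alv] psi.hom_0 by simp
    then have "minpoly k0 (psi v) dvd map_poly s (minpoly K v)"
      by (rule minpoly_dvd[OF k0 alv0 sp[OF mvO]])
    then have "poly (map_poly s (minpoly K v)) x = 0" using x(2) by (meson poly_eq_0_iff_dvd dvd_trans)
    then have "(\<Prod>r\<in>?Rv. x - psi r) = 0" using factor[OF v RvD mvO] by simp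
    then obtain r where r: "r \<in> ?Rv" "x = psi r" using finRv by auto
    \<comment> \<open>No new automorphism arises. If \<open>r\<close> were outside K(v), some
      automorphism over K(v) would move it. Its transfer fixes \<open>psi v\<close>, hence also
      \<open>psi r\<close>, which lies in k0(psi v). So two different conjugates of \<open>v\<close>
      would have the same reduction.\<close>
    have "r \<in> adj K v"
    proof (rule ccontr)
      assume "r \<notin> adj K v"
      moreover have "v \<in> adj K w" "r \<in> adj K w" using Rvw vRv r by blast+
      ultimately obtain r' where r': "r' \<in> ?Rw" "emb K w r' v = v" "emb K w r' r \<noteq> r"
        using normal_gen_moves[OF K(1) w] by auto
      have rD: "r \<in> D" using r RvD by blast
      have "poly (minpoly K r) (emb K w r' r) = 0"
        using emb_minpoly[OF K(1) alw _ \<open>r \<in> adj K w\<close>] r' by auto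
      then have r2: "emb K w r' r \<in> ?Rv"
        using minpoly_conjugate(2)[OF K(1) alv] r by auto
      obtain q where q: "q \<in> polys k0" "x = poly q (psi v)" using x(1) by (rule adjE)
      note h = emb_hom[OF k0 alw0 root_w0[OF r'(1)]]
      have "emb k0 w0 (psi r') (poly q (psi v)) = poly q (emb k0 w0 (psi r') (psi v))"
        by (rule hom_poly_fixed[OF h emb_base[OF k0 alw0 root_w0[OF r'(1)]] _ q(1) psiv])
           (auto intro: adj_base[OF subfield_subring[OF k0]])
      also have "emb k0 w0 (psi r') (psi v) = psi v" using transfer[OF r'(1) vD] r'(2) by simp
      finally have "emb k0 w0 (psi r') (psi r) = psi r" using q r by simp
      then have "psi (emb K w r' r) = psi r" using transfer[OF r'(1) rD] by simp
      then show False using inj r2 r(1) r'(3) by (meson inj_onD)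
    qed
    then show "\<exists>r\<in>Cj. x = psi r" using r by (auto simp: Cj_def)
  qed
qed

section \<open>Evaluation of multivariate polynomials\<close>

definition mon_val :: "(nat \<Rightarrow> 'b::comm_ring_1) \<Rightarrow> (nat \<Rightarrow>\<^sub>0 nat) \<Rightarrow> 'b" where
  "mon_val t m = (\<Prod>i\<in>keys m. t i ^ lookup m i)"

text \<open>Evaluation with coefficients sent through \<open>f\<close> into another ring. It covers
  specialization at a point, permutation of the variables, twisting by an automorphism of
  \<open>L\<close>, and the passage to the function field.\<close>

definition ev :: "('a::field \<Rightarrow> 'b::comm_ring_1) \<Rightarrow> (nat \<Rightarrow> 'b) \<Rightarrow> 'a mpoly \<Rightarrow> 'b" where
  "ev f t p = (\<Sum>m\<in>keys p. f (lookup p m) * mon_val t m)"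

lemma mpoly_eval_eq_ev: "mpoly_eval t = ev (\<lambda>x. x) t"
  by (simp add: mpoly_eval_def ev_def mon_val_def fun_eq_iff)

lemma mon_superset:
  "finite I \<Longrightarrow> keys m \<subseteq> I \<Longrightarrow> mon_val t m = (\<Prod>i\<in>I. t i ^ lookup m i)"
  unfolding mon_val_def by (rule prod.mono_neutral_left) (auto simp: in_keys_iff)

lemma mon_add: "mon_val t (m + m') = mon_val t m * mon_val t m'"
proof -
  define I where "I = keys m \<union> keys m'"
  have "finite I" "keys m \<subseteq> I" "keys m' \<subseteq> I" "keys (m + m') \<subseteq> I"
    using keys_add[of m m'] by (auto simp: I_def)
  then show ?thesis
    by (simp add: mon_superset[of I] lookup_add power_add prod.distrib)
qed

lemma mon_0: "mon_val t 0 = 1"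
  by (simp add: mon_val_def)

lemma mon_single: "mon_val t (single i e) = t i ^ e"
  by (simp add: mon_val_def)

lemma mon_cong: "(\<And>i. i \<in> keys m \<Longrightarrow> t i = t' i) \<Longrightarrow> mon_val t m = mon_val t' m"
  by (simp add: mon_val_def)

lemma ev_superset:
  "f 0 = 0 \<Longrightarrow> finite M \<Longrightarrow> keys p \<subseteq> M \<Longrightarrow>
    ev f t p = (\<Sum>m\<in>M. f (lookup p m) * mon_val t m)"
  unfolding ev_def by (rule sum.mono_neutral_left) (auto simp: in_keys_iff)

lemma ev_single: "f 0 = 0 \<Longrightarrow> ev f t (single m c) = f c * mon_val t m"
  using ev_superset[of f "{m}" "single m c" t] by simp

lemma ev_0: "ev f t 0 = 0"
  by (simp add: ev_def)

lemma mpoly_sum_singles: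
  "p = (\<Sum>m\<in>keys p. single m (lookup p m))"
proof (rule poly_mapping_eqI)
  fix m
  have "(\<Sum>n\<in>keys p. lookup (single n (lookup p n)) m) =
      (\<Sum>n\<in>keys p. if n = m then lookup p m else 0)"
    by (intro sum.cong refl) (auto simp: lookup_single when_def)
  also have "\<dots> = lookup p m" by (simp add: in_keys_iff)
  finally show "lookup p m = lookup
      (\<Sum>m\<in>keys p. single m (lookup p m)) m"
    by (simp add: lookup_sum)
qed

lemma mpoly_mult_singles:
  fixes p q :: "'a::field mpoly"
  shows "p * q = (\<Sum>m\<in>keys p. \<Sum>n\<in>keys q.
    single (m + n) (lookup p m * lookup q n))"
proof -
  have "(\<Sum>m\<in>keys p. single m (lookup p m)) *
      (\<Sum>n\<in>keys q. single n (lookup q n)) =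
    (\<Sum>m\<in>keys p. \<Sum>n\<in>keys q.
      single (m + n) (lookup p m * lookup q n))"
    by (simp add: sum_product mult_single)
  then show ?thesis by (simp only: mpoly_sum_singles[symmetric])
qed

lemma mpoly_overI:
  "(\<And>m. lookup p m \<in> K) \<Longrightarrow> (\<And>m. m \<in> keys p \<Longrightarrow> keys m \<subseteq> {..<n}) \<Longrightarrow>
    p \<in> mpoly_over K n"
  by (simp add: mpoly_over_def)

lemma mpoly_overD:
  assumes "p \<in> mpoly_over K n"
  shows "lookup p m \<in> K" "m \<in> keys p \<Longrightarrow> keys m \<subseteq> {..<n}"
  using assms by (auto simp: mpoly_over_def)

lemma mpoly_over_mono: "K \<subseteq> K' \<Longrightarrow> mpoly_over K n \<subseteq> mpoly_over K' n"
  by (auto simp: mpoly_over_def)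

lemma mpoly_over_single:
  "subring_set K \<Longrightarrow> c \<in> K \<Longrightarrow> keys m \<subseteq> {..<n} \<Longrightarrow> single m c \<in> mpoly_over K n"
  by (rule mpoly_overI) (auto simp: lookup_single when_def subring_set_0 split: if_splits)

lemma mpoly_over_add:
  assumes K: "subring_set K" and p: "p \<in> mpoly_over K n" and q: "q \<in> mpoly_over K n"
  shows "p + q \<in> mpoly_over K n"
proof (rule mpoly_overI)
  show "lookup (p + q) m \<in> K" for m
    using mpoly_overD(1)[OF p] mpoly_overD(1)[OF q] by (simp add: lookup_add subring_set_add[OF K])
  show "keys m \<subseteq> {..<n}" if "m \<in> keys (p + q)" for m
    using that keys_add[of p q] mpoly_overD(2)[OF p] mpoly_overD(2)[OF q] by blast
qed

lemma mpoly_over_uminus: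
  assumes K: "subring_set K" and p: "p \<in> mpoly_over K n"
  shows "- p \<in> mpoly_over K n"
proof (rule mpoly_overI)
  show "lookup (- p) m \<in> K" for m
    using mpoly_overD(1)[OF p] by (simp add: subring_set_minus[OF K])
  show "keys m \<subseteq> {..<n}" if "m \<in> keys (- p)" for m
    using that mpoly_overD(2)[OF p] by (simp add: in_keys_iff)
qed

lemma mpoly_over_0: "subring_set K \<Longrightarrow> 0 \<in> mpoly_over K n"
  by (simp add: mpoly_over_def subring_set_0)

lemma mpoly_over_sum:
  "subring_set K \<Longrightarrow> (\<And>i. i \<in> A \<Longrightarrow> g i \<in> mpoly_over K n) \<Longrightarrow> sum g A \<in> mpoly_over K n"
  by (induction A rule: infinite_finite_induct)
     (simp_all add: mpoly_over_add mpoly_over_0)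

lemma subring_set_mpoly_over:
  assumes K: "subring_set K" shows "subring_set (mpoly_over K n)"
  unfolding subring_set_def
proof (intro conjI ballI)
  show "1 \<in> mpoly_over K n"
    using mpoly_over_single[OF K subring_set_1[OF K], of 0 n] by simp
  fix p q assume p: "p \<in> mpoly_over K n" and q: "q \<in> mpoly_over K n"
  show "p - q \<in> mpoly_over K n"
    using mpoly_over_add[OF K p mpoly_over_uminus[OF K q]] by simp
  show "p * q \<in> mpoly_over K n"
    unfolding mpoly_mult_singles[of p q]
  proof (intro mpoly_over_sum[OF K] mpoly_over_single[OF K])
    fix m m' assume m: "m \<in> keys p" "m' \<in> keys q"
    show "lookup p m * lookup q m' \<in> K"
      using mpoly_overD(1)[OF p] mpoly_overD(1)[OF q] by (rule subring_set_mult[OF K])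
    show "keys (m + m') \<subseteq> {..<n}"
      using keys_add[of m m'] mpoly_overD(2)[OF p m(1)] mpoly_overD(2)[OF q m(2)] by blast
  qed
qed

lemma ev_hom:
  assumes f: "ring_hom_on K f"
  shows "ring_hom_on (mpoly_over K n) (ev f t)"
proof
  interpret ring_hom_on K f by (rule f)
  show "subring_set (mpoly_over K n)" by (rule subring_set_mpoly_over[OF subring])
  show "ev f t 1 = 1" using ev_single[of f t 0 1, OF hom_0] by (simp add: mon_0 hom_1)
  have add: "ev f t (p + q) = ev f t p + ev f t q" if "p \<in> mpoly_over K n" "q \<in> mpoly_over K n" for p q
  proof -
    define M where "M = keys p \<union> keys q"
    have M: "finite M" "keys p \<subseteq> M" "keys q \<subseteq> M" "keys (p + q) \<subseteq> M"
      using keys_add[of p q] by (auto simp: M_def)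
    show ?thesis
      using mpoly_overD(1)[OF that(1)] mpoly_overD(1)[OF that(2)]
      by (simp add: ev_superset[of f M, OF hom_0 M(1)] M lookup_add hom_add distrib_right sum.distrib)
  qed
  have sum: "ev f t (sum g A) = (\<Sum>i\<in>A. ev f t (g i))" if "\<And>i. i \<in> A \<Longrightarrow> g i \<in> mpoly_over K n"
    for g :: "'c \<Rightarrow> _" and A
    using that
    by (induction A rule: infinite_finite_induct) (auto simp: ev_0 add mpoly_over_sum[OF subring])
  fix p q assume p: "p \<in> mpoly_over K n" and q: "q \<in> mpoly_over K n"
  show "ev f t (p + q) = ev f t p + ev f t q" by (rule add[OF p q])
  have K: "lookup p m * lookup q m' \<in> K" for m m'
    using mpoly_overD(1)[OF p] mpoly_overD(1)[OF q] by (rule subring_set_mult[OF subring])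
  have single: "single (m + m') (lookup p m * lookup q m') \<in> mpoly_over K n"
    if "m \<in> keys p" "m' \<in> keys q" for m m'
    using keys_add[of m m'] mpoly_overD(2)[OF p that(1)] mpoly_overD(2)[OF q that(2)]
    by (intro mpoly_over_single[OF subring K]) blast
  show "ev f t (p * q) = ev f t p * ev f t q"
    unfolding mpoly_mult_singles[of p q]
    using mpoly_overD(1)[OF p] mpoly_overD(1)[OF q]
    by (simp add: sum single mpoly_over_sum[OF subring] ev_single[of f, OF hom_0] hom_mult mon_add)
       (simp add: ev_def sum_product ac_simps)
qed

definition Const :: "'a::field \<Rightarrow> 'a mpoly" where
  "Const c = single 0 c"

definition Var :: "nat \<Rightarrow> 'a::field mpoly" where
  "Var i = single (single i 1) 1"

lemma Const_hom: "subring_set K \<Longrightarrow> ring_hom_on K Const"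
  by unfold_locales (auto simp: Const_def single_add mult_single)

lemma Const_eq_iff: "Const c = Const d \<longleftrightarrow> c = d"
  unfolding Const_def by (metis inj_single injD)

lemma ev_Const: "f 0 = 0 \<Longrightarrow> ev f t (Const c) = f c"
  by (simp add: Const_def ev_single mon_0)

lemma ev_Var: "f 0 = 0 \<Longrightarrow> f 1 = 1 \<Longrightarrow> ev f t (Var i) = t i"
  by (simp add: Var_def ev_single mon_single)

lemma Const_in: "subring_set K \<Longrightarrow> c \<in> K \<Longrightarrow> Const c \<in> mpoly_over K n"
  unfolding Const_def by (rule mpoly_over_single) auto

lemma Var_in: "subring_set K \<Longrightarrow> i < n \<Longrightarrow> Var i \<in> mpoly_over K n"
  unfolding Var_def by (rule mpoly_over_single) (auto simp: subring_set_1)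

lemma ev_in:
  assumes p: "p \<in> mpoly_over K n" and T: "subring_set T" and f: "\<And>c. c \<in> K \<Longrightarrow> f c \<in> T"
    and t: "\<And>i. i < n \<Longrightarrow> t i \<in> T"
  shows "ev f t p \<in> T"
  unfolding ev_def mon_val_def
  using mpoly_overD[OF p] f t
  by (intro subring_set_sum[OF T] subring_set_mult[OF T] subring_set_prod[OF T] subring_set_power[OF T])
     (auto simp: subset_iff)

lemma hom_ev:
  assumes h: "ring_hom_on T h" and p: "p \<in> mpoly_over K n" and f: "\<And>c. c \<in> K \<Longrightarrow> f c \<in> T"
    and t: "\<And>i. i < n \<Longrightarrow> t i \<in> T"
  shows "h (ev f t p) = ev (\<lambda>c. h (f c)) (\<lambda>i. h (t i)) p"
proof -
  interpret ring_hom_on T h by (rule h)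
  have t': "t i \<in> T" if "m \<in> keys p" "i \<in> keys m" for m i
    using t mpoly_overD(2)[OF p that(1)] that(2) by blast
  have m: "mon_val t m \<in> T" if "m \<in> keys p" for m
    unfolding mon_val_def using t'[OF that] by (intro subring_set_prod subring_set_power subring) auto
  have "h (mon_val t m) = mon_val (\<lambda>i. h (t i)) m" if "m \<in> keys p" for m
    unfolding mon_val_def using t'[OF that] subring
    by (simp add: hom_prod hom_power subring_set_power)
  then show ?thesis
    unfolding ev_def using m f mpoly_overD(1)[OF p] subring
    by (simp add: hom_sum hom_mult subring_set_mult)
qed

lemma ev_cong:
  assumes p: "p \<in> mpoly_over K n" and f: "\<And>c. c \<in> K \<Longrightarrow> f c = g c" and t: "\<And>i. i < n \<Longrightarrow> t i = u i"
  shows "ev f t p = ev g u p"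
  unfolding ev_def
proof (rule sum.cong[OF refl])
  fix m assume "m \<in> keys p"
  then have "mon_val t m = mon_val u m" using mpoly_overD(2)[OF p] t by (intro mon_cong) blast
  then show "f (lookup p m) * mon_val t m = g (lookup p m) * mon_val u m"
    using f mpoly_overD(1)[OF p] by simp
qed

lemma ev_Const_Var: "p \<in> mpoly_over K n \<Longrightarrow> ev Const Var p = p"
proof -
  have m: "mon_val Var m = single m (1::'a)" for m :: "nat \<Rightarrow>\<^sub>0 nat"
  proof -
    have pow: "Var i ^ e = single (single i e) (1::'a)" for i e
      by (induction e) (simp_all add: Var_def mult_single flip: single_add)
    have "(\<Prod>i\<in>I. single (single i (lookup m i)) (1::'a)) =
      single (\<Sum>i\<in>I. single i (lookup m i)) 1" for I
      by (induction I rule: infinite_finite_induct) (auto simp: mult_single)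
    moreover have "(\<Sum>i\<in>keys m. single i (lookup m i)) = m"
    proof (rule poly_mapping_eqI)
      fix j
      have "(\<Sum>i\<in>keys m. lookup (single i (lookup m i)) j) =
          (\<Sum>i\<in>keys m. if i = j then lookup m j else 0)"
        by (intro sum.cong refl) (auto simp: lookup_single when_def)
      also have "\<dots> = lookup m j" by (simp add: in_keys_iff)
      finally show "lookup (\<Sum>i\<in>keys m. single i (lookup m i)) j
        = lookup m j" by (simp add: lookup_sum)
    qed
    ultimately show ?thesis by (simp add: mon_val_def pow)
  qed
  show ?thesis
    by (subst (2) mpoly_sum_singles[of p]) (simp add: ev_def m Const_def mult_single)
qed

text \<open>Comparison modulo \<open>d\<close> yields the lowest digit. This makes the Kronecker
  substitution injective on exponent vectors.\<close>

lemma digits_unique: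
  fixes d :: nat
  assumes "(\<Sum>i<n. f i * d ^ i) = (\<Sum>i<n. g i * d ^ i)" and "\<And>i. i < n \<Longrightarrow> f i < d" and "\<And>i. i < n \<Longrightarrow> g i < d"
    and "i < n"
  shows "f i = g i"
  using assms
proof (induction n arbitrary: f g i)
  case (Suc n)
  have s: "(\<Sum>i<Suc n. f i * d ^ i) = f 0 + d * (\<Sum>i<n. f (Suc i) * d ^ i)" for f
    by (subst sum.lessThan_Suc_shift) (simp add: sum_distrib_left ac_simps)
  have "f 0 < d" "g 0 < d" using Suc.prems by simp_all
  moreover have eq: "f 0 + d * (\<Sum>i<n. f (Suc i) * d ^ i) = g 0 + d * (\<Sum>i<n. g (Suc i) * d ^ i)"
    using Suc.prems(1) unfolding s .
  ultimately have 0: "f 0 = g 0" by (metis mod_less mod_mult_self2)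
  then have "(\<Sum>i<n. f (Suc i) * d ^ i) = (\<Sum>i<n. g (Suc i) * d ^ i)"
    using eq \<open>f 0 < d\<close> by simp
  then have "f (Suc j) = g (Suc j)" if "j < n" for j
    by (rule Suc.IH) (use Suc.prems that in auto)
  then show ?case using 0 Suc.prems(4) by (cases i) auto
qed simp

text \<open>Kronecker substitution \<open>T\<^sub>i \<mapsto> \<tau>^(d^i)\<close> reduces this to univariate polynomials.\<close>

lemma mpoly_zero_everywhere:
  fixes f :: "'a::field \<Rightarrow> 'b::field"
  assumes f: "ring_hom_on K f" "is_subfield K" and inf: "infinite (UNIV :: 'b set)" and p: "p \<in> mpoly_over K n"
    and zero: "\<And>t. ev f t p = 0"
  shows "p = 0"
proof (rule ccontr)
  assume "p \<noteq> 0"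
  interpret ring_hom_on K f by (rule f)
  \<comment> \<open>\<open>d\<close> exceeds every exponent that occurs, so exponents are digits in
    base \<open>d\<close>. The inserted 0 keeps \<open>Max\<close> meaningful when there are no
    variables.\<close>
  define d where "d = Suc (Max (insert 0 (\<Union>m\<in>keys p. lookup m ` {..<n})))"
  have d: "lookup m i < d" if "m \<in> keys p" "i < n" for m i
    unfolding d_def less_Suc_eq_le by (rule Max_ge) (use that in auto)
  define e where "e m = (\<Sum>i<n. lookup m i * d ^ i)" for m :: "nat \<Rightarrow>\<^sub>0 nat"
  have inj: "inj_on e (keys p)"
  proof (rule inj_onI)
    fix m m' assume mm: "m \<in> keys p" "m' \<in> keys p" "e m = e m'"
    have "lookup m i = lookup m' i" if "i < n" for i
      using digits_unique[of "lookup m" d n "lookup m'" i] mm d that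
      by (simp add: e_def)
    moreover have "lookup m i = 0 \<and> lookup m' i = 0" if "\<not> i < n" for i
      using mpoly_overD(2)[OF p mm(1)] mpoly_overD(2)[OF p mm(2)] that by (auto simp: in_keys_iff)
    ultimately show "m = m'" by (intro poly_mapping_eqI) metis
  qed
  define P where "P = (\<Sum>m\<in>keys p. pmonom (f (lookup p m)) (e m))"
  have "poly P x = 0" for x
  proof -
    have "mon_val (\<lambda>i. x ^ d ^ i) m = x ^ e m" if "m \<in> keys p" for m
      using mpoly_overD(2)[OF p that]
      by (simp add: mon_superset[of "{..<n}"] e_def power_sum power_mult[symmetric] mult.commute)
    then have "poly P x = ev f (\<lambda>i. x ^ d ^ i) p"
      by (simp add: P_def ev_def poly_sum poly_monom)
    then show ?thesis using zero by simp
  qed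
  then have "P = 0" using poly_roots_finite[of P] inf by auto
  obtain m where m: "m \<in> keys p" using \<open>p \<noteq> 0\<close> by fastforce
  have "pcoeff P (e m) = (\<Sum>m'\<in>keys p. if m' = m then f (lookup p m') else 0)"
    unfolding P_def coeff_sum using inj m by (intro sum.cong refl) (auto dest: inj_onD)
  also have "\<dots> = f (lookup p m)" using m by simp
  finally have "f (lookup p m) = f 0" using \<open>P = 0\<close> by (simp add: hom_0)
  then have "lookup p m = 0"
    using hom_field_inj[OF f] mpoly_overD(1)[OF p] subring_set_0[OF subring] by blast
  then show False using m by (simp add: in_keys_iff)
qed

section \<open>Hilbert irreducibility as a source of places\<close>

lemma to_ac_hom: "subring_set K \<Longrightarrow> ring_hom_on K to_ac"
  by unfold_locales auto

text \<open>Multiple roots are sought in the algebraic closure, so irreducibility is carried to the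
  image of \<open>K\<close> there. Over that field the derivative, nonzero and of smaller degree,
  shares no root with the polynomial.\<close>

lemma separable_polyI:
  assumes K: "is_subfield K" and p: "irreducible_over K p" "pderiv p \<noteq> 0"
  shows "separable_poly p"
  unfolding separable_poly_def
proof (rule rsquarefreeI_simple_roots)
  note h = to_ac_hom[OF subfield_subring[OF K]]
  have pK: "p \<in> polys K" using p by (simp add: irreducible_over_def poly_over_eq_polys)
  note irr = irreducible_over_map_poly[OF h K p(1)]
  show "map_poly to_ac p \<noteq> 0" using irr by (simp add: irreducible_over_def)
  have "pderiv (map_poly to_ac p) \<noteq> 0"
    using p(2) map_poly_pderiv_hom[OF h pK]
      map_poly_inj_on[OF h K polys_pderiv[OF subfield_subring[OF K] pK] polys_0[OF subfield_subring[OF K]]] by auto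
  then show "poly (pderiv (map_poly to_ac p)) r \<noteq> 0" if "poly (map_poly to_ac p) r = 0" for r
    using irreducible_over_simple_roots[OF hom_image_subfield[OF h K] irr] that by blast
qed

lemma ratfun_over_subfield:
  assumes k: "subring_set k" shows "is_subfield (ratfun_over k n)"
proof (rule is_subfieldI)
  note sr = subring_set_mpoly_over[OF k, of n]
  have I: "Fract a b \<in> ratfun_over k n" if "a \<in> mpoly_over k n" "b \<in> mpoly_over k n" "b \<noteq> 0" for a b
    using that by (auto simp: ratfun_over_def)
  have E: "\<exists>a b. a \<in> mpoly_over k n \<and> b \<in> mpoly_over k n \<and> b \<noteq> 0 \<and> x = Fract a b"
    if "x \<in> ratfun_over k n" for x
    using that by (auto simp: ratfun_over_def)
  show "subring_set (ratfun_over k n)"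
    unfolding subring_set_def
  proof (intro conjI ballI)
    show "1 \<in> ratfun_over k n" unfolding One_fract_def by (rule I) (auto simp: subring_set_1[OF sr])
    fix x y assume "x \<in> ratfun_over k n" "y \<in> ratfun_over k n"
    then obtain a b c d where *: "a \<in> mpoly_over k n" "b \<in> mpoly_over k n" "b \<noteq> 0" "x = Fract a b"
      "c \<in> mpoly_over k n" "d \<in> mpoly_over k n" "d \<noteq> 0" "y = Fract c d" using E by meson
    then show "x - y \<in> ratfun_over k n" "x * y \<in> ratfun_over k n"
      by (auto intro!: I subring_set_diff[OF sr] subring_set_mult[OF sr])
  qed
  fix x assume "x \<in> ratfun_over k n"
  then obtain a b where *: "a \<in> mpoly_over k n" "b \<in> mpoly_over k n" "b \<noteq> 0" "x = Fract a b" using E by meson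
  show "inverse x \<in> ratfun_over k n"
  proof (cases "a = 0")
    case True
    then have "inverse x = Fract 0 1" using * by (simp add: fract_collapse)
    then show ?thesis using I[OF subring_set_0[OF sr] subring_set_1[OF sr]] by simp
  next
    case False
    then show ?thesis using * I by simp
  qed
qed

text \<open>Over a finite \<open>k\<close> the product of all \<open>T - c\<close> is a nonzero
  polynomial vanishing on \<open>k\<close>, so no point avoids it.\<close>

lemma hilbertian_infinite:
  fixes k :: "'a::field set"
  assumes k: "is_subfield k" and h: "hilbertian k"
  shows "infinite k"
proof
  assume fin: "finite k"
  note sr = subfield_subring[OF k]
  define g where "g = (\<Prod>c\<in>k. Var 0 - Const c :: 'a mpoly)"
  have hid: "ring_hom_on k (\<lambda>x. x)" by (rule ring_hom_on_id[OF sr])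
  have fac: "Var 0 - Const c \<in> mpoly_over k 1" if "c \<in> k" for c
    using that by (intro subring_set_diff[OF subring_set_mpoly_over] Var_in Const_in sr) auto
  have g: "g \<in> mpoly_over k 1" unfolding g_def
    by (intro subring_set_prod[OF subring_set_mpoly_over] fac sr)
  have "Var 0 \<noteq> (Const c :: 'a mpoly)" for c
  proof
    assume "Var 0 = (Const c :: 'a mpoly)"
    then have "ev (\<lambda>x. x) t (Var 0) = ev (\<lambda>x. x) t (Const c)" for t :: "nat \<Rightarrow> 'a" by simp
    from this[of "\<lambda>_. 0"] this[of "\<lambda>_. 1"] show False by (simp add: ev_Var ev_Const)
  qed
  then have "g \<noteq> 0" using fin by (simp add: g_def)
  define B where "B = ratfun_over k 1"
  have B: "is_subfield B" unfolding B_def by (rule ratfun_over_subfield[OF sr])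
  note srB = subfield_subring[OF B]
  \<comment> \<open>The Hilbert property has to be applied to at least one polynomial;
    \<open>X\<close> will do, being the minimal polynomial of 0.\<close>
  have "irreducible_over B [:0, 1:]"
  proof -
    have "minpoly B 0 dvd [:0, 1:]"
      by (rule minpoly_dvd[OF B alg_base[OF srB subring_set_0[OF srB]]])
         (simp_all add: polys_linear srB subring_set_0 subring_set_1)
    then have "pdeg (minpoly B 0) \<le> 1"
      using dvd_imp_degree_le[of "minpoly B 0" "[:0, 1:]"] by simp
    then have d: "pdeg (minpoly B 0) = 1"
      using minpoly_degree_pos[OF B alg_base[OF srB subring_set_0[OF srB]]] by simp
    then obtain a b where ab: "minpoly B 0 = [:a, b:]" by (metis degree1_coeffs)
    have "a = 0" "b = 1"
      using minpoly_props(2,3)[OF B alg_base[OF srB subring_set_0[OF srB]]] d unfolding ab by simp_all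
    then show ?thesis
      using minpoly_irreducible[OF B alg_base[OF srB subring_set_0[OF srB]]] ab by simp
  qed
  moreover have "separable_poly ([:0, 1:] :: 'a mpoly fract poly)"
    unfolding separable_poly_def
    by (rule rsquarefreeI_simple_roots) (simp_all add: map_poly_pCons pderiv_pCons)
  ultimately obtain t where t: "t 0 \<in> k" "mpoly_eval t g \<noteq> 0"
    using h[unfolded hilbertian_def, rule_format, of 1 1 "\<lambda>_. [:0, 1:]" g] g \<open>g \<noteq> 0\<close>
    by (auto simp: B_def)
  interpret e: ring_hom_on "mpoly_over k 1" "ev (\<lambda>x. x) t" by (rule ev_hom[OF hid])
  have "mpoly_eval t g = (\<Prod>c\<in>k. t 0 - c)"
    unfolding mpoly_eval_eq_ev g_def using fac sr
    by (simp add: e.hom_prod e.hom_diff Var_in Const_in ev_Var ev_Const)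
  also have "\<dots> = 0" using fin t by auto
  finally show False using t by simp
qed

lemma inv_into_hom:
  fixes f :: "'a::field \<Rightarrow> 'b::field"
  assumes f: "ring_hom_on K f" and K: "is_subfield K"
  shows "ring_hom_on (f ` K) (inv_into K f)"
proof
  interpret ring_hom_on K f by (rule f)
  show "subring_set (f ` K)" by (rule hom_image_subring)
  have inj: "inj_on f K" using hom_field_inj[OF f K] by (meson inj_onI)
  show "inv_into K f 1 = 1" using inv_into_f_f[OF inj subring_set_1[OF subring]] by (simp add: hom_1)
  fix x y assume "x \<in> f ` K" "y \<in> f ` K"
  then obtain a b where ab: "a \<in> K" "b \<in> K" "x = f a" "y = f b" by blast
  then show "inv_into K f (x + y) = inv_into K f x + inv_into K f y"
    using inv_into_f_f[OF inj subring_set_add[OF subring ab(1,2)]] inv_into_f_f[OF inj] by (simp add: hom_add)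
  show "inv_into K f (x * y) = inv_into K f x * inv_into K f y"
    using ab inv_into_f_f[OF inj subring_set_mult[OF subring ab(1,2)]] inv_into_f_f[OF inj] by (simp add: hom_mult)
qed

text \<open>The local ring of the point \<open>t\<close>. It is the domain of the place
  \<open>ratfun_at\<close>, evaluation at \<open>t\<close>.\<close>

definition ratfun_dom :: "'a::field set \<Rightarrow> nat \<Rightarrow> (nat \<Rightarrow> 'a) \<Rightarrow> 'a mpoly fract set" where
  "ratfun_dom k n t = {c. \<exists>v. ratfun_value k n t c v}"

definition ratfun_at :: "'a::field set \<Rightarrow> nat \<Rightarrow> (nat \<Rightarrow> 'a) \<Rightarrow> 'a mpoly fract \<Rightarrow> 'a" where
  "ratfun_at k n t c = (SOME v. ratfun_value k n t c v)"

lemma ratfun_at: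
  assumes k: "subring_set k" and v: "ratfun_value k n t c v"
  shows "ratfun_at k n t c = v"
proof -
  interpret e: ring_hom_on "mpoly_over k n" "mpoly_eval t"
    unfolding mpoly_eval_eq_ev by (rule ev_hom[OF ring_hom_on_id[OF k]])
  have "v = u" if u: "ratfun_value k n t c u" for u
  proof -
    obtain a b a' b' where *: "a \<in> mpoly_over k n" "b \<in> mpoly_over k n" "c = Fract a b" "mpoly_eval t b \<noteq> 0"
      "v = mpoly_eval t a / mpoly_eval t b"
      "a' \<in> mpoly_over k n" "b' \<in> mpoly_over k n" "c = Fract a' b'" "mpoly_eval t b' \<noteq> 0"
      "u = mpoly_eval t a' / mpoly_eval t b'"
      using u v unfolding ratfun_value_def by blast
    then have "b \<noteq> 0" "b' \<noteq> 0" using e.hom_0 by auto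
    then have "a * b' = a' * b" using * by (metis eq_fract(1))
    then have "mpoly_eval t a * mpoly_eval t b' = mpoly_eval t a' * mpoly_eval t b"
      using * e.hom_mult by metis
    then show ?thesis using * by (simp add: frac_eq_eq)
  qed
  then show ?thesis unfolding ratfun_at_def using v by (metis someI)
qed

lemma ratfun_at_hom:
  assumes k: "subring_set k" shows "ring_hom_on (ratfun_dom k n t) (ratfun_at k n t)"
proof
  interpret e: ring_hom_on "mpoly_over k n" "mpoly_eval t"
    unfolding mpoly_eval_eq_ev by (rule ev_hom[OF ring_hom_on_id[OF k]])
  note sr = subring_set_mpoly_over[OF k, of n]
  have I: "ratfun_value k n t (Fract a b) (mpoly_eval t a / mpoly_eval t b)"
    if "a \<in> mpoly_over k n" "b \<in> mpoly_over k n" "mpoly_eval t b \<noteq> 0" for a b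
    unfolding ratfun_value_def using that by blast
  have one: "ratfun_value k n t 1 1"
    using I[OF subring_set_1[OF sr] subring_set_1[OF sr]] e.hom_1 by (simp add: One_fract_def)
  then show "ratfun_at k n t 1 = 1" by (rule ratfun_at[OF k])
  have op: "ratfun_value k n t (x - y) (u - v)" "ratfun_value k n t (x * y) (u * v)"
      "ratfun_value k n t (x + y) (u + v)"
    if xy: "ratfun_value k n t x u" "ratfun_value k n t y v" for x y u v
  proof -
    obtain a b where 1: "a \<in> mpoly_over k n" "b \<in> mpoly_over k n" "x = Fract a b" "mpoly_eval t b \<noteq> 0"
      "u = mpoly_eval t a / mpoly_eval t b"
      using xy(1) unfolding ratfun_value_def by blast
    obtain a' b' where 2: "a' \<in> mpoly_over k n" "b' \<in> mpoly_over k n" "y = Fract a' b'" "mpoly_eval t b' \<noteq> 0"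
      "v = mpoly_eval t a' / mpoly_eval t b'"
      using xy(2) unfolding ratfun_value_def by blast
    note * = 1 2
    have nz: "b \<noteq> 0" "b' \<noteq> 0" using * e.hom_0 by auto
    have cl: "a * b' \<in> mpoly_over k n" "a' * b \<in> mpoly_over k n" "b * b' \<in> mpoly_over k n" "a * a' \<in> mpoly_over k n"
      using * subring_set_mult[OF sr] by blast+
    have bb: "mpoly_eval t (b * b') \<noteq> 0" using * by (simp add: e.hom_mult)
    show "ratfun_value k n t (x - y) (u - v)"
      using I[OF subring_set_diff[OF sr cl(1,2)] cl(3) bb] * nz
      by (simp add: e.hom_mult e.hom_diff cl diff_frac_eq)
    show "ratfun_value k n t (x + y) (u + v)"
      using I[OF subring_set_add[OF sr cl(1,2)] cl(3) bb] * nz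
      by (simp add: e.hom_mult e.hom_add cl add_frac_eq)
    show "ratfun_value k n t (x * y) (u * v)"
      using I[OF cl(4) cl(3) bb] * by (simp add: e.hom_mult)
  qed
  show "subring_set (ratfun_dom k n t)"
    unfolding subring_set_def ratfun_dom_def using one op by blast
  fix x y assume "x \<in> ratfun_dom k n t" "y \<in> ratfun_dom k n t"
  then obtain u v where uv: "ratfun_value k n t x u" "ratfun_value k n t y v" by (auto simp: ratfun_dom_def)
  show "ratfun_at k n t (x + y) = ratfun_at k n t x + ratfun_at k n t y"
    "ratfun_at k n t (x * y) = ratfun_at k n t x * ratfun_at k n t y"
    using ratfun_at[OF k op(3)[OF uv]] ratfun_at[OF k op(2)[OF uv]] ratfun_at[OF k uv(1)] ratfun_at[OF k uv(2)]
    by simp_all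
qed

text \<open>The product of the denominators serves as \<open>g\<close>. Given to the Hilbert
  property as the polynomial to be avoided, it forces the place to be defined on a prescribed finite
  set.\<close>

lemma common_denominator:
  assumes k: "subring_set k" and C: "finite C" "C \<subseteq> ratfun_over k n"
  shows "\<exists>g\<in>mpoly_over k n. g \<noteq> 0 \<and> (\<forall>t. mpoly_eval t g \<noteq> 0 \<longrightarrow> C \<subseteq> ratfun_dom k n t)"
  using C
proof (induction C rule: finite_induct)
  case empty
  show ?case using subring_set_1[OF subring_set_mpoly_over[OF k]] by (intro bexI[of _ 1]) auto
next
  case (insert c C)
  then obtain g where g: "g \<in> mpoly_over k n" "g \<noteq> 0" "\<forall>t. mpoly_eval t g \<noteq> 0 \<longrightarrow> C \<subseteq> ratfun_dom k n t" by auto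
  obtain a b where ab: "a \<in> mpoly_over k n" "b \<in> mpoly_over k n" "b \<noteq> 0" "c = Fract a b"
    using insert by (auto simp: ratfun_over_def)
  have "C \<subseteq> ratfun_dom k n t \<and> c \<in> ratfun_dom k n t" if "mpoly_eval t (g * b) \<noteq> 0" for t
  proof -
    interpret e: ring_hom_on "mpoly_over k n" "mpoly_eval t"
      unfolding mpoly_eval_eq_ev by (rule ev_hom[OF ring_hom_on_id[OF k]])
    have "mpoly_eval t g \<noteq> 0" "mpoly_eval t b \<noteq> 0" using that g(1) ab(2) by (auto simp: e.hom_mult)
    then show ?thesis using g(3) ab unfolding ratfun_dom_def ratfun_value_def by blast
  qed
  then show ?case using g ab subring_set_mult[OF subring_set_mpoly_over[OF k]]
    by (intro bexI[of _ "g * b"]) auto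
qed

text \<open>The Hilbert property speaks about \<open>ratfun_over k n\<close>, whereas the base field
  has to lie inside a field that contains the extensions. Algebraic independence of the
  \<open>t i\<close> identifies the two: \<open>push\<close> substitutes them for the variables,
  \<open>pull\<close> is the inverse.\<close>

locale generic_base =
  fixes k :: "'a::field set" and n :: nat and f :: "'a \<Rightarrow> 'c::field" and t :: "nat \<Rightarrow> 'c"
  assumes k: "is_subfield k" and f: "ring_hom_on k f"
    and indep: "p \<in> mpoly_over k n \<Longrightarrow> ev f t p = 0 \<Longrightarrow> p = 0"
begin

interpretation e: ring_hom_on "mpoly_over k n" "ev f t" by (rule ev_hom[OF f])

lemma k_subring: "subring_set k"
  by (rule subfield_subring[OF k])

definition push :: "'a mpoly fract \<Rightarrow> 'c" where
  "push x = (SOME y. \<exists>a\<in>mpoly_over k n. \<exists>b\<in>mpoly_over k n. b \<noteq> 0 \<and> x = Fract a b \<and> y = ev f t a / ev f t b)"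

definition base :: "'c set" where
  "base = push ` ratfun_over k n"

definition pull :: "'c \<Rightarrow> 'a mpoly fract" where
  "pull = inv_into (ratfun_over k n) push"

text \<open>Independence keeps denominators nonzero, and cross-multiplication shows that the value
  does not depend on the fraction chosen.\<close>

lemma push_Fract:
  assumes a: "a \<in> mpoly_over k n" and b: "b \<in> mpoly_over k n" "b \<noteq> 0"
  shows "push (Fract a b) = ev f t a / ev f t b"
proof -
  define y where "y = push (Fract a b)"
  have "\<exists>a'\<in>mpoly_over k n. \<exists>b'\<in>mpoly_over k n. b' \<noteq> 0 \<and> Fract a b = Fract a' b' \<and> y = ev f t a' / ev f t b'"
    unfolding y_def push_def by (rule someI[of _ "ev f t a / ev f t b"]) (use a b in blast)
  then obtain a' b' where *: "a' \<in> mpoly_over k n" "b' \<in> mpoly_over k n" "b' \<noteq> 0"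
    "Fract a b = Fract a' b'" "y = ev f t a' / ev f t b'" by blast
  then have "a * b' = a' * b" using b by (simp add: eq_fract)
  then have "ev f t a * ev f t b' = ev f t a' * ev f t b" using a b * e.hom_mult by metis
  moreover have "ev f t b \<noteq> 0" "ev f t b' \<noteq> 0" using indep b * by blast+
  ultimately have "ev f t a / ev f t b = y" using * by (simp add: frac_eq_eq)
  then show ?thesis by (simp add: y_def)
qed

lemma push_hom: "ring_hom_on (ratfun_over k n) push"
proof
  note sr = subring_set_mpoly_over[OF k_subring, of n]
  show "subring_set (ratfun_over k n)" by (rule subfield_subring[OF ratfun_over_subfield[OF k_subring]])
  show "push 1 = 1" using push_Fract[of 1 1] subring_set_1[OF sr] e.hom_1 by (simp add: One_fract_def)
  fix x y assume "x \<in> ratfun_over k n" "y \<in> ratfun_over k n"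
  then obtain a b c d where *: "a \<in> mpoly_over k n" "b \<in> mpoly_over k n" "b \<noteq> 0" "x = Fract a b"
    "c \<in> mpoly_over k n" "d \<in> mpoly_over k n" "d \<noteq> 0" "y = Fract c d" unfolding ratfun_over_def by blast
  have cl: "a * d \<in> mpoly_over k n" "c * b \<in> mpoly_over k n" "b * d \<in> mpoly_over k n" "a * c \<in> mpoly_over k n"
    using * subring_set_mult[OF sr] by blast+
  have nz: "ev f t b \<noteq> 0" "ev f t d \<noteq> 0" "b * d \<noteq> 0" using indep * by auto
  show "push (x + y) = push x + push y"
    using * nz push_Fract[OF subring_set_add[OF sr cl(1,2)] cl(3) nz(3)]
    by (simp add: push_Fract e.hom_mult e.hom_add cl add_frac_eq)
  show "push (x * y) = push x * push y"
    using * push_Fract[OF cl(4,3) nz(3)] by (simp add: push_Fract e.hom_mult)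
qed

lemma base_subfield: "is_subfield base"
  unfolding base_def by (rule hom_image_subfield[OF push_hom ratfun_over_subfield[OF k_subring]])

lemma ev_in_base:
  assumes p: "p \<in> mpoly_over k n" shows "ev f t p \<in> base"
proof -
  note one = subring_set_1[OF subring_set_mpoly_over[OF k_subring, of n]]
  have "Fract p 1 \<in> ratfun_over k n" unfolding ratfun_over_def using p one by force
  then show ?thesis using push_Fract[OF p one] e.hom_1 unfolding base_def by force
qed

lemma base_fraction:
  assumes "x \<in> base"
  obtains a b where "a \<in> mpoly_over k n" "b \<in> mpoly_over k n" "ev f t b \<noteq> 0" "x = ev f t a / ev f t b"
proof -
  obtain a b where ab: "a \<in> mpoly_over k n" "b \<in> mpoly_over k n" "b \<noteq> 0" "x = push (Fract a b)"
    using assms unfolding base_def ratfun_over_def by blast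
  then show thesis using that[OF ab(1,2)] indep[OF ab(2)] push_Fract[OF ab(1-3)] by blast
qed

lemma f_0: "f 0 = 0"
  by (rule ring_hom_on.hom_0[OF f])

lemma f_in_base: "c \<in> k \<Longrightarrow> f c \<in> base"
  using ev_in_base[OF Const_in[OF k_subring], of c] by (simp add: ev_Const f_0)

lemma t_in_base: "i < n \<Longrightarrow> t i \<in> base"
  using ev_in_base[OF Var_in[OF k_subring], of i] ring_hom_on.hom_1[OF f] by (simp add: ev_Var f_0)

lemma pull_hom: "ring_hom_on base pull"
  unfolding base_def pull_def by (rule inv_into_hom[OF push_hom ratfun_over_subfield[OF k_subring]])

lemma push_inj: "inj_on push (ratfun_over k n)"
  using hom_field_inj[OF push_hom ratfun_over_subfield[OF k_subring]] by (meson inj_onI)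

lemma pull_push: "c \<in> ratfun_over k n \<Longrightarrow> pull (push c) = c"
  unfolding pull_def by (rule inv_into_f_f[OF push_inj])

lemma push_pull: "x \<in> base \<Longrightarrow> push (pull x) = x"
  unfolding pull_def base_def by (rule f_inv_into_f)

lemma pull_image: "pull ` base = ratfun_over k n"
  unfolding base_def image_image using pull_push by (simp cong: image_cong)

lemma separable_poly_pull:
  assumes w: "sep base w" shows "separable_poly (map_poly pull (minpoly base w))"
proof (rule separable_polyI)
  note al = sep_imp_alg[OF w]
  note m = minpoly_props[OF base_subfield al]
  show "is_subfield (pull ` base)" by (rule hom_image_subfield[OF pull_hom base_subfield])
  show "irreducible_over (pull ` base) (map_poly pull (minpoly base w))"
    by (rule irreducible_over_map_poly[OF pull_hom base_subfield minpoly_irreducible[OF base_subfield al]])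
  show "pderiv (map_poly pull (minpoly base w)) \<noteq> 0"
  proof
    assume "pderiv (map_poly pull (minpoly base w)) = 0"
    then have "map_poly pull (pderiv (minpoly base w)) = map_poly pull 0"
      using map_poly_pderiv_hom[OF pull_hom m(1)] by simp
    then have "pderiv (minpoly base w) = 0"
      using polys_pderiv[OF subfield_subring[OF base_subfield] m(1)] polys_0[OF subfield_subring[OF base_subfield]]
      by (intro map_poly_inj_on[OF pull_hom base_subfield])
    then show False using sep_minpoly[OF base_subfield w] by simp
  qed
qed

text \<open>The Hilbert property is applied to one polynomial, the pullback of the minimal
  polynomial of \<open>w\<close>, avoiding a common denominator for \<open>C\<close>. The point
  found is the place: \<open>V\<close> is its local ring pushed into \<open>base\<close>, and
  \<open>s\<close> evaluates there.\<close>

theorem hilbert_place: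
  assumes hilb: "hilbertian k" and n: "n \<ge> 1" and w: "sep base w" and C: "finite C" "C \<subseteq> base"
  shows "\<exists>V s. ring_hom_on V s \<and> V \<subseteq> base \<and> C \<subseteq> V \<and> f ` k \<subseteq> V \<and>
    (\<forall>x\<in>f ` k. s x = to_ac (inv_into k f x)) \<and> s ` V \<subseteq> to_ac ` k \<and>
    minpoly base w \<in> polys V \<and> irreducible_over (to_ac ` k) (map_poly s (minpoly base w))"
proof -
  note al = sep_imp_alg[OF w]
  note m = minpoly_props[OF base_subfield al]
  interpret pull: ring_hom_on base pull by (rule pull_hom)
  define h where "h = map_poly pull (minpoly base w)"
  have "irreducible_over (pull ` base) h"
    unfolding h_def by (rule irreducible_over_map_poly[OF pull_hom base_subfield minpoly_irreducible[OF base_subfield al]])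
  then have h: "irreducible_over (ratfun_over k n) h" "separable_poly h"
    using separable_poly_pull[OF w] by (simp_all add: pull_image h_def)
  obtain g where g: "g \<in> mpoly_over k n" "g \<noteq> 0"
    "\<And>u. mpoly_eval u g \<noteq> 0 \<Longrightarrow> pull ` C \<subseteq> ratfun_dom k n u"
    using common_denominator[OF k_subring, of "pull ` C" n] C pull_image by blast
  obtain u q where u: "\<And>j. j < n \<Longrightarrow> u j \<in> k" "mpoly_eval u g \<noteq> 0" and q: "specializes k n u h q" "irreducible_over k q"
    using hilb[unfolded hilbertian_def, rule_format, of n 1 "\<lambda>_. h" g] n h g by auto
  let ?D = "ratfun_dom k n u"
  have DB: "?D \<subseteq> ratfun_over k n"
  proof
    fix c assume "c \<in> ?D"
    then obtain a b where "a \<in> mpoly_over k n" "b \<in> mpoly_over k n" "c = Fract a b" "mpoly_eval u b \<noteq> 0"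
      unfolding ratfun_dom_def ratfun_value_def by blast
    moreover from this have "b \<noteq> 0" by (auto simp: mpoly_eval_def)
    ultimately show "c \<in> ratfun_over k n" unfolding ratfun_over_def by blast
  qed
  define V where "V = push ` ?D"
  define s where "s x = to_ac (ratfun_at k n u (pull x))" for x
  have hD: "ring_hom_on ?D (ratfun_at k n u)" by (rule ratfun_at_hom[OF k_subring])
  have srD: "subring_set ?D" using hD by (simp add: ring_hom_on_def)
  have V: "V \<subseteq> base" unfolding V_def base_def using DB by blast
  have srV: "subring_set V" unfolding V_def
    by (rule ring_hom_on.hom_image_subring[OF ring_hom_on_subset[OF push_hom srD DB]])
  have pullV: "pull ` V \<subseteq> ?D" unfolding V_def using pull_push DB by auto
  have VI: "x \<in> V" if "x \<in> base" "pull x \<in> ?D" for x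
    unfolding V_def using push_pull[OF that(1)] that(2) by (metis imageI)
  have "ring_hom_on V (\<lambda>x. ratfun_at k n u (pull x))"
    by (rule ring_hom_on_comp[OF ring_hom_on_subset[OF pull_hom srV V] hD pullV])
  then have s: "ring_hom_on V s"
    unfolding s_def by (rule ring_hom_on_comp[where T = UNIV]) (unfold_locales, auto simp: subring_set_UNIV)
  have in_k: "v \<in> k" if "ratfun_value k n u c v" for c v
    using that u(1) k_subring k unfolding ratfun_value_def mpoly_eval_eq_ev
    by (auto intro!: subfield_divide ev_in)
  have f_val: "ratfun_value k n u (pull (f c)) c" if c: "c \<in> k" for c
  proof -
    note one = subring_set_1[OF subring_set_mpoly_over[OF k_subring, of n]]
    note cc = Const_in[OF k_subring c, of n]
    have "push (Fract (Const c) 1) = f c"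
      using push_Fract[OF cc one] e.hom_1 by (simp add: ev_Const f_0)
    moreover have "Fract (Const c) 1 \<in> ratfun_over k n" unfolding ratfun_over_def using cc one by force
    ultimately have "pull (f c) = Fract (Const c) 1" using pull_push by metis
    moreover have "mpoly_eval u (Const c) = c" "mpoly_eval u 1 = 1"
      using ev_Const[of "\<lambda>x. x" u c] ring_hom_on.hom_1[OF ev_hom[OF ring_hom_on_id[OF k_subring], of n u]]
      by (simp_all add: mpoly_eval_eq_ev)
    ultimately show ?thesis unfolding ratfun_value_def using cc one by force
  qed
  have inj: "inj_on f k" using hom_field_inj[OF f k] by (meson inj_onI)
  \<comment> \<open>Coefficientwise, the minimal polynomial is defined at \<open>u\<close> with
    value \<open>q\<close>: this puts its coefficients into \<open>V\<close> and identifies its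
    reduction.\<close>
  have val: "ratfun_value k n u (pull (pcoeff (minpoly base w) i)) (pcoeff q i)" for i
    using q(1) by (simp add: specializes_def h_def pull.coeff_map_poly_hom)
  have "ring_hom_on V s \<and> V \<subseteq> base \<and> C \<subseteq> V \<and> f ` k \<subseteq> V \<and>
    (\<forall>x\<in>f ` k. s x = to_ac (inv_into k f x)) \<and> s ` V \<subseteq> to_ac ` k \<and>
    minpoly base w \<in> polys V \<and> irreducible_over (to_ac ` k) (map_poly s (minpoly base w))"
  proof (intro conjI)
    show "C \<subseteq> V" using g(3)[OF u(2)] C VI by blast
    show "f ` k \<subseteq> V" using f_val f_in_base VI by (auto simp: ratfun_dom_def)
    show "\<forall>x\<in>f ` k. s x = to_ac (inv_into k f x)"
      using ratfun_at[OF k_subring f_val] by (auto simp: s_def inv_into_f_f[OF inj])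
    show "s ` V \<subseteq> to_ac ` k"
    proof
      fix y assume "y \<in> s ` V"
      then obtain x where x: "x \<in> V" "y = s x" by blast
      then obtain v where v: "ratfun_value k n u (pull x) v" using pullV by (auto simp: ratfun_dom_def)
      then show "y \<in> to_ac ` k" using x ratfun_at[OF k_subring v] in_k[OF v] by (simp add: s_def)
    qed
    show "minpoly base w \<in> polys V"
      unfolding polys_def using val VI coeff_polys[OF m(1)] by (auto simp: ratfun_dom_def)
    have "map_poly s (minpoly base w) = map_poly to_ac q"
      using ratfun_at[OF k_subring val] ring_hom_on.coeff_map_poly_hom[OF s]
      by (intro poly_eqI) (simp add: coeff_map_poly s_def)
    moreover have "ring_hom_on k to_ac" using k_subring by unfold_locales auto
    ultimately show "irreducible_over (to_ac ` k) (map_poly s (minpoly base w))"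
      using irreducible_over_map_poly[OF _ k q(2), of to_ac] by simp
  qed (rule s V)+
  then show ?thesis by (intro exI)
qed

end

section \<open>A rational function field with prescribed automorphisms\<close>

lemma Fract_hom: "ring_hom_on UNIV (\<lambda>a::'a::idom. Fract a 1)"
  by unfold_locales (auto simp: subring_set_UNIV One_fract_def)

lemma Fract_1_eq_iff: "Fract (a::'a::idom) 1 = Fract b 1 \<longleftrightarrow> a = b"
  by (simp add: eq_fract)

text \<open>A root of a monic polynomial over \<open>F[Y]\<close> lies in \<open>F[Y]\<close>. A polynomial \<open>d\<close> of least degree
  with \<open>d F[Y][z] \<subseteq> F[Y]\<close> divides \<open>d z\<close>.\<close>

lemma cubic_integral:
  fixes z :: "'f::field poly fract" and Q :: "'f poly"
  assumes z: "z ^ 3 + z ^ 2 = Fract Q 1"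
  obtains u where "z = Fract u 1"
proof -
  define P where "P x \<longleftrightarrow> (\<exists>p. x = Fract p (1::'f poly))" for x
  interpret F: ring_hom_on UNIV "\<lambda>a::'f poly. Fract a 1" by (rule Fract_hom)
  have Pd: "P (x - y)" if "P x" "P y" for x y using that unfolding P_def by (metis F.hom_diff UNIV_I)
  have Pm: "P (x * y)" if "P x" "P y" for x y using that unfolding P_def by (metis F.hom_mult UNIV_I)
  have P1: "P (Fract p 1)" for p unfolding P_def by blast
  \<comment> \<open>Since \<open>z^3 = Q - z^2\<close>, the two conditions say that \<open>d\<close>
    multiplies all of F[Y][z] into F[Y]: \<open>I\<close> is the conductor.\<close>
  define I where "I = {d. P (Fract d 1 * z) \<and> P (Fract d 1 * z ^ 2)}"
  obtain a b where ab: "z = Fract a b" "b \<noteq> 0" by (cases z rule: Fract_cases) blast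
  have bz: "Fract b 1 * z = Fract a 1" using ab by (simp add: eq_fract)
  have bb: "Fract (b ^ 2) 1 = Fract b 1 * Fract b 1" by (simp add: power2_eq_square)
  have "Fract (b ^ 2) 1 * z = Fract b 1 * Fract a 1"
    unfolding bb bz[symmetric] by (simp only: mult.assoc)
  moreover have "Fract (b ^ 2) 1 * z ^ 2 = Fract a 1 * Fract a 1"
    unfolding bb bz[symmetric] by (simp only: power2_eq_square ac_simps)
  ultimately have "b ^ 2 \<in> I" using P1 Pm unfolding I_def by simp
  have "b ^ 2 \<noteq> 0" using ab by simp
  define d where "d = arg_min pdeg (\<lambda>d. d \<in> I \<and> d \<noteq> 0)"
  have d: "d \<in> I" "d \<noteq> 0" and min: "\<And>e. e \<in> I \<Longrightarrow> e \<noteq> 0 \<Longrightarrow> pdeg d \<le> pdeg e"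
    unfolding d_def
    using arg_min_natI[of "\<lambda>d. d \<in> I \<and> d \<noteq> 0" "b ^ 2"] arg_min_nat_le[of "\<lambda>d. d \<in> I \<and> d \<noteq> 0"]
      \<open>b ^ 2 \<in> I\<close> \<open>b ^ 2 \<noteq> 0\<close> by blast+
  obtain p where p: "Fract d 1 * z = Fract p 1" using d unfolding I_def P_def by blast
  \<comment> \<open>Here \<open>p = d z\<close>, so \<open>p z = d z^2\<close> and
    \<open>p z^2 = d z^3 = d Q - d z^2\<close>.\<close>
  have "p \<in> I"
  proof -
    have "Fract p 1 * z = Fract d 1 * z ^ 2" by (simp add: p[symmetric] power2_eq_square mult.assoc)
    moreover have "Fract p 1 * z ^ 2 = Fract d 1 * Fract Q 1 - Fract d 1 * z ^ 2"
      unfolding p[symmetric] z[symmetric] by (simp add: algebra_simps power2_eq_square power3_eq_cube)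
    ultimately show ?thesis using d Pd Pm P1 unfolding I_def by auto
  qed
  \<comment> \<open>The remainder of \<open>p\<close> modulo \<open>d\<close> stays in the conductor
    but has smaller degree than \<open>d\<close>, so it vanishes and \<open>d\<close> divides
    \<open>p = d z\<close>.\<close>
  define u r where "u = p div d" and "r = p mod d"
  have pur: "p = d * u + r" by (simp add: u_def r_def)
  have er: "Fract r 1 = Fract p 1 - Fract d 1 * Fract u 1" using pur by (simp add: F.hom_diff)
  have "Fract r 1 * z = Fract p 1 * z - (Fract d 1 * z) * Fract u 1"
    "Fract r 1 * z ^ 2 = Fract p 1 * z ^ 2 - (Fract d 1 * z ^ 2) * Fract u 1"
    unfolding er by (simp_all only: left_diff_distrib) (simp_all only: ac_simps)
  then have "r \<in> I" using \<open>p \<in> I\<close> d(1) Pd Pm P1 unfolding I_def by auto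
  then have "r = 0"
    using min[of r] degree_mod_less[OF d(2), of p] unfolding r_def[symmetric] by fastforce
  then have "Fract d 1 * z = Fract d 1 * Fract u 1" using p pur by simp
  moreover have "Fract d 1 \<noteq> 0" using d(2) Fract_1_eq_iff[of d 0] F.hom_0 by simp
  ultimately have "z = Fract u 1" by (simp del: mult_fract)
  then show thesis by (rule that)
qed

text \<open>By integrality \<open>z\<close> is a polynomial \<open>u\<close>, and
  \<open>u^2 (u + 1)\<close> has three times its degree, so \<open>u = a Y + b\<close>. The rest is
  a comparison of coefficients.\<close>

lemma cubic_shift:
  fixes z :: "'f::field poly fract"
  assumes z: "z ^ 3 + z ^ 2 = Fract [:c, 0, 1, 1:] 1"
  shows "z = Fract [:0, 1:] 1" "c = 0"
proof -
  interpret F: ring_hom_on UNIV "\<lambda>a::'f poly. Fract a 1" by (rule Fract_hom)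
  obtain u where u: "z = Fract u 1" by (rule cubic_integral[OF z])
  have "Fract (u ^ 3 + u ^ 2) 1 = Fract [:c, 0, 1, 1:] 1"
    using z unfolding u by (simp add: F.hom_add F.hom_power del: add_fract)
  then have eq: "u ^ 3 + u ^ 2 = [:c, 0, 1, 1:]" by (simp only: Fract_1_eq_iff)
  have "pdeg u = 1"
  proof (cases "pdeg u = 0")
    case True
    then obtain b where "u = [:b:]" by (metis degree_0_id)
    then show ?thesis using eq by (simp add: power2_eq_square power3_eq_cube)
  next
    case False
    have "pdeg (u + 1) = pdeg u"
      using False by (intro degree_add_eq_left) simp
    moreover have "u \<noteq> 0" "u + 1 \<noteq> 0" using False calculation by auto
    moreover have "u ^ 3 + u ^ 2 = u * u * (u + 1)" by (simp add: power2_eq_square power3_eq_cube algebra_simps)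
    ultimately have "pdeg (u ^ 3 + u ^ 2) = 3 * pdeg u"
      by (simp add: degree_mult_eq)
    then show ?thesis unfolding eq by simp
  qed
  then obtain a b where ab: "u = [:b, a:]" "a \<noteq> 0" by (metis degree1_coeffs)
  have "[:b * b * b + b * b, 3 * a * b * b + 2 * a * b, 3 * a * a * b + a * a, a * a * a:] = [:c, 0, 1, 1:]"
    using eq unfolding ab by (simp add: power2_eq_square power3_eq_cube algebra_simps)
  then have c: "b * b * b + b * b = c" and 1: "3 * a * b * b + 2 * a * b = 0" and 2: "3 * a * a * b + a * a = 1"
    and 3: "a * a * a = 1" by auto
  have "a * b * (3 * b + 2) = 0" using 1 by (simp add: algebra_simps)
  then have "b = 0 \<or> 3 * b = -2" using ab(2) by (auto simp: eq_neg_iff_add_eq_0)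
  then have "b = 0 \<and> a = 1"
  proof
    assume "b = 0"
    then show ?thesis using 2 3 by simp
  next
    \<comment> \<open>Then \<open>a^2 = -1\<close> and \<open>a^3 = 1\<close> give
      \<open>a = -1\<close>, hence \<open>1 = -1\<close>. In characteristic 2 the assumption reads
      \<open>b = 0\<close>, so this case leads back to the other one.\<close>
    assume b: "3 * b = -2"
    have "a * a * (3 * b + 1) = 1" using 2 by (simp add: algebra_simps)
    then have aa: "a * a = -1" unfolding b by (simp add: minus_equation_iff[of _ 1])
    then have a: "a = -1" using 3 by (simp add: minus_equation_iff[of _ 1])
    have "(1::'f) = -1" using aa unfolding a by simp
    then have "(1::'f) + 1 = 0" by (metis add.right_inverse)
    then have two: "(2::'f) = 0" by (simp only: one_add_one)
    moreover have "(3::'f) = 2 + 1" by simp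
    ultimately have "(3::'f) = 1" by simp
    then have "b = 0" using b two by simp
    moreover have "a = 1" using a \<open>(1::'f) = -1\<close> by simp
    ultimately show ?thesis by simp
  qed
  then show "z = Fract [:0, 1:] 1" "c = 0" using u ab c by auto
qed

text \<open>Over a finite field the product of all \<open>X - a\<close>, increased by 1, is
  nonconstant and has no root.\<close>

lemma alg_closed_infinite: "infinite (UNIV :: 'a::alg_closed_field set)"
proof
  assume fin: "finite (UNIV :: 'a set)"
  define p :: "'a poly" where "p = (\<Prod>a\<in>UNIV. [:- a, 1:]) + 1"
  have deg: "pdeg (\<Prod>a\<in>UNIV. [:- a, 1:] :: 'a poly) = card (UNIV :: 'a set)"
    by (subst degree_prod_eq_sum_degree) auto
  have "card (UNIV :: 'a set) > 0" using fin by (simp add: card_gt_0_iff)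
  then have "pdeg p > 0"
    unfolding p_def using deg by (subst degree_add_eq_left) simp_all
  then obtain x where "poly p x = 0" using alg_closed_imp_poly_has_root by blast
  moreover have "poly (\<Prod>a\<in>UNIV. [:- a, 1:]) x = 0" using fin by (auto simp: poly_prod)
  ultimately show False by (simp add: p_def)
qed

text \<open>The monic polynomial with these lower coefficients splits, multiplicities included. So
  the map from tuples of roots to coefficients is surjective, which is the source of the algebraic
  independence of the symmetric functions.\<close>

lemma monic_roots_enumeration:
  fixes c :: "nat \<Rightarrow> 'a::alg_closed_field"
  obtains x where "\<And>i. i < n \<Longrightarrow> pcoeff (\<Prod>j<n. [:- x j, 1:]) i = c i"
proof -
  define p where "p = pmonom 1 n + (\<Sum>i<n. pmonom (c i) i)"
  have coeff: "pcoeff p i = (if i < n then c i else if i = n then 1 else 0)" for i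
    by (auto simp: p_def coeff_sum)
  have deg: "pdeg p = n"
    by (intro antisym degree_le le_degree) (auto simp: coeff)
  then have lc: "plead p = 1" by (simp add: coeff)
  then have "p \<noteq> 0" by force
  then obtain A where A: "size A = n" "p = (\<Prod>x\<in>#A. [:- x, 1:])"
    using alg_closed_imp_factorization[of p] lc deg by auto
  obtain xs where xs: "mset xs = A" using ex_mset by blast
  have "p = (\<Prod>x\<leftarrow>xs. [:- x, 1:])" using A(2) xs by (metis prod_mset_prod_list mset_map)
  also have "\<dots> = (\<Prod>j<n. [:- xs ! j, 1:])"
    using A(1) xs by (auto simp: prod.list_conv_set_nth atLeast0LessThan)
  finally show thesis using that[of "\<lambda>j. xs ! j"] coeff by metis
qed

section \<open>The ambient field of functions in the \<open>x\<close> variables and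
  \<open>y\<close>\<close>

definition cst :: "'a::field \<Rightarrow> 'a mpoly poly" where
  "cst c = [:Const c:]"

text \<open>Polynomials in Y over polynomials in the \<open>x\<close> variables are embedded into
  F(Y), with F the field of rational functions in the latter, and then into an algebraic closure.
  Keeping Y as an outer layer over a field makes \<open>cubic_shift\<close> applicable; the closure
  provides room for normal closures.\<close>

definition jC :: "'a::field mpoly poly \<Rightarrow> 'a mpoly fract poly fract alg_closure" where
  "jC p = to_ac (Fract (map_poly (\<lambda>a. Fract a 1) p) 1)"

lemma jC_hom: "ring_hom_on UNIV jC"
proof -
  have 1: "ring_hom_on UNIV (map_poly (\<lambda>a::'a mpoly. Fract a 1))"
    using ring_hom_on.map_poly_hom[OF Fract_hom] by (simp add: polys_UNIV)
  have "ring_hom_on UNIV (\<lambda>p::'a mpoly poly. Fract (map_poly (\<lambda>a. Fract a 1) p) 1)"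
    by (rule ring_hom_on_comp[OF 1 Fract_hom]) simp
  then show ?thesis
    unfolding jC_def by (rule ring_hom_on_comp[OF _ to_ac_hom[OF subring_set_UNIV]]) simp
qed

interpretation jC: ring_hom_on UNIV jC by (rule jC_hom)

lemma jC_eq_iff: "jC p = jC q \<longleftrightarrow> p = q"
proof
  assume "jC p = jC q"
  then have "map_poly (\<lambda>a. Fract a 1) p = map_poly (\<lambda>a. Fract a 1) q"
    by (simp add: jC_def Fract_1_eq_iff)
  then have "Fract (pcoeff p i) 1 = Fract (pcoeff q i) 1" for i
    by (metis ring_hom_on.coeff_map_poly_hom[OF Fract_hom])
  then show "p = q" by (intro poly_eqI) (simp add: Fract_1_eq_iff)
qed simp

lemma jC_eq_0_iff: "jC p = 0 \<longleftrightarrow> p = 0"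
  using jC_eq_iff[of p 0] by (simp add: jC.hom_0)

lemma cst_hom: "ring_hom_on UNIV cst"
  using Const_hom[OF subring_set_UNIV]
  by unfold_locales (auto simp: cst_def ring_hom_on_def one_pCons mult.commute)

interpretation cst: ring_hom_on UNIV cst by (rule cst_hom)

definition cC :: "'a::field \<Rightarrow> 'a mpoly fract poly fract alg_closure" where
  "cC c = jC (cst c)"

lemma cC_hom: "ring_hom_on UNIV cC"
  unfolding cC_def by (rule ring_hom_on_comp[OF cst_hom jC_hom]) simp

interpretation cC: ring_hom_on UNIV cC by (rule cC_hom)

lemma cC_eq_iff: "cC c = cC d \<longleftrightarrow> c = d"
  by (simp add: cC_def jC_eq_iff cst_def Const_eq_iff)

lemma cC_hom_on: "subring_set S \<Longrightarrow> ring_hom_on S cC"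
  by (rule ring_hom_on_subset[OF cC_hom]) auto

lemma polys_mpoly_subring: "subring_set S \<Longrightarrow> subring_set (polys (mpoly_over S n))"
  by (intro subring_set_polys subring_set_mpoly_over)

lemma sep_hom:
  fixes f :: "'x::field \<Rightarrow> 'y::field"
  assumes f: "ring_hom_on UNIV f" and a: "sep S a"
  shows "sep (f ` S) (f a)"
proof -
  interpret ring_hom_on UNIV f by (rule f)
  obtain p where p: "p \<in> polys S" "poly p a = 0" "poly (pderiv p) a \<noteq> 0" using a by (auto simp: sep_def)
  have "is_subfield (UNIV :: 'x set)" by (simp add: is_subfield_iff)
  then have inj: "f x = 0 \<Longrightarrow> x = 0" for x using hom_field_inj[OF f _ UNIV_I UNIV_I, of x 0] hom_0 by simp
  have "map_poly f p \<in> polys (f ` S)" using p by (auto simp: polys_def coeff_map_poly_hom)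
  moreover have "poly (map_poly f p) (f a) = 0" using poly_map_poly_hom[of p a] p by (simp add: polys_UNIV hom_0)
  moreover have "poly (pderiv (map_poly f p)) (f a) \<noteq> 0"
    using poly_map_poly_hom[of "pderiv p" a] p inj map_poly_pderiv_hom[OF f, of p] by (auto simp: polys_UNIV)
  ultimately show ?thesis by (auto simp: sep_def)
qed

text \<open>The epimorphism appears as an action of \<open>G\<close> on \<open>L\<close>. The
  assumption \<open>split\<close> expresses that L/k is Galois and that \<open>G\<close> reaches
  every conjugate of \<theta>; \<open>theta_nz\<close> makes every coefficient of \<open>e\<close>
  nonzero.\<close>

locale generic_solution =
  fixes k L :: "'a::field set" and \<theta> :: 'a and G :: "('g, 'b) monoid_scheme" (structure)
    and \<alpha> :: "'g \<Rightarrow> 'a \<Rightarrow> 'a"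
  assumes k: "is_subfield k" and L: "is_subfield L" and kL: "k \<subseteq> L" and inf_k: "infinite k"
    and L_eq: "L = adj k \<theta>" and theta_nz: "\<theta> \<noteq> 0" and sep_theta: "sep k \<theta>"
    and G: "group G" and fin_G: "finite (carrier G)"
    and act_hom: "g \<in> carrier G \<Longrightarrow> ring_hom_on L (\<alpha> g)"
    and act_L: "g \<in> carrier G \<Longrightarrow> x \<in> L \<Longrightarrow> \<alpha> g x \<in> L"
    and act_k: "g \<in> carrier G \<Longrightarrow> x \<in> k \<Longrightarrow> \<alpha> g x = x"
    and act_mult: "g \<in> carrier G \<Longrightarrow> h \<in> carrier G \<Longrightarrow> x \<in> L \<Longrightarrow> \<alpha> (g \<otimes> h) x = \<alpha> g (\<alpha> h x)"
    and act_one: "x \<in> L \<Longrightarrow> \<alpha> \<one> x = x"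
    and split: "minpoly k \<theta> = (\<Prod>\<rho>\<in>(\<lambda>g. \<alpha> g \<theta>) ` carrier G. [:- \<rho>, 1:])"
begin

interpretation G: group G by (rule G)

lemma srk: "subring_set k" and srL: "subring_set L"
  by (rule subfield_subring[OF k], rule subfield_subring[OF L])

lemma theta_L: "\<theta> \<in> L"
  unfolding L_eq by (rule adj_self[OF srk])

lemma act_inj: "g \<in> carrier G \<Longrightarrow> x \<in> L \<Longrightarrow> y \<in> L \<Longrightarrow> \<alpha> g x = \<alpha> g y \<Longrightarrow> x = y"
  by (rule hom_field_inj[OF act_hom L])

subsection \<open>The regular action on the variables\<close>

definition n :: nat where
  "n = card (carrier G)"

definition enum :: "nat \<Rightarrow> 'g" where
  "enum = (SOME h. bij_betw h {..<n} (carrier G))"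

lemma enum: "bij_betw enum {..<n} (carrier G)"
  unfolding enum_def n_def atLeast0LessThan[symmetric]
  by (rule someI_ex[OF ex_bij_betw_nat_finite[OF fin_G]])

definition perm :: "'g \<Rightarrow> nat \<Rightarrow> nat" where
  "perm g i = inv_into {..<n} enum (g \<otimes> enum i)"

lemma enum_in: "i < n \<Longrightarrow> enum i \<in> carrier G"
  using enum by (auto simp: bij_betw_def)

lemma perm: assumes "g \<in> carrier G" "i < n"
  shows "perm g i < n" "enum (perm g i) = g \<otimes> enum i"
proof -
  have "g \<otimes> enum i \<in> enum ` {..<n}"
    using enum enum_in[OF assms(2)] assms(1) by (simp add: bij_betw_def)
  then show "perm g i < n" "enum (perm g i) = g \<otimes> enum i"
    unfolding perm_def using inv_into_into[of _ enum "{..<n}"] f_inv_into_f[of _ enum "{..<n}"] by auto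
qed

lemma enum_inj: "i < n \<Longrightarrow> j < n \<Longrightarrow> enum i = enum j \<Longrightarrow> i = j"
  using enum by (auto simp: bij_betw_def dest: inj_onD)

lemma perm_mult:
  assumes "g \<in> carrier G" "h \<in> carrier G" "i < n" shows "perm (g \<otimes> h) i = perm g (perm h i)"
  using assms perm by (intro enum_inj) (simp_all add: G.m_assoc enum_in)

lemma perm_one: "i < n \<Longrightarrow> perm \<one> i = i"
  using perm[OF G.one_closed] by (intro enum_inj) (simp_all add: enum_in)

lemma perm_inj:
  assumes "g \<in> carrier G" "i < n" "j < n" "perm g i = perm g j" shows "i = j"
  using assms perm[of g i] perm[of g j] by (intro enum_inj) (auto simp: enum_in)

text \<open>The regular action is free, so a single value identifies the group element.\<close>

lemma perm_eq:
  assumes "g \<in> carrier G" "h \<in> carrier G" "i < n" "perm g i = perm h i" shows "g = h"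
  using assms perm(2)[of g i] perm(2)[of h i] enum_in by (metis G.r_cancel)

lemma n_pos: "n > 0"
  using fin_G G.one_closed unfolding n_def by (auto simp: card_gt_0_iff)

lemma perm_bij: "g \<in> carrier G \<Longrightarrow> perm g ` {..<n} = {..<n}"
  using perm perm_inj by (intro endo_inj_surj inj_onI) auto

text \<open>The exponents \<open>i + 1\<close> are pairwise distinct, so the monomial of \<open>p\<close> determines \<open>p\<close> on \<open>{..<n}\<close>.\<close>

definition monomial :: "(nat \<Rightarrow> nat) \<Rightarrow> nat \<Rightarrow>\<^sub>0 nat" where
  "monomial p = (\<Sum>i<n. single (p i) (Suc i))"

lemma lookup_monomial:
  assumes "inj_on p {..<n}" "i < n" shows "lookup (monomial p) (p i) = Suc i"
proof -
  have "lookup (monomial p) (p i) = (\<Sum>j<n. if j = i then Suc i else 0)"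
    unfolding monomial_def lookup_sum using assms
    by (intro sum.cong refl) (auto simp: lookup_single when_def dest: inj_onD)
  then show ?thesis using assms by simp
qed

lemma monomial_eqD:
  assumes p: "inj_on p {..<n}" and q: "inj_on q {..<n}" "q ` {..<n} = {..<n}" "p ` {..<n} \<subseteq> {..<n}"
    and eq: "monomial p = monomial q" and i: "i < n"
  shows "p i = q i"
proof -
  obtain j where j: "j < n" "p i = q j" using q i by (metis image_iff image_subset_iff lessThan_iff)
  have "Suc i = Suc j" using lookup_monomial[OF p i] lookup_monomial[OF q(1) j(1)] eq j by simp
  then show ?thesis using j by simp
qed

lemma keys_monomial: assumes "p ` {..<n} \<subseteq> {..<n}" shows "keys (monomial p) \<subseteq> {..<n}"
proof
  fix j assume "j \<in> keys (monomial p)"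
  then obtain i where "i < n" "j \<in> keys (single (p i) (Suc i))"
    unfolding monomial_def using keys_sum[of "\<lambda>i. single (p i) (Suc i)" "{..<n}"] by blast
  then show "j \<in> {..<n}" using assms by auto
qed

lemma monomial_cong: "(\<And>i. i < n \<Longrightarrow> p i = q i) \<Longrightarrow> monomial p = monomial q"
  by (simp add: monomial_def)

subsection \<open>The invariants\<close>

text \<open>The orbit sum of \<theta> times the product of the powers \<open>x_i^(i+1)\<close>.
  Distinct group elements contribute distinct monomials, the one of \<open>perm g\<close> with
  coefficient \<open>\<alpha> g \<theta>\<close>. Thus a permutation and the automorphism of
  \<open>L\<close> that belongs to it can be read off from one term.\<close>

definition e :: "'a mpoly" where
  "e = (\<Sum>g\<in>carrier G. single (monomial (perm g)) (\<alpha> g \<theta>))"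

text \<open>Up to sign the elementary symmetric polynomials, indexed by the power of the auxiliary
  variable.\<close>

definition s :: "nat \<Rightarrow> 'a mpoly" where
  "s = pcoeff (\<Prod>j<n. [:- Var j, 1:])"

text \<open>The generators of \<open>K\<close>; the cubic sits at index \<open>n\<close>, and no
  larger index is ever substituted.\<close>

definition tau :: "nat \<Rightarrow> 'a mpoly poly" where
  "tau i = (if i < n then [:s i:] else [:- e, 0, 1, 1:])"

definition tw :: "('a \<Rightarrow> 'a) \<Rightarrow> (nat \<Rightarrow> nat) \<Rightarrow> 'a mpoly \<Rightarrow> 'a mpoly" where
  "tw \<gamma> p = ev (\<lambda>c. Const (\<gamma> c)) (\<lambda>i. Var (p i))"

lemma e_in: "e \<in> mpoly_over L n"
  unfolding e_def using perm_bij
  by (intro mpoly_over_sum[OF srL] mpoly_over_single[OF srL] act_L theta_L keys_monomial) auto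

lemma prodX_in: "(\<Prod>j<n. [:- Var j, 1:]) \<in> polys (mpoly_over k n)"
  by (intro subring_set_prod subring_set_polys polys_linear subring_set_mpoly_over srk
      subring_set_minus subring_set_1 Var_in) auto

lemma s_in: "s i \<in> mpoly_over k n"
  unfolding s_def by (rule coeff_polys[OF prodX_in])

lemma mpoly_kL: "mpoly_over k n \<subseteq> mpoly_over L n"
  by (rule mpoly_over_mono[OF kL])

lemma srUL: "subring_set (polys (mpoly_over L n))"
  by (rule polys_mpoly_subring[OF srL])

lemma tau_in: "tau i \<in> polys (mpoly_over L n)"
  using s_in mpoly_kL e_in subring_set_mpoly_over[OF srL, of n] srUL
  by (auto simp: tau_def polys_pCons_iff intro!: polys_0 subring_set_minus subring_set_0 subring_set_1)

lemma cst_in: "c \<in> L \<Longrightarrow> cst c \<in> polys (mpoly_over L n)"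
  unfolding cst_def by (intro polys_const subring_set_mpoly_over Const_in srL)

text \<open>Algebraic independence: every point of affine space over the algebraic closure is a value of \<open>tau\<close>.\<close>

lemma tau_indep:
  assumes p: "p \<in> mpoly_over k (Suc n)" and zero: "ev (\<lambda>c. jC (cst c)) (\<lambda>i. jC (tau i)) p = 0"
  shows "p = 0"
proof -
  have "jC (ev cst tau p) = jC 0"
    using zero hom_ev[OF jC_hom p, of cst tau] by (simp add: jC.hom_0)
  then have zU: "ev cst tau p = 0" by (simp only: jC_eq_iff)
  have "ev to_ac t p = 0" for t :: "nat \<Rightarrow> 'a alg_closure"
  proof -
    \<comment> \<open>The point \<open>t\<close> is attained: take for \<open>x\<close> the roots of
      the monic polynomial with coefficients \<open>t i\<close>, and for \<open>y\<close> a root of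
      the cubic \<open>Q\<close> that prescribes the last coordinate.\<close>
    obtain x where x: "\<And>i. i < n \<Longrightarrow> pcoeff (\<Prod>j<n. [:- x j, 1:]) i = t i"
      using monic_roots_enumeration[of n t] by blast
    have hx: "ring_hom_on (mpoly_over L n) (ev to_ac x)" by (rule ev_hom[OF to_ac_hom[OF srL]])
    interpret hx: ring_hom_on "mpoly_over L n" "ev to_ac x" by (rule hx)
    interpret mx: ring_hom_on "polys (mpoly_over L n)" "map_poly (ev to_ac x)" by (rule hx.map_poly_hom)
    define Q where "Q = [:- ev to_ac x e - t n, 0, 1, 1:]"
    have "pdeg Q > 0" by (simp add: Q_def)
    then obtain y where y: "poly Q y = 0" using alg_closed_imp_poly_has_root by blast
    define h where "h p = poly (map_poly (ev to_ac x) p) y" for p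
    have h: "ring_hom_on (polys (mpoly_over L n)) h"
      unfolding h_def
      by (unfold_locales) (simp_all add: mx.hom_add mx.hom_mult mx.hom_1 srUL)
    have hc: "h (cst c) = to_ac c" for c
      by (simp add: h_def cst_def hx.map_poly_pCons_hom ev_Const)
    have VL: "Var j \<in> mpoly_over L n" if "j < n" for j using Var_in[OF srL that] .
    have "map_poly (ev to_ac x) (\<Prod>j<n. [:- Var j, 1:]) = (\<Prod>j<n. map_poly (ev to_ac x) [:- Var j, 1:])"
      using VL subring_set_mpoly_over[OF srL, of n]
      by (intro mx.hom_prod polys_linear subring_set_minus subring_set_1) auto
    also have "\<dots> = (\<Prod>j<n. [:- x j, 1:])"
      using VL by (intro prod.cong refl)
        (simp add: hx.map_poly_pCons_hom hx.hom_minus hx.hom_1 ev_Var)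
    finally have "ev to_ac x (s i) = t i" if "i < n" for i
      using x[OF that] hx.coeff_map_poly_hom unfolding s_def by metis
    then have ht: "h (tau i) = t i" if "i < Suc n" for i
      using that y e_in
      by (auto simp: h_def tau_def Q_def hx.map_poly_pCons_hom hx.hom_0 hx.hom_1 hx.hom_minus less_Suc_eq
          algebra_simps)
    have "h (ev cst tau p) = ev (\<lambda>c. h (cst c)) (\<lambda>i. h (tau i)) p"
      using kL by (intro hom_ev[OF h p] cst_in tau_in) auto
    also have "\<dots> = ev to_ac t p" by (rule ev_cong[OF p hc ht])
    finally show ?thesis using zU ring_hom_on.hom_0[OF h] by simp
  qed
  then show ?thesis
    by (rule mpoly_zero_everywhere[OF to_ac_hom[OF srk] k alg_closed_infinite p])
qed

sublocale base: generic_base k "Suc n" cC "\<lambda>i. jC (tau i)"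
proof (rule generic_base.intro)
  show "is_subfield k" by (rule k)
  show "ring_hom_on k cC" by (rule cC_hom_on[OF srk])
  show "p = 0" if "p \<in> mpoly_over k (Suc n)" "ev cC (\<lambda>i. jC (tau i)) p = 0" for p
    using tau_indep[OF that(1)] that(2) unfolding cC_def .
qed

abbreviation K where "K \<equiv> base.base"

lemmas K = base.base_subfield

lemma srK: "subring_set K"
  by (rule subfield_subring[OF K])

lemma inf_cC_k: "infinite (cC ` k)" "cC ` k \<subseteq> K"
  using inf_k base.f_in_base by (auto simp: finite_image_iff inj_on_def cC_eq_iff)

lemma inf_K: "infinite K"
  using inf_cC_k finite_subset by blast

section \<open>The generators \<theta>, \<open>x_i\<close> and \<open>y\<close> and their
  separability\<close>

definition jV :: "'a mpoly \<Rightarrow> 'a mpoly fract poly fract alg_closure" where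
  "jV q = jC [:q:]"

lemma jV_hom: "ring_hom_on UNIV jV"
proof
  show "jV (x * y) = jV x * jV y" for x y :: "'a mpoly"
    unfolding jV_def jC.hom_mult[OF UNIV_I UNIV_I, symmetric] by (simp add: mult.commute)
qed (auto simp: jV_def subring_set_UNIV one_pCons[symmetric] jC.hom_1 simp flip: jC.hom_add)

lemma jV_eq_iff: "jV p = jV q \<longleftrightarrow> p = q"
  by (simp add: jV_def jC_eq_iff)

lemma jV_Const: "jV (Const c) = cC c"
  by (simp add: jV_def cC_def cst_def)

definition xC :: "nat \<Rightarrow> 'a mpoly fract poly fract alg_closure" where
  "xC i = jV (Var i)"

definition yC :: "'a mpoly fract poly fract alg_closure" where
  "yC = jC [:0, 1:]"

lemma xC_inj: "xC i = xC j \<longleftrightarrow> i = j"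
proof
  assume "xC i = xC j"
  then have v: "Var i = (Var j :: 'a mpoly)" by (simp add: xC_def jV_eq_iff)
  have "ev (\<lambda>x::'a. x) (\<lambda>l. if l = i then 1 else 0) (Var i) = 1"
    "ev (\<lambda>x::'a. x) (\<lambda>l. if l = i then 1 else 0) (Var j) = (if j = i then 1 else 0)"
    by (simp_all add: ev_Var)
  then show "i = j" using v by (metis zero_neq_one)
qed simp

lemma tau_n: "jC (tau n) = yC ^ 3 + yC ^ 2 - jV e"
proof -
  have "tau n = [:0, 1:] ^ 3 + [:0, 1:] ^ 2 - [:e:]"
    by (simp add: tau_def power2_eq_square power3_eq_cube)
  then show ?thesis unfolding yC_def jV_def by (simp only: jC.hom_add jC.hom_diff jC.hom_power UNIV_I)
qed

lemma sep_th: "sep K (cC \<theta>)"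
  by (rule sep_mono[OF sep_hom[OF cC_hom sep_theta] inf_cC_k(2)])

text \<open>A polynomial over \<open>K\<close> with roots \<open>xC i\<close>; it is the reason why
  automorphisms over \<open>K\<close> permute the \<open>xC i\<close>.\<close>

definition PX where "PX = (\<Prod>j<n. [:- xC j, 1:])"

lemma PX_map: "PX = map_poly jV (\<Prod>j<n. [:- Var j, 1:])"
proof -
  interpret jV: ring_hom_on UNIV jV by (rule jV_hom)
  interpret m: ring_hom_on "polys UNIV" "map_poly jV" by (rule jV.map_poly_hom)
  have "map_poly jV (\<Prod>j<n. [:- Var j, 1:]) = (\<Prod>j<n. map_poly jV [:- Var j, 1:])"
    by (rule m.hom_prod) (simp add: polys_UNIV)
  then show ?thesis
    unfolding PX_def xC_def by (simp add: jV.map_poly_pCons_hom jV.hom_minus jV.hom_1)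
qed

lemma PX_K: "PX \<in> polys K"
proof -
  have deg: "pdeg PX = n" unfolding PX_def
    by (subst degree_prod_eq_sum_degree) auto
  have lead: "plead PX = 1" unfolding PX_def by (simp add: lead_coeff_prod)
  have "pcoeff PX i \<in> K" for i
  proof -
    consider "i < n" | "i = n" | "i > n" by linarith
    then show ?thesis
    proof cases
      case 1
      have "pcoeff PX i = jV (s i)"
        unfolding PX_map s_def by (rule ring_hom_on.coeff_map_poly_hom[OF jV_hom])
      also have "\<dots> = jC (tau i)" using 1 by (simp add: tau_def jV_def)
      finally show ?thesis using base.t_in_base[of i] 1 by simp
    next
      case 2
      then show ?thesis using lead deg subring_set_1[OF srK] by simp
    next
      case 3
      then show ?thesis using deg subring_set_0[OF srK] by (simp add: coeff_eq_0)
    qed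
  qed
  then show ?thesis by (simp add: polys_def)
qed

lemma PX_root: "poly PX r = 0 \<longleftrightarrow> (\<exists>i<n. r = xC i)"
  by (auto simp: PX_def poly_prod)

lemma sep_xC: assumes i: "i < n" shows "sep K (xC i)"
proof -
  define l where "l = [:- xC i, 1:]"
  have l: "poly l (xC i) = 0" "pderiv l = 1" by (simp_all add: l_def pderiv_pCons)
  have "PX = l * (\<Prod>j\<in>{..<n} - {i}. [:- xC j, 1:])"
    unfolding PX_def l_def using i by (intro prod.remove) auto
  then have "poly (pderiv PX) (xC i) = (\<Prod>j\<in>{..<n} - {i}. xC i - xC j)"
    by (simp add: pderiv_mult l poly_prod)
  also have "\<dots> \<noteq> 0" by (auto simp: xC_inj)
  finally show ?thesis using PX_K PX_root[of "xC i"] i by (auto simp: sep_def)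
qed

lemma cC_L_in:
  assumes T: "subring_set T" "K \<subseteq> T" "cC \<theta> \<in> T" and c: "c \<in> L"
  shows "cC c \<in> T"
proof -
  obtain p where p: "p \<in> polys k" "c = poly p \<theta>" using c unfolding L_eq by (rule adjE)
  have "map_poly cC p \<in> polys K"
    using p base.f_in_base by (auto simp: polys_def cC.coeff_map_poly_hom)
  then show ?thesis
    using cC.poly_map_poly_hom[of p \<theta>] p poly_in_subring[OF T(1) _ T(3), of "map_poly cC p"] polys_mono[OF T(2)]
    by (auto simp: polys_UNIV)
qed

lemma jV_ev: "p \<in> mpoly_over L n \<Longrightarrow> jV p = ev cC xC p"
  using hom_ev[OF jV_hom, of p L n Const Var] ev_Const_Var[of p L n] unfolding jV_Const xC_def[symmetric] by simp

lemma jV_in: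
  assumes T: "subring_set T" "K \<subseteq> T" "cC \<theta> \<in> T" and x: "\<And>i. i < n \<Longrightarrow> xC i \<in> T" and p: "p \<in> mpoly_over L n"
  shows "jV p \<in> T"
  unfolding jV_ev[OF p] by (rule ev_in[OF p T(1) cC_L_in[OF T] x])

definition A1 where "A1 = insert (cC \<theta>) (xC ` {..<n})"

text \<open>\<open>e\<close> lies in the field generated over \<open>K\<close> by \<theta> and the
  \<open>x_i\<close>, all separable; a primitive element reduces the claim to
  \<open>sep_adj\<close>.\<close>

lemma sep_e: "sep K (jV e)"
proof -
  have "sep K a" if "a \<in> A1" for a using that sep_th sep_xC by (auto simp: A1_def)
  then obtain z where z: "sep K z" "A1 \<subseteq> adj K z"
    using primitive_element[OF K inf_cC_k(2,1), of A1] by (auto simp: A1_def)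
  have "jV e \<in> adj K z"
    using z(2) adj_base[OF srK] by (intro jV_in subring_set_adj srK e_in) (auto simp: A1_def)
  then show ?thesis by (rule sep_adj[OF K inf_K z(1)])
qed

text \<open>T(y) = e for a cubic \<open>T\<close> over \<open>K\<close>, so \<open>y\<close> is a
  root of the minimal polynomial of \<open>e\<close> composed with \<open>T\<close>. By the chain
  rule it is a simple root once T'(y) is nonzero, and \<open>3 y^2 + 2 y\<close> is nonzero because
  2 and 3 cannot both vanish.\<close>

lemma sep_yC: "sep K yC"
proof -
  define T where "T = [:- jC (tau n), 0, 1, 1:]"
  have T: "T \<in> polys K" unfolding T_def
    using base.t_in_base[of n] srK by (auto simp: polys_pCons_iff intro: polys_0 subring_set_minus subring_set_0 subring_set_1)
  have Ty: "poly T yC = jV e" by (simp add: T_def tau_n power2_eq_square power3_eq_cube algebra_simps)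
  have "poly (pderiv T) yC = yC + yC + (yC * yC + yC * yC + yC * yC)"
    by (simp add: T_def pderiv_pCons algebra_simps)
  also have "\<dots> = jC [:0, 1 + 1, 1 + 1 + 1:]"
  proof -
    have "[:0, 1 + 1, 1 + 1 + 1:] = ([:0, 1:] + [:0, 1:] + ([:0, 1:] * [:0, 1:] + [:0, 1:] * [:0, 1:] + [:0, 1:] * [:0, 1:]) :: 'a mpoly poly)"
      by simp
    then show ?thesis unfolding yC_def by (simp only: jC.hom_add jC.hom_mult UNIV_I)
  qed
  also have "\<dots> \<noteq> 0"
  proof
    assume "jC [:0, 1 + 1 :: 'a mpoly, 1 + 1 + 1:] = 0"
    then have "[:0, 1 + 1, 1 + 1 + 1:] = (0 :: 'a mpoly poly)" by (simp only: jC_eq_0_iff)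
    then have "(1::'a mpoly) + 1 = 0" "(1::'a mpoly) + 1 + 1 = 0"
      unfolding pCons_eq_0_iff by blast+
    then have "0 + (1::'a mpoly) = 0" by metis
    then show False by simp
  qed
  finally have dT: "poly (pderiv T) yC \<noteq> 0" .
  let ?H = "minpoly K (jV e)"
  note al = sep_imp_alg[OF sep_e]
  have "pcompose ?H T \<in> polys K" by (intro polys_pcompose srK minpoly_props[OF K al] T)
  moreover have "poly (pcompose ?H T) yC = 0"
    using minpoly_props(3)[OF K al] by (simp add: poly_pcompose Ty)
  moreover have "poly (pderiv (pcompose ?H T)) yC \<noteq> 0"
    using sep_minpoly[OF K sep_e] dT by (simp add: pderiv_pcompose poly_pcompose Ty)
  ultimately show ?thesis by (auto simp: sep_def)
qed

subsection \<open>The action on the function field\<close>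

lemma tw_hom:
  assumes "ring_hom_on L \<gamma>" shows "ring_hom_on (mpoly_over L n) (tw \<gamma> p)"
  unfolding tw_def
  by (rule ev_hom[OF ring_hom_on_comp[OF assms Const_hom[OF subring_set_UNIV]]]) simp

lemma tw_in:
  assumes "\<And>c. c \<in> L \<Longrightarrow> \<gamma> c \<in> L" "\<And>i. i < n \<Longrightarrow> p i < n" "q \<in> mpoly_over L n"
  shows "tw \<gamma> p q \<in> mpoly_over L n"
  unfolding tw_def using assms
  by (intro ev_in[OF assms(3)] subring_set_mpoly_over srL Const_in Var_in) auto

lemma mon_val_Var_monomial: "mon_val (\<lambda>i. Var (p i)) (monomial q) = (single (monomial (\<lambda>i. p (q i))) 1 :: 'a mpoly)"
proof -
  have pow: "Var i ^ d = single (single i d) (1::'a)" for i d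
    by (induction d) (simp_all add: Var_def mult_single flip: single_add)
  have "mon_val (\<lambda>i. Var (p i)) (\<Sum>i\<in>I. single (q i) (Suc i)) =
    (single (\<Sum>i\<in>I. single (p (q i)) (Suc i)) 1 :: 'a mpoly)" for I
    by (induction I rule: infinite_finite_induct)
       (simp_all add: mon_0 mon_add mon_single mult_single pow del: power_Suc)
  then show ?thesis by (simp add: monomial_def)
qed

lemma tw_e:
  assumes \<gamma>: "ring_hom_on L \<gamma>"
  shows "tw \<gamma> p e = (\<Sum>g\<in>carrier G. single (monomial (\<lambda>i. p (perm g i))) (\<gamma> (\<alpha> g \<theta>)))"
proof -
  interpret t: ring_hom_on "mpoly_over L n" "tw \<gamma> p" by (rule tw_hom[OF \<gamma>])
  have "tw \<gamma> p e = (\<Sum>g\<in>carrier G. tw \<gamma> p (single (monomial (perm g)) (\<alpha> g \<theta>)))"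
    unfolding e_def using perm_bij
    by (intro t.hom_sum mpoly_over_single[OF srL] act_L theta_L keys_monomial) auto
  moreover have "tw \<gamma> p (single (monomial (perm g)) (\<alpha> g \<theta>)) =
    single (monomial (\<lambda>i. p (perm g i))) (\<gamma> (\<alpha> g \<theta>))" for g
    using ring_hom_on.hom_0[OF \<gamma>]
    by (simp add: tw_def ev_single Const_def mon_val_Var_monomial mult_single)
  ultimately show ?thesis by simp
qed

text \<open>The summand of \<open>h\<close> goes to the summand of \<open>g \<otimes> h\<close>, so
  the orbit sum is only reindexed.\<close>

lemma tw_e_act:
  assumes g: "g \<in> carrier G" shows "tw (\<alpha> g) (perm g) e = e"
proof -
  have "tw (\<alpha> g) (perm g) e =
      (\<Sum>h\<in>carrier G. single (monomial (perm (g \<otimes> h))) (\<alpha> (g \<otimes> h) \<theta>))"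
    unfolding tw_e[OF act_hom[OF g]] using g
    by (intro sum.cong refl) (auto simp: act_mult theta_L perm_mult intro!: arg_cong2[of _ _ _ _ single] monomial_cong)
  also have "\<dots> = e"
    unfolding e_def
    by (rule sum.reindex_bij_witness[of _ "\<lambda>h. inv g \<otimes> h" "\<lambda>h. g \<otimes> h"])
       (use g in \<open>auto simp: G.m_assoc[symmetric]\<close>)
  finally show ?thesis .
qed

lemma tw_s:
  assumes \<gamma>: "ring_hom_on L \<gamma>" and p: "inj_on p {..<n}" "p ` {..<n} = {..<n}"
  shows "tw \<gamma> p (s i) = s i"
proof -
  interpret t: ring_hom_on "mpoly_over L n" "tw \<gamma> p" by (rule tw_hom[OF \<gamma>])
  interpret m: ring_hom_on "polys (mpoly_over L n)" "map_poly (tw \<gamma> p)" by (rule t.map_poly_hom)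
  have VL: "Var j \<in> mpoly_over L n" if "j < n" for j using Var_in[OF srL that] .
  have tV: "tw \<gamma> p (Var j) = Var (p j)" for j
    unfolding tw_def using ring_hom_on.hom_0[OF \<gamma>] ring_hom_on.hom_1[OF \<gamma>]
    by (subst ev_Var) (simp_all add: Const_def)
  have "map_poly (tw \<gamma> p) (\<Prod>j<n. [:- Var j, 1:]) = (\<Prod>j<n. map_poly (tw \<gamma> p) [:- Var j, 1:])"
    using VL subring_set_mpoly_over[OF srL, of n]
    by (intro m.hom_prod polys_linear subring_set_minus subring_set_1) auto
  also have "\<dots> = (\<Prod>j<n. [:- Var (p j), 1:])"
    using VL by (intro prod.cong refl) (simp add: t.map_poly_pCons_hom t.hom_minus t.hom_1 tV)
  also have "\<dots> = (\<Prod>j\<in>p ` {..<n}. [:- Var j, 1:])"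
    by (subst prod.reindex[OF p(1)]) simp
  finally show ?thesis unfolding s_def p(2) using t.coeff_map_poly_hom by metis
qed

text \<open>The action of \<open>g\<close> on L[x][Y], with Y fixed. It is kept on polynomials;
  \<open>rho_relation\<close> takes the place of an extension to fractions.\<close>

definition rho :: "'g \<Rightarrow> 'a mpoly poly \<Rightarrow> 'a mpoly poly" where
  "rho g = map_poly (tw (\<alpha> g) (perm g))"

lemma rho_hom: "g \<in> carrier G \<Longrightarrow> ring_hom_on (polys (mpoly_over L n)) (rho g)"
  unfolding rho_def by (rule ring_hom_on.map_poly_hom[OF tw_hom[OF act_hom]])

lemma rho_pCons: "g \<in> carrier G \<Longrightarrow> rho g (pCons a p) = pCons (tw (\<alpha> g) (perm g) a) (rho g p)"
  unfolding rho_def by (rule ring_hom_on.map_poly_pCons_hom[OF tw_hom[OF act_hom]])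

lemma rho_0: "rho g 0 = 0"
  by (simp add: rho_def)

lemma rho_in:
  assumes "g \<in> carrier G" "p \<in> polys (mpoly_over L n)" shows "rho g p \<in> polys (mpoly_over L n)"
  using assms tw_in[OF act_L perm(1)]
  by (auto simp: rho_def polys_def ring_hom_on.coeff_map_poly_hom[OF tw_hom[OF act_hom]])

lemma tw_Const: "g \<in> carrier G \<Longrightarrow> tw (\<alpha> g) p (Const c) = Const (\<alpha> g c)"
  unfolding tw_def using ring_hom_on.hom_0[OF act_hom] by (subst ev_Const) (simp_all add: Const_def)

lemma tw_Var: "g \<in> carrier G \<Longrightarrow> tw (\<alpha> g) p (Var i) = Var (p i)"
  unfolding tw_def using ring_hom_on.hom_0[OF act_hom] ring_hom_on.hom_1[OF act_hom]
  by (subst ev_Var) (simp_all add: Const_def)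

lemma rho_cst: "g \<in> carrier G \<Longrightarrow> rho g (cst c) = cst (\<alpha> g c)"
  by (simp add: cst_def rho_pCons rho_0 tw_Const)

lemma rho_tau: assumes g: "g \<in> carrier G" shows "rho g (tau i) = tau i"
proof -
  interpret t: ring_hom_on "mpoly_over L n" "tw (\<alpha> g) (perm g)" by (rule tw_hom[OF act_hom[OF g]])
  have inj: "inj_on (perm g) {..<n}" using perm_inj[OF g] by (intro inj_onI) auto
  show ?thesis
    using tw_s[OF act_hom[OF g] inj perm_bij[OF g]] tw_e_act[OF g] e_in
    by (auto simp: tau_def rho_pCons[OF g] rho_0 t.hom_minus t.hom_0 t.hom_1)
qed

lemma coeff_rho: "g \<in> carrier G \<Longrightarrow> pcoeff (rho g p) i = tw (\<alpha> g) (perm g) (pcoeff p i)"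
  unfolding rho_def by (rule ring_hom_on.coeff_map_poly_hom[OF tw_hom[OF act_hom]])

lemma rho_mult:
  assumes g: "g \<in> carrier G" and h: "h \<in> carrier G" and p: "p \<in> polys (mpoly_over L n)"
  shows "rho (g \<otimes> h) p = rho g (rho h p)"
proof (rule poly_eqI)
  fix i
  have q: "pcoeff p i \<in> mpoly_over L n" by (rule coeff_polys[OF p])
  have "tw (\<alpha> g) (perm g) (ev (\<lambda>c. Const (\<alpha> h c)) (\<lambda>i. Var (perm h i)) (pcoeff p i)) =
    ev (\<lambda>c. tw (\<alpha> g) (perm g) (Const (\<alpha> h c))) (\<lambda>i. tw (\<alpha> g) (perm g) (Var (perm h i))) (pcoeff p i)"
    using perm[OF h] act_L[OF h]
    by (intro hom_ev[OF tw_hom[OF act_hom[OF g]] q] Const_in Var_in srL)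
  also have "\<dots> = ev (\<lambda>c. Const (\<alpha> (g \<otimes> h) c)) (\<lambda>i. Var (perm (g \<otimes> h) i)) (pcoeff p i)"
    by (intro ev_cong[OF q]) (use g h in \<open>simp_all add: tw_Const tw_Var act_mult perm_mult\<close>)
  finally show "pcoeff (rho (g \<otimes> h) p) i = pcoeff (rho g (rho h p)) i"
    using g h by (simp add: coeff_rho) (simp add: tw_def)
qed

text \<open>The polynomial ring over \<open>k\<close> in the \<open>tau i\<close>, inside L[x][Y].
  \<open>K\<close> is the fraction field of its image, and \<open>rho g\<close> fixes it
  pointwise.\<close>

definition R0 where "R0 = ev cst tau ` mpoly_over k (Suc n)"

lemma ev_cst_hom: "ring_hom_on (mpoly_over k (Suc n)) (ev cst tau)"
  by (rule ev_hom[OF ring_hom_on_subset[OF cst_hom srk]]) simp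

lemma srR0: "subring_set R0"
  unfolding R0_def by (rule ring_hom_on.hom_image_subring[OF ev_cst_hom])

lemma R0_UL: "R0 \<subseteq> polys (mpoly_over L n)"
  unfolding R0_def using kL by (auto intro!: ev_in srUL cst_in tau_in)

lemma rho_R0: assumes g: "g \<in> carrier G" and x: "x \<in> R0" shows "rho g x = x"
proof -
  obtain p where p: "p \<in> mpoly_over k (Suc n)" "x = ev cst tau p" using x by (auto simp: R0_def)
  have "rho g x = ev (\<lambda>c. rho g (cst c)) (\<lambda>i. rho g (tau i)) p"
    unfolding p(2) using kL by (intro hom_ev[OF rho_hom[OF g] p(1)] cst_in tau_in) auto
  also have "\<dots> = x"
    unfolding p(2) by (rule ev_cong[OF p(1)]) (simp_all add: rho_cst g rho_tau act_k)
  finally show ?thesis .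
qed

lemma clear_denominators:
  assumes "p \<in> polys K"
  shows "\<exists>d\<in>R0. d \<noteq> 0 \<and> (\<exists>P\<in>polys R0. psmult (jC d) p = map_poly jC P)"
  using assms
proof (induction p)
  case 0
  show ?case using subring_set_1[OF srR0] polys_0[OF srR0] by (intro bexI[of _ 1]) (auto intro!: bexI[of _ 0])
next
  case (pCons a p)
  then have a: "a \<in> K" and p: "p \<in> polys K" by (auto simp: polys_pCons_iff)
  obtain d P where d: "d \<in> R0" "d \<noteq> 0" "P \<in> polys R0" "psmult (jC d) p = map_poly jC P"
    using pCons.IH[OF p] by blast
  obtain b c where bc: "b \<in> mpoly_over k (Suc n)" "c \<in> mpoly_over k (Suc n)"
    "ev cC (\<lambda>i. jC (tau i)) c \<noteq> 0" "a = ev cC (\<lambda>i. jC (tau i)) b / ev cC (\<lambda>i. jC (tau i)) c"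
    using base.base_fraction[OF a] by blast
  define bU cU where "bU = ev cst tau b" and "cU = ev cst tau c"
  have ev: "ev cC (\<lambda>i. jC (tau i)) q = jC (ev cst tau q)" if "q \<in> mpoly_over k (Suc n)" for q
    unfolding cC_def using hom_ev[OF jC_hom that, of cst tau] by simp
  have U: "bU \<in> R0" "cU \<in> R0" unfolding bU_def cU_def R0_def using bc by auto
  have ca: "jC cU * a = jC bU" and cnz: "cU \<noteq> 0"
    using bc ev jC.hom_0 unfolding bU_def cU_def by auto
  have "psmult (jC (d * cU)) (pCons a p) = map_poly jC (pCons (d * bU) (psmult cU P))"
  proof -
    have "psmult (jC (d * cU)) p = psmult (jC cU) (map_poly jC P)"
      by (simp add: jC.hom_mult d(4)[symmetric] mult.commute)
    also have "\<dots> = map_poly jC (psmult cU P)"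
      by (rule poly_eqI) (simp add: jC.coeff_map_poly_hom jC.hom_mult)
    finally show ?thesis using ca by (simp add: jC.map_poly_pCons_hom jC.hom_mult mult.assoc)
  qed
  then show ?case
    using d U cnz by (intro bexI[of _ "d * cU"] conjI bexI[of _ "pCons (d * bU) (psmult cU P)"])
      (auto simp: polys_pCons_iff intro: subring_set_mult[OF srR0] polys_smult[OF srR0])
qed

text \<open>A common denominator from \<open>R0\<close> turns the relation over \<open>K\<close>
  into one between polynomials, to which \<open>rho g\<close> applies; denominator and coefficients
  are fixed by it.\<close>

lemma rho_relation:
  assumes g: "g \<in> carrier G" and w: "w \<in> polys (mpoly_over L n)" and u: "u \<in> polys (mpoly_over L n)"
    and p: "p \<in> polys K" and eq: "jC u = poly p (jC w)"
  shows "jC (rho g u) = poly p (jC (rho g w))"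
proof -
  interpret r: ring_hom_on "polys (mpoly_over L n)" "rho g" by (rule rho_hom[OF g])
  obtain d P where d: "d \<in> R0" "d \<noteq> 0" and P: "P \<in> polys R0" "psmult (jC d) p = map_poly jC P"
    using clear_denominators[OF p] by blast
  have jP: "jC d * poly p (jC x) = jC (poly P x)" for x
    using jC.poly_map_poly_hom[of P x] P(2) by (metis UNIV_I poly_smult polys_UNIV)
  have "jC (d * u) = jC (poly P w)" using jP[of w] eq by (simp add: jC.hom_mult)
  then have "rho g (d * u) = rho g (poly P w)" by (simp only: jC_eq_iff)
  moreover have "rho g (d * u) = d * rho g u" using d u R0_UL rho_R0[OF g] by (subst r.hom_mult) auto
  moreover have "rho g (poly P w) = poly P (rho g w)"
    by (rule hom_poly_fixed[OF rho_hom[OF g] rho_R0[OF g] R0_UL P(1) w])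
  ultimately have "jC d * jC (rho g u) = jC d * poly p (jC (rho g w))" using jP by (metis jC.hom_mult UNIV_I)
  moreover have "jC d \<noteq> 0" using d(2) by (simp add: jC_eq_0_iff)
  ultimately show ?thesis by simp
qed

lemma UL_in:
  assumes T: "subring_set T" "K \<subseteq> T" "cC \<theta> \<in> T" and x: "\<And>i. i < n \<Longrightarrow> xC i \<in> T" and y: "yC \<in> T"
    and u: "u \<in> polys (mpoly_over L n)"
  shows "jC u \<in> T"
  using u
proof (induction u)
  case 0
  then show ?case using subring_set_0[OF T(1)] by (simp add: jC.hom_0)
next
  case (pCons a u)
  then have a: "a \<in> mpoly_over L n" "jC u \<in> T" by (auto simp: polys_pCons_iff)
  have "pCons a u = [:a:] + [:0, 1:] * u" by simp
  then have "jC (pCons a u) = jV a + yC * jC u"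
    unfolding jV_def yC_def by (simp only: jC.hom_add jC.hom_mult UNIV_I)
  then show ?case using jV_in[OF T x a(1)] a(2) y by (simp add: subring_set_add[OF T(1)] subring_set_mult[OF T(1)])
qed

definition A2 where "A2 = insert yC A1"

text \<open>The generator has to come from L[x][Y] so that \<open>rho\<close> can act on it.
  Multipliers taken from the constants in \<open>k\<close> guarantee this.\<close>

lemma generator_exists:
  obtains vU where "vU \<in> polys (mpoly_over L n)" "sep K (jC vU)" "A2 \<subseteq> adj K (jC vU)"
proof -
  have "finite A2" "sep K a" if "a \<in> A2" for a using that sep_th sep_xC sep_yC by (auto simp: A2_def A1_def)
  then obtain v where v: "sep K v" "A2 \<subseteq> adj K v" "v \<in> lin_combs (cC ` k) A2"
    using primitive_element[OF K inf_cC_k(2,1), of A2] by (auto simp: A2_def A1_def)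
  have "\<exists>u\<in>polys (mpoly_over L n). x = jC u" if "x \<in> lin_combs (cC ` k) A2" for x
    using that
  proof (induction rule: lin_combs.induct)
    case (lin_combs_base a)
    have "[:0, 1:] \<in> polys (mpoly_over L n)"
      using subring_set_closed[OF subring_set_mpoly_over[OF srL, of n]] by (intro polys_linear subring_set_mpoly_over srL)
    moreover have "[:Var i:] \<in> polys (mpoly_over L n)" if "i < n" for i
      using that by (intro polys_const subring_set_mpoly_over Var_in srL)
    ultimately show ?case
      using lin_combs_base cst_in[OF theta_L] unfolding A2_def A1_def cC_def yC_def xC_def jV_def by blast
  next
    case lin_combs_0
    show ?case using subring_set_0[OF srUL] jC.hom_0 by metis
  next
    case (lin_combs_add x y c)
    then obtain u u' d where u: "u \<in> polys (mpoly_over L n)" "x = jC u" "u' \<in> polys (mpoly_over L n)" "y = jC u'"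
      "d \<in> k" "c = cC d" by blast
    then have "x + c * y = jC (u + cst d * u')" by (simp add: cC_def jC.hom_add jC.hom_mult)
    moreover have "u + cst d * u' \<in> polys (mpoly_over L n)"
      using u kL by (intro subring_set_add[OF srUL] subring_set_mult[OF srUL] cst_in) auto
    ultimately show ?case by blast
  qed
  then show thesis using that v by blast
qed

text \<open>K(v) consists of rational functions, not of arbitrary elements of the algebraic closure.
  So the image of \<open>y\<close> under an automorphism is a fraction in F(Y), as
  \<open>cubic_shift\<close> requires.\<close>

lemma adj_generator_subset_range: "adj K (jC u) \<subseteq> range to_ac"
proof -
  have "is_subfield (UNIV :: 'a mpoly fract poly fract set)" by (simp add: is_subfield_iff)
  then have f: "is_subfield (range (to_ac :: 'a mpoly fract poly fract \<Rightarrow> _))"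
    by (rule hom_image_subfield[OF to_ac_hom[OF subring_set_UNIV]])
  have j: "jC p \<in> range to_ac" for p by (simp add: jC_def)
  have ev: "ev cC (\<lambda>i. jC (tau i)) q \<in> range to_ac" if "q \<in> mpoly_over k (Suc n)" for q
    using j subfield_subring[OF f] by (intro ev_in[OF that]) (auto simp: cC_def)
  have "K \<subseteq> range to_ac"
  proof
    fix x assume "x \<in> K"
    then show "x \<in> range to_ac" using base.base_fraction ev subfield_divide[OF f] by metis
  qed
  then show ?thesis using j by (intro adj_least subfield_subring[OF f])
qed

section \<open>Determination of all automorphisms over \<open>K\<close>\<close>

context
  fixes vU
  assumes vU: "vU \<in> polys (mpoly_over L n)" and sep_v: "sep K (jC vU)" and A2v: "A2 \<subseteq> adj K (jC vU)"
begin

lemma alg_v: "alg K (jC vU)"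
  by (rule sep_imp_alg[OF sep_v])

lemma sr_adj: "subring_set (adj K (jC vU))"
  by (rule subring_set_adj[OF srK])

lemma UL_adj: "u \<in> polys (mpoly_over L n) \<Longrightarrow> jC u \<in> adj K (jC vU)"
  using A2v adj_base[OF srK] by (intro UL_in sr_adj) (auto simp: A2_def A1_def)

text \<open>\<open>rho g\<close> is applied to the relation that the minimal polynomial vanishes at
  \<open>v\<close>, and to the expression of \<open>u\<close> as a polynomial in
  \<open>v\<close>.\<close>

lemma conjugate_rho:
  assumes g: "g \<in> carrier G"
  shows "poly (minpoly K (jC vU)) (jC (rho g vU)) = 0"
    "u \<in> polys (mpoly_over L n) \<Longrightarrow> emb K (jC vU) (jC (rho g vU)) (jC u) = jC (rho g u)"
proof -
  have "jC (rho g 0) = poly (minpoly K (jC vU)) (jC (rho g vU))"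
    using minpoly_props(1,3)[OF K alg_v] by (intro rho_relation[OF g vU polys_0]) (auto simp: jC.hom_0 subring_set_mpoly_over srL)
  then show 0: "poly (minpoly K (jC vU)) (jC (rho g vU)) = 0" by (simp add: rho_0 jC.hom_0)
  assume u: "u \<in> polys (mpoly_over L n)"
  obtain p where p: "p \<in> polys K" "jC u = poly p (jC vU)" using UL_adj[OF u] by (rule adjE)
  show "emb K (jC vU) (jC (rho g vU)) (jC u) = jC (rho g u)"
    using rho_relation[OF g vU u p] emb_poly[OF K alg_v 0 p(1)] p(2) by simp
qed

lemma VarU_in: "i < n \<Longrightarrow> [:Var i:] \<in> polys (mpoly_over L n)"
  by (intro polys_const subring_set_mpoly_over Var_in srL)

lemma rho_inj:
  assumes g: "g \<in> carrier G" and h: "h \<in> carrier G" and eq: "jC (rho g vU) = jC (rho h vU)"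
  shows "g = h"
proof -
  have "jC (rho g [:Var 0:]) = jC (rho h [:Var 0:])"
    using conjugate_rho(2)[OF g VarU_in[OF n_pos]] conjugate_rho(2)[OF h VarU_in[OF n_pos]] eq by simp
  then have "xC (perm g 0) = xC (perm h 0)"
    using g h by (simp add: rho_pCons rho_0 tw_Var xC_def jV_def)
  then show ?thesis using perm_eq[OF g h n_pos] by (simp add: xC_inj)
qed

text \<open>An automorphism over \<open>K\<close> acts on \<open>L\<close> through some
  \<open>h\<close> in \<open>G\<close> and on the \<open>x_i\<close> by a permutation \<pi>; the
  cubic makes it fix \<open>y\<close> and \<open>e\<close>. The coefficient of
  \<open>monomial \<pi>\<close> in \<open>e\<close> then yields one \<open>g\<close> that induces
  both \<pi> and the action on \<open>L\<close>.\<close>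

lemma conjugate_is_rho:
  assumes r: "r \<in> adj K (jC vU)" "poly (minpoly K (jC vU)) r = 0"
  shows "\<exists>g\<in>carrier G. r = jC (rho g vU)"
proof -
  define F where "F = adj K (jC vU)"
  define \<eta> where "\<eta> = emb K (jC vU) r"
  have \<eta>: "ring_hom_on F \<eta>" unfolding F_def \<eta>_def by (rule emb_hom[OF K alg_v r(2)])
  interpret \<eta>: ring_hom_on F \<eta> by (rule \<eta>)
  have \<eta>K: "\<eta> x = x" if "x \<in> K" for x unfolding \<eta>_def by (rule emb_base[OF K alg_v r(2) that])
  have KF: "K \<subseteq> F" unfolding F_def using adj_base[OF srK] by blast
  have F: "is_subfield F" unfolding F_def by (rule adj_subfield[OF K alg_v])
  note srF = subfield_subring[OF F]
  have inF: "cC \<theta> \<in> F" "i < n \<Longrightarrow> xC i \<in> F" "yC \<in> F" for i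
    using A2v by (auto simp: F_def A2_def A1_def)
  have \<eta>F: "\<eta> x \<in> F" if "x \<in> F" for x
    unfolding \<eta>_def F_def
    by (rule emb_in[OF K alg_v r(2) _ sr_adj _ r(1)]) (use that KF in \<open>auto simp: F_def\<close>)
  note fx = hom_poly_fixed[OF \<eta> \<eta>K KF]
  \<comment> \<open>This \<open>h\<close> is determined only up to the kernel of \<alpha>; the group
    element that belongs to \<eta> is the \<open>g\<close> found below.\<close>
  obtain h where h: "h \<in> carrier G" "\<eta> (cC \<theta>) = cC (\<alpha> h \<theta>)"
  proof -
    let ?m = "map_poly cC (minpoly k \<theta>)"
    have mk: "minpoly k \<theta> \<in> polys k" "poly (minpoly k \<theta>) \<theta> = 0"
      by (rule minpoly_props[OF k sep_imp_alg[OF sep_theta]])+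
    have m: "?m \<in> polys K" using mk base.f_in_base by (auto simp: polys_def cC.coeff_map_poly_hom)
    interpret c: ring_hom_on "polys UNIV" "map_poly cC" by (rule cC.map_poly_hom)
    have "?m = (\<Prod>\<rho>\<in>(\<lambda>g. \<alpha> g \<theta>) ` carrier G. map_poly cC [:- \<rho>, 1:])"
      unfolding split by (rule c.hom_prod) (simp add: polys_UNIV)
    then have pm: "poly ?m x = (\<Prod>\<rho>\<in>(\<lambda>g. \<alpha> g \<theta>) ` carrier G. x - cC \<rho>)" for x
      by (simp add: poly_prod cC.map_poly_pCons_hom cC.hom_minus cC.hom_1)
    have "poly ?m (\<eta> (cC \<theta>)) = \<eta> (poly ?m (cC \<theta>))" using fx[OF _ m inF(1)] by simp
    also have "poly ?m (cC \<theta>) = 0" using cC.poly_map_poly_hom[of "minpoly k \<theta>" \<theta>] mk by (simp add: polys_UNIV cC.hom_0)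
    finally have "(\<Prod>\<rho>\<in>(\<lambda>g. \<alpha> g \<theta>) ` carrier G. \<eta> (cC \<theta>) - cC \<rho>) = 0" by (simp add: pm \<eta>.hom_0)
    then show thesis using that fin_G by auto
  qed
  have act_fixed: "\<alpha> g (poly p \<theta>) = poly p (\<alpha> g \<theta>)" if "g \<in> carrier G" "p \<in> polys k" for g p
    by (rule hom_poly_fixed[OF act_hom[OF that(1)] act_k[OF that(1)] kL that(2) theta_L])
  have \<eta>c: "\<eta> (cC c) = cC (\<alpha> h c)" if c: "c \<in> L" for c
  proof -
    obtain p where p: "p \<in> polys k" "c = poly p \<theta>" using c unfolding L_eq by (rule adjE)
    have m: "map_poly cC p \<in> polys K" using p base.f_in_base by (auto simp: polys_def cC.coeff_map_poly_hom)
    have cp: "cC (poly p x) = poly (map_poly cC p) (cC x)" for x using cC.poly_map_poly_hom[of p x] by (simp add: polys_UNIV)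
    have "\<eta> (cC c) = poly (map_poly cC p) (\<eta> (cC \<theta>))"
      unfolding p(2) cp using fx[OF _ m inF(1)] by simp
    then show ?thesis using h cp act_fixed[OF h(1) p(1)] p by simp
  qed
  have "\<exists>j<n. \<eta> (xC i) = xC j" if i: "i < n" for i
  proof -
    have "poly PX (\<eta> (xC i)) = \<eta> (poly PX (xC i))" using fx[OF _ PX_K inF(2)[OF i]] by simp
    also have "poly PX (xC i) = 0" using PX_root i by blast
    finally show ?thesis using PX_root \<eta>.hom_0 by simp
  qed
  then obtain \<pi> where \<pi>: "\<And>i. i < n \<Longrightarrow> \<pi> i < n" "\<And>i. i < n \<Longrightarrow> \<eta> (xC i) = xC (\<pi> i)" by metis
  have inj\<pi>: "inj_on \<pi> {..<n}"
  proof (rule inj_onI)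
    fix i j assume ij: "i \<in> {..<n}" "j \<in> {..<n}" "\<pi> i = \<pi> j"
    then have "\<eta> (xC i) = \<eta> (xC j)" using \<pi> by simp
    then have "xC i = xC j" using hom_field_inj[OF \<eta> F] inF ij by auto
    then show "i = j" by (simp add: xC_inj)
  qed
  have \<pi>im: "\<pi> ` {..<n} = {..<n}" using \<pi> inj\<pi> by (intro endo_inj_surj) auto
  have \<eta>V: "\<eta> (jV p) = jV (tw (\<alpha> h) \<pi> p)" if p: "p \<in> mpoly_over L n" for p
  proof -
    have "\<eta> (jV p) = ev (\<lambda>c. \<eta> (cC c)) (\<lambda>i. \<eta> (xC i)) p"
      unfolding jV_ev[OF p] using cC_L_in[OF srF KF inF(1)] inF by (intro hom_ev[OF \<eta> p]) auto
    also have "\<dots> = ev (\<lambda>c. cC (\<alpha> h c)) (\<lambda>i. xC (\<pi> i)) p"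
      by (rule ev_cong[OF p \<eta>c \<pi>(2)])
    also have "\<dots> = jV (tw (\<alpha> h) \<pi> p)"
      unfolding tw_def using hom_ev[OF jV_hom p, of "\<lambda>c. Const (\<alpha> h c)" "\<lambda>i. Var (\<pi> i)"]
      by (simp add: jV_Const xC_def)
    finally show ?thesis .
  qed
  define e' where "e' = tw (\<alpha> h) \<pi> e"
  \<comment> \<open>Since \<eta> fixes \<open>y^3 + y^2 - e\<close>, the image of \<open>y\<close>
    satisfies the cubic equation with right side \<open>y^3 + y^2 + (e' - e)\<close>, where
    \<open>e' - e\<close> is free of \<open>y\<close>.\<close>
  have y: "\<eta> yC = yC" and e': "e' = e"
  proof -
    have jVF: "jV e \<in> F" using jV_in[OF srF KF inF(1) _ e_in] inF by blast
    have tauK: "jC (tau n) \<in> K" using base.t_in_base[of n] by simp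
    have "yC ^ 3 + yC ^ 2 = jC (tau n) + jV e" using tau_n by simp
    then have "\<eta> (yC ^ 3 + yC ^ 2) = jC (tau n) + jV e'"
      using tauK KF jVF \<eta>K \<eta>V[OF e_in] by (auto simp: \<eta>.hom_add e'_def)
    then have "\<eta> yC ^ 3 + \<eta> yC ^ 2 = jC (tau n) + jV e'"
      using inF by (simp add: \<eta>.hom_add \<eta>.hom_power subring_set_power[OF srF])
    also have "\<dots> = jC ([:0, 1:] ^ 3 + [:0, 1:] ^ 2 - [:e:] + [:e':])"
      unfolding tau_n yC_def jV_def by (simp only: jC.hom_add jC.hom_diff jC.hom_power UNIV_I)
    also have "[:0, 1:] ^ 3 + [:0, 1:] ^ 2 - [:e:] + [:e':] = [:e' - e, 0, 1, 1:]"
      by (simp add: power2_eq_square power3_eq_cube)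
    finally have eq: "\<eta> yC ^ 3 + \<eta> yC ^ 2 = jC [:e' - e, 0, 1, 1:]" .
    obtain z where z: "\<eta> yC = to_ac z" using \<eta>F[OF inF(3)] adj_generator_subset_range unfolding F_def by blast
    have F01: "Fract 0 1 = (0 :: 'a mpoly fract)" "Fract 1 1 = (1 :: 'a mpoly fract)"
      by (simp_all add: fract_collapse)
    have "to_ac (z ^ 3 + z ^ 2) = to_ac (Fract [:Fract (e' - e) 1, 0, 1, 1:] 1)"
      using eq unfolding z jC_def by (simp add: map_poly_pCons F01 del: add_fract)
    then have zz: "z ^ 3 + z ^ 2 = Fract [:Fract (e' - e) 1, 0, 1, 1:] 1" by (simp only: to_ac_eq_iff)
    have "\<eta> yC = to_ac (Fract [:0, 1:] 1)" unfolding z using cubic_shift(1)[OF zz] by simp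
    also have "\<dots> = yC" by (simp add: yC_def jC_def map_poly_pCons F01)
    finally show "\<eta> yC = yC" .
    have "Fract (e' - e) 1 = Fract 0 1" using cubic_shift(2)[OF zz] F01 by simp
    then have "e' - e = 0" by (simp only: Fract_1_eq_iff)
    then show "e' = e" by simp
  qed
  have inj_comp: "inj_on (\<lambda>i. \<pi> (perm g i)) {..<n}" if g: "g \<in> carrier G" for g
    using perm(1)[OF g] perm_inj[OF g] inj\<pi> by (auto intro!: inj_onI dest!: inj_onD)
  \<comment> \<open>In the image of \<open>e\<close> only the summand of the unit element carries
    the monomial of \<pi>.\<close>
  have "lookup e' (monomial \<pi>) = (\<Sum>g\<in>carrier G. if g = \<one> then \<alpha> h \<theta> else 0)"
    unfolding e'_def tw_e[OF act_hom[OF h(1)]] lookup_sum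
  proof (intro sum.cong refl)
    fix g assume g: "g \<in> carrier G"
    have "monomial (\<lambda>i. \<pi> (perm g i)) = monomial \<pi> \<longleftrightarrow> g = \<one>"
    proof
      assume eq: "monomial (\<lambda>i. \<pi> (perm g i)) = monomial \<pi>"
      have "\<pi> (perm g 0) = \<pi> 0"
        by (rule monomial_eqD[OF inj_comp[OF g] inj\<pi> \<pi>im _ eq n_pos]) (use perm(1)[OF g] \<pi>(1) in auto)
      then have "perm g 0 = 0" using inj\<pi> perm(1)[OF g n_pos] n_pos by (auto dest: inj_onD)
      then show "g = \<one>" using perm_eq[OF g G.one_closed n_pos] perm_one[OF n_pos] by simp
    qed (auto intro!: monomial_cong simp: perm_one)
    then show "lookup (single (monomial (\<lambda>i. \<pi> (perm g i))) (\<alpha> h (\<alpha> g \<theta>))) (monomial \<pi>) =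
      (if g = \<one> then \<alpha> h \<theta> else 0)"
      by (auto simp: lookup_single when_def act_one theta_L)
  qed
  then have l1: "lookup e (monomial \<pi>) = \<alpha> h \<theta>" using e' fin_G by simp
  have "\<alpha> h \<theta> \<noteq> 0"
    using act_inj[OF h(1) theta_L subring_set_0[OF srL]] theta_nz ring_hom_on.hom_0[OF act_hom[OF h(1)]] by auto
  \<comment> \<open>As \<open>e' = e\<close>, this monomial occurs in \<open>e\<close> with a
    nonzero coefficient, so it belongs to some \<open>perm g\<close>.\<close>
  then have "(\<Sum>g\<in>carrier G. lookup (single (monomial (perm g)) (\<alpha> g \<theta>)) (monomial \<pi>)) \<noteq> 0"
    using l1 by (simp add: e_def lookup_sum)
  then obtain g where g: "g \<in> carrier G" "monomial (perm g) = monomial \<pi>"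
    by (metis (mono_tags, lifting) lookup_single_not_eq sum.neutral)
  have perm_inj': "inj_on (perm g') {..<n}" if "g' \<in> carrier G" for g'
    using perm_inj[OF that] by (intro inj_onI) auto
  have g\<pi>: "perm g i = \<pi> i" if i: "i < n" for i
    by (rule monomial_eqD[OF perm_inj'[OF g(1)] inj\<pi> \<pi>im _ g(2) i]) (use perm(1)[OF g(1)] in auto)
  have uniq: "monomial (perm g') = monomial \<pi> \<longleftrightarrow> g' = g" if g': "g' \<in> carrier G" for g'
  proof
    assume eq: "monomial (perm g') = monomial \<pi>"
    have "perm g' 0 = \<pi> 0"
      by (rule monomial_eqD[OF perm_inj'[OF g'] inj\<pi> \<pi>im _ eq n_pos]) (use perm(1)[OF g'] in auto)
    then show "g' = g" using g\<pi>[OF n_pos] perm_eq[OF g' g(1) n_pos] by simp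
  qed (use g in simp)
  \<comment> \<open>Read in \<open>e\<close>, the same coefficient is
    \<open>\<alpha> g \<theta>\<close>; hence \<open>g\<close> and \<open>h\<close> act alike on
    \<theta> and on \<open>L\<close>.\<close>
  have "lookup e (monomial \<pi>) = (\<Sum>g'\<in>carrier G. if g' = g then \<alpha> g \<theta> else 0)"
    unfolding e_def lookup_sum using uniq by (intro sum.cong refl) (auto simp: lookup_single when_def)
  then have gh: "\<alpha> h \<theta> = \<alpha> g \<theta>" using l1 g fin_G by simp
  have act_eq: "\<alpha> h c = \<alpha> g c" if c: "c \<in> L" for c
  proof -
    obtain p where p: "p \<in> polys k" "c = poly p \<theta>" using c unfolding L_eq by (rule adjE)
    then show ?thesis using act_fixed[OF h(1) p(1)] act_fixed[OF g(1) p(1)] gh by simp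
  qed
  have tw_eq: "tw (\<alpha> h) \<pi> a = tw (\<alpha> g) (perm g) a" if "a \<in> mpoly_over L n" for a
    unfolding tw_def using act_eq g\<pi> by (intro ev_cong[OF that]) auto
  have "\<eta> (jC u) = jC (rho g u)" if "u \<in> polys (mpoly_over L n)" for u
    using that
  proof (induction u)
    case 0
    then show ?case by (simp add: rho_0 jC.hom_0 \<eta>.hom_0)
  next
    case (pCons a u)
    then have a: "a \<in> mpoly_over L n" "u \<in> polys (mpoly_over L n)" by (auto simp: polys_pCons_iff)
    have j: "jC (pCons a u) = jV a + yC * jC u" for a u
    proof -
      have "pCons a u = [:a:] + [:0, 1:] * u" by simp
      then show ?thesis unfolding jV_def yC_def by (simp only: jC.hom_add jC.hom_mult UNIV_I)
    qed
    have "jV a \<in> F" using jV_in[OF srF KF inF(1) _ a(1)] inF by blast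
    moreover have "jC u \<in> F" unfolding F_def by (rule UL_adj[OF a(2)])
    ultimately have "\<eta> (jC (pCons a u)) = jV (tw (\<alpha> h) \<pi> a) + yC * jC (rho g u)"
      unfolding j using inF a pCons.IH
      by (simp add: \<eta>.hom_add \<eta>.hom_mult subring_set_mult[OF srF] \<eta>V y)
    also have "\<dots> = jC (rho g (pCons a u))" by (simp add: rho_pCons[OF g(1)] j tw_eq[OF a(1)])
    finally show ?case .
  qed
  from this[OF vU] have "r = jC (rho g vU)" unfolding \<eta>_def by (simp add: emb_gen[OF K alg_v r(2)])
  then show ?thesis using g by blast
qed

end

text \<open>The isomorphism of \<open>G\<close> with the automorphism group of K(v)/K, in terms of
  conjugates: \<open>c g\<close> is the image of \<open>v\<close> under \<open>g\<close>, and
  composition is expressed by \<open>emb\<close>. This is the form that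
  \<open>specialize_automorphisms\<close> carries over.\<close>

theorem generic_automorphisms:
  obtains v c where "sep K v" "cC \<theta> \<in> adj K v"
    "bij_betw c (carrier G) {r \<in> adj K v. poly (minpoly K v) r = 0}"
    "\<And>g h. g \<in> carrier G \<Longrightarrow> h \<in> carrier G \<Longrightarrow> emb K v (c g) (c h) = c (g \<otimes> h)"
    "\<And>g. g \<in> carrier G \<Longrightarrow> emb K v (c g) (cC \<theta>) = cC (\<alpha> g \<theta>)"
proof -
  obtain vU where vU: "vU \<in> polys (mpoly_over L n)" "sep K (jC vU)" "A2 \<subseteq> adj K (jC vU)"
    by (rule generator_exists)
  define c where "c g = jC (rho g vU)" for g
  note cr = conjugate_rho[OF vU]
  show thesis
  proof (rule that[of "jC vU" c])
    show "sep K (jC vU)" by (rule vU)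
    show "cC \<theta> \<in> adj K (jC vU)" using vU by (auto simp: A2_def A1_def)
    show "bij_betw c (carrier G) {r \<in> adj K (jC vU). poly (minpoly K (jC vU)) r = 0}"
    proof (rule bij_betw_imageI)
      show "inj_on c (carrier G)" using rho_inj[OF vU] by (intro inj_onI) (simp add: c_def)
      show "c ` carrier G = {r \<in> adj K (jC vU). poly (minpoly K (jC vU)) r = 0}"
        using cr(1) UL_adj[OF vU rho_in[OF _ vU(1)]] conjugate_is_rho[OF vU] by (auto simp: c_def image_iff)
    qed
    show "emb K (jC vU) (c g) (c h) = c (g \<otimes> h)" if "g \<in> carrier G" "h \<in> carrier G" for g h
      unfolding c_def using cr(2)[OF that(1) rho_in[OF that(2) vU(1)]] rho_mult[OF that vU(1)] by simp
    show "emb K (jC vU) (c g) (cC \<theta>) = cC (\<alpha> g \<theta>)" if "g \<in> carrier G" for g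
      unfolding c_def cC_def[of \<theta>] cC_def[of "\<alpha> g \<theta>"]
      using cr(2)[OF that cst_in[OF theta_L]] rho_cst[OF that] by simp
  qed
qed

end

section \<open>Finite Galois extensions\<close>

lemma ring_of_type_algebra_sel:
  "carrier (ring_of_type_algebra :: 'a::field ring) = UNIV"
  "\<zero>\<^bsub>ring_of_type_algebra\<^esub> = (0::'a)" "x \<oplus>\<^bsub>ring_of_type_algebra\<^esub> y = (x + y :: 'a)"
  "x \<otimes>\<^bsub>ring_of_type_algebra\<^esub> y = (x * y :: 'a)"
  by (simp_all add: ring_of_type_algebra_def)

lemma finite_ext_generators:
  fixes k L :: "'a::field set"
  assumes k: "is_subfield k" and fin: "finite_ext k L"
  shows "\<exists>A. finite A \<and> A \<subseteq> L \<and> (\<forall>T. subring_set T \<and> k \<subseteq> T \<and> A \<subseteq> T \<longrightarrow> L \<subseteq> T)"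
proof -
  let ?R = "ring_of_type_algebra :: 'a ring"
  interpret R: Ring.field ?R by (rule field_from_type_algebra)
  obtain n where "R.dimension n k L" using fin unfolding finite_ext_def by (rule R.finite_dimensionE')
  then obtain Vs where Vs: "set Vs \<subseteq> carrier ?R" "R.Span k Vs = L"
    using R.exists_base[OF k] by blast
  have "R.Span k Us \<subseteq> T" if "subring_set T" "k \<subseteq> T" "set Us \<subseteq> T" for T Us
    using that(3)
  proof (induction Us)
    case Nil
    then show ?case using subring_set_0[OF that(1)] by (simp add: ring_of_type_algebra_sel)
  next
    case (Cons u Us)
    show ?case
    proof
      fix x assume "x \<in> R.Span k (u # Us)"
      then have "x \<in> R.line_extension k u (R.Span k Us)" by simp
      then obtain c y where "c \<in> k" "y \<in> R.Span k Us" "x = c * u + y"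
        using R.line_extension_mem_iff[of x k u "R.Span k Us"] by (auto simp: ring_of_type_algebra_sel)
      then show "x \<in> T" using Cons that by (auto intro!: subring_set_add[OF that(1)] subring_set_mult[OF that(1)])
    qed
  qed
  moreover have "set Vs \<subseteq> L" using R.Span_base_incl[OF k Vs(1)] Vs(2) by simp
  ultimately show ?thesis using Vs(2) by (intro exI[of _ "set Vs"]) auto
qed

text \<open>Horner's scheme identifies K[a] with the inductively generated
  \<open>simple_extension\<close> of HOL-Algebra, which is finite-dimensional for algebraic
  \<open>a\<close>.\<close>

lemma finite_ext_adj:
  fixes K :: "'a::field set"
  assumes K: "is_subfield K" and a: "alg K a"
  shows "finite_ext K (adj K a)"
proof -
  let ?R = "ring_of_type_algebra :: 'a ring"
  interpret R: Ring.field ?R by (rule field_from_type_algebra)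
  have c: "a \<in> carrier ?R" by (simp add: ring_of_type_algebra_sel)
  note sr = subfield_subring[OF K]
  have "R.simple_extension K a = adj K a"
  proof
    show "R.simple_extension K a \<subseteq> adj K a"
    proof
      fix x assume "x \<in> R.simple_extension K a"
      then show "x \<in> adj K a"
      proof (induction rule: R.simple_extension.induct)
        case zero
        show ?case using subring_set_0[OF subring_set_adj[OF sr]] by (simp add: ring_of_type_algebra_sel)
      next
        case (lin k1 k2)
        then show ?case
          using adj_self[OF sr, of a] adj_base[OF sr, of k2 a]
          by (auto simp: ring_of_type_algebra_sel intro!: subring_set_add subring_set_mult subring_set_adj sr)
      qed
    qed
    show "adj K a \<subseteq> R.simple_extension K a"
    proof
      fix x assume "x \<in> adj K a"
      then obtain p where p: "p \<in> polys K" "x = poly p a" by (rule adjE)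
      have "poly p a \<in> R.simple_extension K a" using p(1)
      proof (induction p)
        case 0
        show ?case using R.simple_extension.zero[of K a] by (simp add: ring_of_type_algebra_sel)
      next
        case (pCons b p)
        then show ?case using R.simple_extension.lin[of "poly p a" K a b]
          by (simp add: ring_of_type_algebra_sel polys_pCons_iff mult.commute add.commute)
      qed
      then show "x \<in> R.simple_extension K a" using p by simp
    qed
  qed
  moreover have "R.finite_dimension K (R.simple_extension K a)"
    using R.finite_dimension_simple_extension[OF K c] algebraic_iff_alg[OF K, of a] a by (simp add: over_def)
  ultimately show ?thesis by (simp add: finite_ext_def)
qed

text \<open>The primitive element theorem is stated for algebraically closed types; this lemma and
  \<open>adj_to_ac_iff\<close> bring its result back to the type of \<open>L\<close>.\<close>

lemma sep_to_ac_iff: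
  assumes k: "is_subfield k" shows "sep (to_ac ` k) (to_ac a) \<longleftrightarrow> sep k a"
proof
  note h = to_ac_hom[OF subfield_subring[OF k]]
  interpret ac: ring_hom_on UNIV to_ac by (rule to_ac_hom[OF subring_set_UNIV])
  assume "sep (to_ac ` k) (to_ac a)"
  then obtain q where q: "q \<in> polys (to_ac ` k)" "poly q (to_ac a) = 0" "poly (pderiv q) (to_ac a) \<noteq> 0"
    by (auto simp: sep_def)
  obtain p where p: "p \<in> polys k" "q = map_poly to_ac p" using polys_image[OF h q(1)] by blast
  have "to_ac (poly p a) = 0" "to_ac (poly (pderiv p) a) \<noteq> 0"
    using q(2,3) ac.poly_map_poly_hom[of p a] ac.poly_map_poly_hom[of "pderiv p" a] map_poly_pderiv_hom[OF ac.ring_hom_on_axioms, of p]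
    by (simp_all add: p(2) polys_UNIV)
  then show "sep k a" using p(1) by (auto simp: sep_def)
qed (rule sep_hom[OF to_ac_hom[OF subring_set_UNIV]])

lemma adj_to_ac_iff:
  assumes k: "is_subfield k" shows "to_ac x \<in> adj (to_ac ` k) (to_ac a) \<longleftrightarrow> x \<in> adj k a"
proof -
  note h = to_ac_hom[OF subfield_subring[OF k]]
  interpret ac: ring_hom_on UNIV to_ac by (rule to_ac_hom[OF subring_set_UNIV])
  have e: "poly (map_poly to_ac p) (to_ac a) = to_ac (poly p a)" for p
    using ac.poly_map_poly_hom[of p a] by (simp add: polys_UNIV)
  show ?thesis
  proof
    assume "to_ac x \<in> adj (to_ac ` k) (to_ac a)"
    then obtain q where q: "q \<in> polys (to_ac ` k)" "to_ac x = poly q (to_ac a)" by (rule adjE)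
    obtain p where p: "p \<in> polys k" "q = map_poly to_ac p" using polys_image[OF h q(1)] by blast
    then show "x \<in> adj k a" using q(2) e adjI by simp
  next
    assume "x \<in> adj k a"
    then obtain p where p: "p \<in> polys k" "x = poly p a" by (rule adjE)
    moreover have "map_poly to_ac p \<in> polys (to_ac ` k)" using p by (auto simp: polys_def coeff_map_poly)
    ultimately show "to_ac x \<in> adj (to_ac ` k) (to_ac a)" using e adjI by metis
  qed
qed

lemma separable_ext_imp_sep:
  assumes k: "is_subfield k" and s: "separable_ext k L" and x: "x \<in> L"
  shows "sep k x"
proof -
  interpret ac: ring_hom_on UNIV to_ac by (rule to_ac_hom[OF subring_set_UNIV])
  obtain p where p: "irreducible_over k p" "poly p x = 0" "separable_poly p"
    using s x unfolding separable_ext_def by blast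
  have "poly (map_poly to_ac p) (to_ac x) = 0" using ac.poly_map_poly_hom[of p x] p(2) by (simp add: polys_UNIV)
  then have "poly (pderiv (map_poly to_ac p)) (to_ac x) \<noteq> 0"
    using p(3) rsquarefree_imp_simple_roots unfolding separable_poly_def by blast
  then have "poly (pderiv p) x \<noteq> 0"
    using ac.poly_map_poly_hom[of "pderiv p" x] map_poly_pderiv_hom[OF ac.ring_hom_on_axioms, of p] by (auto simp: polys_UNIV)
  then show ?thesis using p by (auto simp: sep_def irreducible_over_def poly_over_eq_polys)
qed

lemma separable_extI:
  assumes K: "is_subfield K" and s: "\<And>x. x \<in> F \<Longrightarrow> sep K x"
  shows "separable_ext K F"
  unfolding separable_ext_def
proof
  fix x assume "x \<in> F"
  then have x: "sep K x" by (rule s)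
  note al = sep_imp_alg[OF x]
  have "pderiv (minpoly K x) \<noteq> 0" using sep_minpoly[OF K x] by auto
  then show "\<exists>p. irreducible_over K p \<and> poly p x = 0 \<and> separable_poly p"
    using minpoly_irreducible[OF K al] minpoly_props(3)[OF K al] separable_polyI[OF K] by blast
qed

text \<open>The primitive element is found in the algebraic closure. Being a combination of
  generators of \<open>L\<close> over \<open>k\<close>, it lies in the image of \<open>L\<close> and
  can be pulled back.\<close>

lemma finite_separable_generator:
  fixes k L :: "'a::field set"
  assumes k: "is_subfield k" "infinite k" and L: "is_subfield L" and kL: "k \<subseteq> L"
    and fin: "finite_ext k L" and s: "separable_ext k L"
  obtains \<theta> where "L = adj k \<theta>" "\<theta> \<noteq> 0" "sep k \<theta>"
proof -
  note srk = subfield_subring[OF k(1)] and srL = subfield_subring[OF L]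
  obtain A where A: "finite A" "A \<subseteq> L" "\<forall>T. subring_set T \<and> k \<subseteq> T \<and> A \<subseteq> T \<longrightarrow> L \<subseteq> T"
    using finite_ext_generators[OF k(1) fin] by (elim exE conjE) (rule that)
  let ?k = "to_ac ` k"
  have k1: "is_subfield ?k" by (rule hom_image_subfield[OF to_ac_hom[OF srk] k(1)])
  have inf: "infinite ?k" using k(2) by (simp add: finite_image_iff inj_on_def)
  have "sep ?k a" if "a \<in> to_ac ` A" for a
    using that A(2) separable_ext_imp_sep[OF k(1) s] sep_to_ac_iff[OF k(1)] by blast
  then obtain v where v: "sep ?k v" "to_ac ` A \<subseteq> adj ?k v" "v \<in> lin_combs ?k (to_ac ` A)"
    using primitive_element[OF k1 subset_refl inf, of "to_ac ` A"] A(1) by blast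
  have "v \<in> to_ac ` L" using v(3)
  proof (induction rule: lin_combs.induct)
    case lin_combs_0
    then show ?case using subring_set_0[OF srL] by (metis imageI to_ac_0)
  next
    case (lin_combs_add x y c)
    then obtain x' y' c' where "x = to_ac x'" "y = to_ac y'" "c = to_ac c'" "x' \<in> L" "y' \<in> L" "c' \<in> L" using kL by blast
    then have "x + c * y = to_ac (x' + c' * y')" "x' + c' * y' \<in> L"
      by (simp_all add: subring_set_add[OF srL] subring_set_mult[OF srL])
    then show ?case by blast
  qed (use A in blast)
  then obtain \<theta> where \<theta>: "\<theta> \<in> L" "v = to_ac \<theta>" by blast
  have s\<theta>: "sep k \<theta>" using v(1) \<theta> sep_to_ac_iff[OF k(1)] by simp
  have "A \<subseteq> adj k \<theta>" using v(2) \<theta> adj_to_ac_iff[OF k(1)] by auto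
  then have "L \<subseteq> adj k \<theta>" using A(3) subring_set_adj[OF srk, of \<theta>] adj_base[OF srk, of _ \<theta>] by blast
  moreover have "adj k \<theta> \<subseteq> L" by (rule adj_least[OF srL kL \<theta>(1)])
  ultimately have L\<theta>: "L = adj k \<theta>" by simp
  show thesis
  proof (cases "\<theta> = 0")
    \<comment> \<open>Here \<open>L = k\<close>, and 1 is a nonzero generator.\<close>
    case True
    have "adj k \<theta> \<subseteq> k" by (rule adj_least[OF srk]) (use True subring_set_0[OF srk] in auto)
    moreover have "adj k 1 \<subseteq> k" by (rule adj_least[OF srk]) (use subring_set_1[OF srk] in auto)
    ultimately have "L = adj k 1" using L\<theta> adj_base[OF srk] by blast
    then show thesis by (rule that) (auto simp: sep_base[OF srk] subring_set_1[OF srk])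
  qed (rule that[OF L\<theta> _ s\<theta>])
qed

text \<open>The splitting supplies linear factors in \<open>L\<close> itself, and separability
  excludes repeated ones; the type is not assumed algebraically closed.\<close>

lemma galois_minpoly_factorization:
  assumes k: "is_subfield k" and s: "sep k \<theta>" and sp: "splits_over L (minpoly k \<theta>)"
  shows "{r. poly (minpoly k \<theta>) r = 0} \<subseteq> L"
    "minpoly k \<theta> = (\<Prod>r\<in>{r. poly (minpoly k \<theta>) r = 0}. [:- r, 1:])"
proof -
  obtain c xs where xs: "set xs \<subseteq> L" "minpoly k \<theta> = psmult c (\<Prod>x\<leftarrow>xs. [:- x, 1:])"
    using sp by (auto simp: splits_over_def)
  have "plead (\<Prod>x\<leftarrow>xs. [:- x, 1:]) = (1::'a)" for xs :: "'a list"
    by (induction xs) (simp_all add: lead_coeff_mult del: mult_pCons_left)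
  then have "c = 1" using minpoly_props(2)[OF k sep_imp_alg[OF s]] unfolding xs(2) lead_coeff_smult by simp
  then have m: "minpoly k \<theta> = (\<Prod>x\<leftarrow>xs. [:- x, 1:])" using xs by simp
  have root: "poly (\<Prod>x\<leftarrow>ys. [:- x, 1:]) r = 0 \<longleftrightarrow> r \<in> set ys" for r :: 'a and ys
    by (induction ys) auto
  then have R: "{r. poly (minpoly k \<theta>) r = 0} = set xs" unfolding m by auto
  then show "{r. poly (minpoly k \<theta>) r = 0} \<subseteq> L" using xs by simp
  have "distinct xs"
  proof (rule ccontr)
    assume "\<not> distinct xs"
    then obtain ys y zs ws where d: "xs = ys @ [y] @ zs @ [y] @ ws" using not_distinct_decomp by blast
    define l where "l = [:- y, 1:]"
    have l: "poly l y = 0" by (simp add: l_def)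
    have "minpoly k \<theta> = l * (l * ((\<Prod>x\<leftarrow>ys. [:- x, 1:]) * (\<Prod>x\<leftarrow>zs. [:- x, 1:]) * (\<Prod>x\<leftarrow>ws. [:- x, 1:])))"
      unfolding m d l_def[symmetric] by (simp add: l_def[symmetric] ac_simps)
    then have "poly (pderiv (minpoly k \<theta>)) y = 0" "poly (minpoly k \<theta>) y = 0"
      by (simp_all add: pderiv_mult l)
    then show False using sep_minpoly_roots(2)[OF k s] by blast
  qed
  then show "minpoly k \<theta> = (\<Prod>r\<in>{r. poly (minpoly k \<theta>) r = 0}. [:- r, 1:])"
    unfolding R using m by (simp add: prod.distinct_set_conv_list)
qed

section \<open>Automorphisms of a subfield as homomorphisms\<close>

lemma field_auts_hom:
  assumes F: "is_subfield F" and \<sigma>: "\<sigma> \<in> field_auts F K"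
  shows "ring_hom_on F \<sigma>" "\<sigma> ` F = F" "x \<in> K \<Longrightarrow> \<sigma> x = x"
proof -
  note sr = subfield_subring[OF F]
  have *: "inj_on \<sigma> F" "\<sigma> ` F = F" "\<And>x y. x \<in> F \<Longrightarrow> y \<in> F \<Longrightarrow> \<sigma> (x + y) = \<sigma> x + \<sigma> y \<and> \<sigma> (x * y) = \<sigma> x * \<sigma> y"
    using \<sigma> by (auto simp: field_auts_def Bij_def bij_betw_def)
  have "\<sigma> (0 + 0) = \<sigma> 0 + \<sigma> 0" using *(3) subring_set_0[OF sr] by blast
  then have "\<sigma> 0 + \<sigma> 0 = 0 + \<sigma> 0" by (simp only: add_0_left)
  then have 0: "\<sigma> 0 = 0" by (simp only: add_right_cancel)
  have "\<sigma> 1 * \<sigma> 1 = \<sigma> 1" using *(3)[of 1 1] subring_set_1[OF sr] by simp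
  moreover have "\<sigma> 1 \<noteq> 0" using *(1) 0 subring_set_0[OF sr] subring_set_1[OF sr] by (metis inj_onD zero_neq_one)
  ultimately have "\<sigma> 1 = 1" by simp
  then show "ring_hom_on F \<sigma>" using * sr by unfold_locales auto
  show "\<sigma> ` F = F" by (rule *)
  show "x \<in> K \<Longrightarrow> \<sigma> x = x" using \<sigma> by (simp add: field_auts_def)
qed

lemma restrict_in_field_auts:
  assumes F: "is_subfield F" and h: "ring_hom_on F \<eta>" and im: "\<eta> ` F = F" and KF: "K \<subseteq> F"
    and fx: "\<And>x. x \<in> K \<Longrightarrow> \<eta> x = x"
  shows "restrict \<eta> F \<in> field_auts F K"
proof -
  interpret ring_hom_on F \<eta> by (rule h)
  have "inj_on \<eta> F" using hom_field_inj[OF h F] by (intro inj_onI)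
  then show ?thesis using im KF fx
    by (auto simp: field_auts_def Bij_def bij_betw_def inj_on_restrict_eq hom_add hom_mult
        subring_set_add[OF subring] subring_set_mult[OF subring])
qed

text \<open>The embedding maps the finite set of conjugates of \<theta> injectively into itself,
  hence onto it. So \<theta> is attained and the image is all of \<open>L\<close>.\<close>

lemma galois_conjugate_automorphism:
  fixes k L :: "'a::field set"
  assumes k: "is_subfield k" and L: "is_subfield L" and L_eq: "L = adj k \<theta>" and s: "sep k \<theta>"
    and roots: "{r. poly (minpoly k \<theta>) r = 0} \<subseteq> L" and r: "poly (minpoly k \<theta>) r = 0"
  shows "restrict (emb k \<theta> r) L \<in> field_auts L k"
proof (rule restrict_in_field_auts[OF L])
  note srk = subfield_subring[OF k] and srL = subfield_subring[OF L]
  note al = sep_imp_alg[OF s]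
  have kL: "k \<subseteq> L" unfolding L_eq using adj_base[OF srk] by blast
  show "k \<subseteq> L" by (rule kL)
  show h: "ring_hom_on L (emb k \<theta> r)" unfolding L_eq by (rule emb_hom[OF k al r])
  show "emb k \<theta> r x = x" if "x \<in> k" for x by (rule emb_base[OF k al r that])
  have into: "emb k \<theta> r ` L \<subseteq> L"
    using emb_in[OF k al r _ srL kL] roots r unfolding L_eq by blast
  let ?R = "{r. poly (minpoly k \<theta>) r = 0}"
  have "emb k \<theta> r ` ?R = ?R"
  proof (rule endo_inj_surj[OF finite_minpoly_roots[OF k al]])
    show "emb k \<theta> r ` ?R \<subseteq> ?R"
      using emb_minpoly[OF k al r] roots minpoly_conjugate(2)[OF k al] unfolding L_eq by fastforce
    show "inj_on (emb k \<theta> r) ?R" using hom_field_inj[OF h L] roots by (intro inj_onI) blast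
  qed
  then have "\<theta> \<in> emb k \<theta> r ` L" using minpoly_props(3)[OF k al] roots by blast
  moreover have "k \<subseteq> emb k \<theta> r ` L" using kL emb_base[OF k al r] by (metis image_eqI subset_iff)
  ultimately have "adj k \<theta> \<subseteq> emb k \<theta> r ` L"
    by (intro adj_least ring_hom_on.hom_image_subring[OF h])
  then show "emb k \<theta> r ` L = L" using into L_eq by blast
qed

lemma Aut_sel:
  "carrier (Aut F K) = field_auts F K"
  "\<sigma> \<in> Bij F \<Longrightarrow> \<tau> \<in> Bij F \<Longrightarrow> \<sigma> \<otimes>\<^bsub>Aut F K\<^esub> \<tau> = compose F \<sigma> \<tau>"
  by (simp_all add: Aut_def BijGroup_def)

lemma field_auts_Bij: "\<sigma> \<in> field_auts F K \<Longrightarrow> \<sigma> \<in> Bij F"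
  by (simp add: field_auts_def)

lemma inner_automorphism_iso:
  assumes "group G" and h: "h \<in> carrier G"
  shows "(\<lambda>g. h \<otimes>\<^bsub>G\<^esub> g \<otimes>\<^bsub>G\<^esub> inv\<^bsub>G\<^esub> h) \<in> iso G G"
proof -
  interpret group G by (rule assms)
  have c: "(inv\<^bsub>G\<^esub> h) \<otimes>\<^bsub>G\<^esub> (h \<otimes>\<^bsub>G\<^esub> x) = x" if "x \<in> carrier G" for x
    using h that by (simp add: m_assoc[symmetric])
  have d: "h \<otimes>\<^bsub>G\<^esub> (inv\<^bsub>G\<^esub> h \<otimes>\<^bsub>G\<^esub> x) = x" if "x \<in> carrier G" for x
    using h that by (simp add: m_assoc[symmetric])
  show ?thesis
  proof (rule isoI)
    show "(\<lambda>g. h \<otimes>\<^bsub>G\<^esub> g \<otimes>\<^bsub>G\<^esub> inv\<^bsub>G\<^esub> h) \<in> hom G G"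
      using h c by (intro homI) (simp_all add: m_assoc)
    show "bij_betw (\<lambda>g. h \<otimes>\<^bsub>G\<^esub> g \<otimes>\<^bsub>G\<^esub> inv\<^bsub>G\<^esub> h) (carrier G) (carrier G)"
      by (rule bij_betw_byWitness[where f' = "\<lambda>g. inv\<^bsub>G\<^esub> h \<otimes>\<^bsub>G\<^esub> g \<otimes>\<^bsub>G\<^esub> h"]) (use h c d in \<open>auto simp: m_assoc\<close>)
  qed
qed

theorem corollary1p3:
  fixes k L :: "'a::field set"
    and G :: "('g, 'b) monoid_scheme"
    and \<alpha> :: "'g \<Rightarrow> 'a \<Rightarrow> 'a"
  assumes "is_subfield k" and "hilbertian k"
    and "is_subfield L" and "k \<subseteq> L" and "finite_ext k L" and "galois_ext k L"
    and "group G" and "finite (carrier G)"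
    and "\<alpha> \<in> epi G (Aut L k)"
    and "\<exists>\<alpha>'\<in>mon (Aut L k) G. \<forall>\<tau>\<in>carrier (Aut L k). \<alpha> (\<alpha>' \<tau>) = \<tau>"
  shows "\<exists>(F :: 'a alg_closure set) \<beta>.
           is_subfield F \<and> to_ac ` L \<subseteq> F \<and>
           finite_ext (to_ac ` L) F \<and> separable_ext (to_ac ` L) F \<and>
           \<beta> \<in> iso (Aut F (to_ac ` k)) G \<and>
           (\<forall>\<sigma>\<in>carrier (Aut F (to_ac ` k)). \<forall>x\<in>L. to_ac (\<alpha> (\<beta> \<sigma>) x) = \<sigma> (to_ac x))"
proof -
  note k = assms(1) and L = assms(3) and kL = assms(4)
  note srk = subfield_subring[OF k] and srL = subfield_subring[OF L]
  interpret G: group G by (rule assms(7))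
  have inf: "infinite k" by (rule hilbertian_infinite[OF k assms(2)])
  have se: "separable_ext k L" and ne: "normal_ext k L" using assms(6) by (auto simp: galois_ext_def)
  obtain \<theta> where L_eq: "L = adj k \<theta>" and nz: "\<theta> \<noteq> 0" and s\<theta>: "sep k \<theta>"
    by (rule finite_separable_generator[OF k inf L kL assms(5) se])
  note al = sep_imp_alg[OF s\<theta>]
  have \<theta>L: "\<theta> \<in> L" unfolding L_eq by (rule adj_self[OF srk])
  have sp: "splits_over L (minpoly k \<theta>)"
    using ne minpoly_irreducible[OF k al] minpoly_props(3)[OF k al] \<theta>L unfolding normal_ext_def by blast
  note roots = galois_minpoly_factorization[OF k s\<theta> sp]
  have act_auts: "\<alpha> g \<in> field_auts L k" if "g \<in> carrier G" for g
    using assms(9) that by (auto simp: epi_def hom_def Aut_sel)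
  note act = field_auts_hom[OF L act_auts]
  have act_L: "\<alpha> g x \<in> L" if "g \<in> carrier G" "x \<in> L" for g x using act(2)[OF that(1)] that(2) by blast
  have act_mult: "\<alpha> (g \<otimes>\<^bsub>G\<^esub> h) x = \<alpha> g (\<alpha> h x)" if "g \<in> carrier G" "h \<in> carrier G" "x \<in> L" for g h x
  proof -
    have "\<alpha> (g \<otimes>\<^bsub>G\<^esub> h) = \<alpha> g \<otimes>\<^bsub>Aut L k\<^esub> \<alpha> h" using assms(9) that by (simp add: epi_def hom_mult)
    also have "\<dots> = compose L (\<alpha> g) (\<alpha> h)" using act_auts that by (intro Aut_sel field_auts_Bij)
    finally show ?thesis using that by (simp add: compose_def)
  qed
  have act_one: "\<alpha> \<one>\<^bsub>G\<^esub> x = x" if "x \<in> L" for x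
    using hom_field_inj[OF act(1)[OF G.one_closed] L act_L[OF G.one_closed that] that]
      act_mult[OF G.one_closed G.one_closed that] by simp
  have act_fixed: "\<alpha> g (poly p \<theta>) = poly p (\<alpha> g \<theta>)" if "g \<in> carrier G" "p \<in> polys k" for g p
    by (rule hom_poly_fixed[OF act(1)[OF that(1)] act(3)[OF that(1)] kL that(2) \<theta>L])
  \<comment> \<open>A conjugate of \<theta> gives an automorphism of L/k, and surjectivity of
    \<alpha> lifts it to \<open>G\<close>.\<close>
  have conj: "{r. poly (minpoly k \<theta>) r = 0} = (\<lambda>g. \<alpha> g \<theta>) ` carrier G"
  proof (intro subset_antisym subsetI)
    fix r assume "r \<in> {r. poly (minpoly k \<theta>) r = 0}"
    then have r: "poly (minpoly k \<theta>) r = 0" by simp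
    have "restrict (emb k \<theta> r) L \<in> \<alpha> ` carrier G"
      using galois_conjugate_automorphism[OF k L L_eq s\<theta> roots(1) r] assms(9) by (simp add: epi_def Aut_sel)
    then obtain g where "g \<in> carrier G" "restrict (emb k \<theta> r) L = \<alpha> g" by blast
    moreover have "restrict (emb k \<theta> r) L \<theta> = r" using emb_gen[OF k al r] \<theta>L by simp
    ultimately show "r \<in> (\<lambda>g. \<alpha> g \<theta>) ` carrier G" by auto
  next
    fix r assume "r \<in> (\<lambda>g. \<alpha> g \<theta>) ` carrier G"
    then obtain g where g: "g \<in> carrier G" "r = \<alpha> g \<theta>" by blast
    then have "poly (minpoly k \<theta>) r = \<alpha> g (poly (minpoly k \<theta>) \<theta>)"
      using act_fixed[OF g(1) minpoly_props(1)[OF k al]] by simp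
    then show "r \<in> {r. poly (minpoly k \<theta>) r = 0}"
      using minpoly_props(3)[OF k al] ring_hom_on.hom_0[OF act(1)[OF g(1)]] by simp
  qed
  have split: "minpoly k \<theta> = (\<Prod>\<rho>\<in>(\<lambda>g. \<alpha> g \<theta>) ` carrier G. [:- \<rho>, 1:])"
    using roots(2) unfolding conj .
  interpret S: generic_solution k L \<theta> G \<alpha>
    by (rule generic_solution.intro)
       (use k L kL inf L_eq nz s\<theta> assms(7,8) act act_L act_mult act_one split in auto)
  obtain v c where v: "sep S.K v" "cC \<theta> \<in> adj S.K v"
    and c: "bij_betw c (carrier G) {r \<in> adj S.K v. poly (minpoly S.K v) r = 0}"
    and c_mult: "\<And>g h. g \<in> carrier G \<Longrightarrow> h \<in> carrier G \<Longrightarrow> emb S.K v (c g) (c h) = c (g \<otimes>\<^bsub>G\<^esub> h)"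
    and c_\<theta>: "\<And>g. g \<in> carrier G \<Longrightarrow> emb S.K v (c g) (cC \<theta>) = cC (\<alpha> g \<theta>)"
    by (rule S.generic_automorphisms) (rule that; blast)
  define Cj where "Cj = {r \<in> adj S.K v. poly (minpoly S.K v) r = 0}"
  have Cj: "Cj = c ` carrier G" using c by (simp add: bij_betw_def Cj_def)
  let ?k = "to_ac ` k"
  have k0: "is_subfield ?k" by (rule hom_image_subfield[OF to_ac_hom[OF srk] k])
  note srk0 = subfield_subring[OF k0]
  have inf0: "infinite ?k" using inf by (simp add: finite_image_iff inj_on_def)
  \<comment> \<open>The place must be compatible with the action on \<theta>, for the restriction to
    \<open>L\<close>, and with that on all conjugates \<open>c g\<close>, for the group law.\<close>
  have finZ: "finite (insert (cC \<theta>) Cj)" "insert (cC \<theta>) Cj \<subseteq> adj S.K v"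
    using Cj assms(8) v(2) by (auto simp: Cj_def)
  \<comment> \<open>On constants the place is the identification of the two copies of
    \<open>k\<close>, in the function field and in the algebraic closure.\<close>
  define kap where "kap = (\<lambda>x. to_ac (inv_into k cC x))"
  obtain D psi where psi: "ring_hom_on D psi" "cC ` k \<subseteq> D" "\<And>x. x \<in> cC ` k \<Longrightarrow> psi x = kap x"
    "insert (cC \<theta>) Cj \<subseteq> D" "sep ?k (psi v)"
    "\<And>z. z \<in> insert (cC \<theta>) Cj \<Longrightarrow> psi z \<in> adj ?k (psi v)"
    "\<And>r. r \<in> Cj \<Longrightarrow> poly (minpoly ?k (psi v)) (psi r) = 0 \<and> psi r \<in> adj ?k (psi v)"
    "\<And>r z. r \<in> Cj \<Longrightarrow> z \<in> insert (cC \<theta>) Cj \<Longrightarrow> psi (emb S.K v r z) = emb ?k (psi v) (psi r) (psi z)"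
    "\<And>x. x \<in> adj ?k (psi v) \<Longrightarrow> poly (minpoly ?k (psi v)) x = 0 \<Longrightarrow> \<exists>r\<in>Cj. x = psi r"
    "inj_on psi Cj"
    unfolding Cj_def
    by (rule specialize_automorphisms[OF S.K S.inf_K k0 _ v(1) finZ[unfolded Cj_def], of "cC ` k" kap])
       (use S.base.hilbert_place[OF assms(2)] in \<open>auto simp: kap_def\<close>)
  interpret psi: ring_hom_on D psi by (rule psi(1))
  define v0 where "v0 = psi v"
  define F where "F = adj ?k v0"
  have sv0: "sep ?k v0" and alv0: "alg ?k v0" using psi(5) sep_imp_alg by (auto simp: v0_def)
  have F: "is_subfield F" unfolding F_def by (rule adj_subfield[OF k0 alv0])
  note srF = subfield_subring[OF F]
  have kF: "?k \<subseteq> F" unfolding F_def using adj_base[OF srk0] by blast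
  have v0F: "v0 \<in> F" unfolding F_def by (rule adj_self[OF srk0])
  define sg where "sg g = psi (c g)" for g
  have sg: "poly (minpoly ?k v0) (sg g) = 0" "sg g \<in> F" if "g \<in> carrier G" for g
    using psi(7)[of "c g"] that by (auto simp: sg_def F_def v0_def Cj)
  define \<epsilon> where "\<epsilon> g = emb ?k v0 (sg g)" for g
  have \<epsilon>_hom: "ring_hom_on F (\<epsilon> g)" if "g \<in> carrier G" for g
    unfolding F_def \<epsilon>_def by (rule emb_hom[OF k0 alv0 sg(1)[OF that]])
  have \<epsilon>_k: "\<epsilon> g x = x" if "g \<in> carrier G" "x \<in> ?k" for g x
    unfolding \<epsilon>_def by (rule emb_base[OF k0 alv0 sg(1)[OF that(1)] that(2)])
  have \<epsilon>_F: "\<epsilon> g x \<in> F" if "g \<in> carrier G" "x \<in> F" for g x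
    unfolding \<epsilon>_def by (rule emb_in[OF k0 alv0 sg(1)[OF that(1)] _ srF kF sg(2)[OF that(1)]])
      (use that(2) in \<open>simp add: F_def\<close>)
  have \<epsilon>_v0: "\<epsilon> g v0 = sg g" if "g \<in> carrier G" for g
    unfolding \<epsilon>_def by (rule emb_gen[OF k0 alv0 sg(1)[OF that]])
  have \<epsilon>_mult: "\<epsilon> (g \<otimes>\<^bsub>G\<^esub> h) x = \<epsilon> g (\<epsilon> h x)" if g: "g \<in> carrier G" and h: "h \<in> carrier G" and x: "x \<in> F" for g h x
  proof -
    have "sg (g \<otimes>\<^bsub>G\<^esub> h) = \<epsilon> g (sg h)"
      using psi(8)[of "c g" "c h"] c_mult[OF g h] g h by (simp add: sg_def \<epsilon>_def v0_def Cj)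
    then show ?thesis
      using emb_comp(2)[OF k0 alv0 sg(1)[OF g] sg(1)[OF h] sg(2)[OF h, unfolded F_def]] x
      by (simp add: \<epsilon>_def F_def)
  qed
  \<comment> \<open>The map is idempotent by multiplicativity and injective on a field, hence the
    identity.\<close>
  have \<epsilon>_one: "\<epsilon> \<one>\<^bsub>G\<^esub> x = x" if "x \<in> F" for x
    using hom_field_inj[OF \<epsilon>_hom[OF G.one_closed] F \<epsilon>_F[OF G.one_closed that] that]
      \<epsilon>_mult[OF G.one_closed G.one_closed that] by simp
  define \<Phi> where "\<Phi> g = restrict (\<epsilon> g) F" for g
  have \<Phi>: "\<Phi> g \<in> field_auts F ?k" if g: "g \<in> carrier G" for g
    unfolding \<Phi>_def
  proof (rule restrict_in_field_auts[OF F \<epsilon>_hom[OF g] _ kF \<epsilon>_k[OF g]])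
    have "x \<in> \<epsilon> g ` F" if "x \<in> F" for x
      using \<epsilon>_mult[OF g G.inv_closed[OF g] that] \<epsilon>_one[OF that] \<epsilon>_F[OF G.inv_closed[OF g] that] g
      by (metis G.r_inv imageI)
    then show "\<epsilon> g ` F = F" using \<epsilon>_F[OF g] by blast
  qed
  have iso: "\<Phi> \<in> iso G (Aut F ?k)"
  proof (rule isoI)
    show "\<Phi> \<in> hom G (Aut F ?k)"
    proof (rule homI)
      show "\<Phi> g \<in> carrier (Aut F ?k)" if "g \<in> carrier G" for g using \<Phi>[OF that] by (simp add: Aut_sel)
      show "\<Phi> (g \<otimes>\<^bsub>G\<^esub> h) = \<Phi> g \<otimes>\<^bsub>Aut F ?k\<^esub> \<Phi> h" if "g \<in> carrier G" "h \<in> carrier G" for g h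
      proof -
        have "\<Phi> g \<otimes>\<^bsub>Aut F ?k\<^esub> \<Phi> h = compose F (\<Phi> g) (\<Phi> h)"
          using \<Phi> that by (intro Aut_sel field_auts_Bij)
        also have "\<dots> = \<Phi> (g \<otimes>\<^bsub>G\<^esub> h)"
          using \<epsilon>_mult[OF that] \<epsilon>_F[OF that(2)] by (auto simp: compose_def \<Phi>_def)
        finally show ?thesis by simp
      qed
    qed
    show "bij_betw \<Phi> (carrier G) (carrier (Aut F ?k))"
    proof (rule bij_betw_imageI)
      show "inj_on \<Phi> (carrier G)"
      proof (rule inj_onI)
        fix g h assume gh: "g \<in> carrier G" "h \<in> carrier G" "\<Phi> g = \<Phi> h"
        have "\<Phi> g v0 = \<Phi> h v0" using gh by simp
        then have "psi (c g) = psi (c h)" using gh v0F \<epsilon>_v0 by (simp add: \<Phi>_def sg_def)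
        then have "c g = c h" using psi(10) gh by (auto simp: Cj dest: inj_onD)
        then show "g = h" using c gh by (auto simp: bij_betw_def dest: inj_onD)
      qed
      show "\<Phi> ` carrier G = carrier (Aut F ?k)"
      proof
        show "\<Phi> ` carrier G \<subseteq> carrier (Aut F ?k)" using \<Phi> by (auto simp: Aut_sel)
        show "carrier (Aut F ?k) \<subseteq> \<Phi> ` carrier G"
        proof
          fix \<sigma> assume "\<sigma> \<in> carrier (Aut F ?k)"
          then have \<sigma>: "\<sigma> \<in> field_auts F ?k" by (simp add: Aut_sel)
          note \<sigma>h = field_auts_hom[OF F \<sigma>]
          have F': "adj ?k v0 \<subseteq> F" by (simp add: F_def)
          have r: "poly (minpoly ?k v0) (\<sigma> v0) = 0"
            by (rule hom_eq_emb(1)[OF k0 alv0 \<sigma>h(1) F' \<sigma>h(3)])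
          have "\<sigma> v0 \<in> F" using \<sigma>h(2) v0F by blast
          \<comment> \<open>Surjectivity of \<Phi> rests on this: every conjugate of
            \<open>v0\<close> in \<open>F\<close> is the reduction of some
            \<open>c g\<close>.\<close>
          then obtain g where g: "g \<in> carrier G" "\<sigma> v0 = sg g"
            using psi(9)[of "\<sigma> v0"] r by (auto simp: F_def v0_def Cj sg_def)
          have "\<sigma> x = \<epsilon> g x" if "x \<in> F" for x
            using hom_eq_emb(2)[OF k0 alv0 \<sigma>h(1) F' \<sigma>h(3)] that g by (simp add: F_def \<epsilon>_def)
          moreover have "\<sigma> \<in> extensional F" using field_auts_Bij[OF \<sigma>] by (simp add: Bij_def)
          ultimately have "\<sigma> = \<Phi> g" unfolding \<Phi>_def by (intro extensionalityI[of \<sigma> F]) auto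
          then show "\<sigma> \<in> \<Phi> ` carrier G" using g by blast
        qed
      qed
    qed
  qed
  \<comment> \<open>The reduction of \<theta> is a root of the same minimal polynomial, but it need
    not be \<theta> itself.\<close>
  define t where "t = psi (cC \<theta>)"
  have injc: "inj_on cC k" by (simp add: inj_on_def cC_eq_iff)
  have psi_poly: "psi (cC (poly p \<theta>)) = poly (map_poly to_ac p) t" if p: "p \<in> polys k" for p
  proof -
    have cD: "map_poly cC p \<in> polys D" using p psi(2) by (auto simp: polys_def coeff_map_poly S.base.f_0)
    have "map_poly psi (map_poly cC p) = map_poly to_ac p"
      using p psi(3) inv_into_f_f[OF injc]
      by (intro poly_eqI) (simp add: psi.coeff_map_poly_hom coeff_map_poly S.base.f_0 polys_def kap_def)
    moreover have "cC (poly p \<theta>) = poly (map_poly cC p) (cC \<theta>)"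
      using ring_hom_on.poly_map_poly_hom[OF cC_hom, of p \<theta>] by (simp add: polys_UNIV)
    ultimately show ?thesis using psi.poly_map_poly_hom[OF cD, of "cC \<theta>"] psi(4) by (simp add: t_def)
  qed
  interpret ac: ring_hom_on UNIV "to_ac :: 'a \<Rightarrow> _" by (rule to_ac_hom[OF subring_set_UNIV])
  have ac_poly: "poly (map_poly to_ac p) (to_ac x) = to_ac (poly p x)" for p and x :: 'a
    using ac.poly_map_poly_hom[of p x] by (simp add: polys_UNIV)
  \<comment> \<open>\<open>h0\<close> measures the twist: on \<open>L\<close> the place acts as
    \<open>\<alpha> h0\<close>.\<close>
  obtain h0 where h0: "h0 \<in> carrier G" "t = to_ac (\<alpha> h0 \<theta>)"
  proof -
    interpret m: ring_hom_on "polys UNIV" "map_poly (to_ac :: 'a \<Rightarrow> _)" by (rule ac.map_poly_hom)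
    have "map_poly to_ac (minpoly k \<theta>) = (\<Prod>\<rho>\<in>(\<lambda>g. \<alpha> g \<theta>) ` carrier G. map_poly to_ac [:- \<rho>, 1:])"
      unfolding split by (rule m.hom_prod) (simp add: polys_UNIV)
    then have "poly (map_poly to_ac (minpoly k \<theta>)) t = (\<Prod>\<rho>\<in>(\<lambda>g. \<alpha> g \<theta>) ` carrier G. t - to_ac \<rho>)"
      by (simp add: poly_prod ac.map_poly_pCons_hom)
    moreover have "poly (map_poly to_ac (minpoly k \<theta>)) t = 0"
      using psi_poly[OF minpoly_props(1)[OF k al]] minpoly_props(3)[OF k al] psi.hom_0 S.base.f_0 by simp
    ultimately show thesis using that assms(8) by auto
  qed
  have psi_L: "psi (cC x) = to_ac (\<alpha> h0 x)" if x: "x \<in> L" for x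
  proof -
    obtain p where p: "p \<in> polys k" "x = poly p \<theta>" using x unfolding L_eq by (rule adjE)
    then show ?thesis using psi_poly[OF p(1)] act_fixed[OF h0(1) p(1)] by (simp add: h0(2) ac_poly)
  qed
  have mp: "map_poly to_ac p \<in> polys ?k" if "p \<in> polys k" for p
    using that by (auto simp: polys_def coeff_map_poly)
  have tF: "t \<in> F" using psi(6)[of "cC \<theta>"] by (simp add: t_def F_def v0_def)
  \<comment> \<open>Undoing the twist exhibits every element of \<open>L\<close> as the reduction of
    a constant; this puts \<open>L\<close> inside \<open>F\<close>.\<close>
  have twist: "to_ac x = psi (cC (\<alpha> (inv\<^bsub>G\<^esub> h0) x)) \<and> \<alpha> (inv\<^bsub>G\<^esub> h0) x \<in> L" if x: "x \<in> L" for x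
    using psi_L[OF act_L[OF G.inv_closed[OF h0(1)] x]] act_mult[OF h0(1) G.inv_closed[OF h0(1)] x]
      act_one[OF x] act_L[OF G.inv_closed[OF h0(1)] x] h0(1) by simp
  have LF: "to_ac ` L \<subseteq> F"
  proof
    fix y assume "y \<in> to_ac ` L"
    then obtain x where x: "x \<in> L" "y = to_ac x" by blast
    obtain p where p: "p \<in> polys k" "\<alpha> (inv\<^bsub>G\<^esub> h0) x = poly p \<theta>" using twist[OF x(1)] unfolding L_eq by (auto elim: adjE)
    have "y = poly (map_poly to_ac p) t" using twist[OF x(1)] x p psi_poly[OF p(1)] by simp
    then show "y \<in> F" using poly_in_subring[OF srF _ tF] mp[OF p(1)] polys_mono[OF kF] by blast
  qed
  \<comment> \<open>On \<open>L\<close> the composite of \<open>\<epsilon> g\<close> with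
    \<open>\<alpha> h0\<close> is \<open>\<alpha>\<close> of \<open>h0 g\<close>, because
    \<open>psi\<close> intertwines the actions. Hence \<open>\<epsilon> g\<close> acts as the
    conjugate of \<open>g\<close> by \<open>h0\<close>.\<close>
  have \<epsilon>_L: "\<epsilon> g (to_ac x) = to_ac (\<alpha> (h0 \<otimes>\<^bsub>G\<^esub> g \<otimes>\<^bsub>G\<^esub> inv\<^bsub>G\<^esub> h0) x)" if g: "g \<in> carrier G" and x: "x \<in> L" for g x
  proof -
    define x' where "x' = \<alpha> (inv\<^bsub>G\<^esub> h0) x"
    have x': "to_ac x = psi (cC x')" "x' \<in> L" using twist[OF x] by (auto simp: x'_def)
    obtain p where p: "p \<in> polys k" "x' = poly p \<theta>" using x'(2) unfolding L_eq by (rule adjE)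
    have hg: "h0 \<otimes>\<^bsub>G\<^esub> g \<in> carrier G" using h0 g by simp
    have "\<epsilon> g t = psi (emb S.K v (c g) (cC \<theta>))"
      using psi(8)[of "c g" "cC \<theta>"] g by (simp add: \<epsilon>_def sg_def v0_def t_def Cj)
    also have "\<dots> = to_ac (\<alpha> (h0 \<otimes>\<^bsub>G\<^esub> g) \<theta>)"
      using c_\<theta>[OF g] psi_L[OF act_L[OF g \<theta>L]] act_mult[OF h0(1) g \<theta>L] by simp
    finally have \<epsilon>t: "\<epsilon> g t = to_ac (\<alpha> (h0 \<otimes>\<^bsub>G\<^esub> g) \<theta>)" .
    have "\<epsilon> g (to_ac x) = \<epsilon> g (poly (map_poly to_ac p) t)" using x' p psi_poly[OF p(1)] by simp
    also have "\<dots> = poly (map_poly to_ac p) (\<epsilon> g t)"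
      by (rule hom_poly_fixed[OF \<epsilon>_hom[OF g] \<epsilon>_k[OF g] kF mp[OF p(1)] tF])
    also have "\<dots> = to_ac (\<alpha> (h0 \<otimes>\<^bsub>G\<^esub> g) x')" unfolding \<epsilon>t ac_poly using act_fixed[OF hg p(1)] p by simp
    also have "\<dots> = to_ac (\<alpha> (h0 \<otimes>\<^bsub>G\<^esub> g \<otimes>\<^bsub>G\<^esub> inv\<^bsub>G\<^esub> h0) x)"
      unfolding x'_def using act_mult[OF hg G.inv_closed[OF h0(1)] x] by simp
    finally show ?thesis .
  qed
  \<comment> \<open>The inverse of \<Phi> followed by conjugation by \<open>h0\<close>, which
    absorbs the twist.\<close>
  define \<beta> where "\<beta> = (\<lambda>g. h0 \<otimes>\<^bsub>G\<^esub> g \<otimes>\<^bsub>G\<^esub> inv\<^bsub>G\<^esub> h0) \<circ> inv_into (carrier G) \<Phi>"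
  have \<beta>: "\<beta> \<in> iso (Aut F ?k) G"
    unfolding \<beta>_def using G.iso_set_sym[OF iso] inner_automorphism_iso[OF assms(7) h0(1)]
    by (rule Group.iso_set_trans)
  have restr: "to_ac (\<alpha> (\<beta> \<sigma>) x) = \<sigma> (to_ac x)" if \<sigma>: "\<sigma> \<in> carrier (Aut F ?k)" and x: "x \<in> L" for \<sigma> x
  proof -
    define g where "g = inv_into (carrier G) \<Phi> \<sigma>"
    have im: "\<sigma> \<in> \<Phi> ` carrier G" using iso \<sigma> by (simp add: iso_iff)
    have g: "g \<in> carrier G" "\<Phi> g = \<sigma>" unfolding g_def by (rule inv_into_into[OF im], rule f_inv_into_f[OF im])
    have "\<beta> \<sigma> = h0 \<otimes>\<^bsub>G\<^esub> g \<otimes>\<^bsub>G\<^esub> inv\<^bsub>G\<^esub> h0" by (simp add: \<beta>_def g_def)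
    moreover have "\<sigma> (to_ac x) = \<epsilon> g (to_ac x)" using g(2) LF x by (auto simp: \<Phi>_def)
    ultimately show ?thesis using \<epsilon>_L[OF g(1) x] by simp
  qed
  let ?L = "to_ac ` L"
  have L0: "is_subfield ?L" by (rule hom_image_subfield[OF to_ac_hom[OF srL] L])
  have kL0: "?k \<subseteq> ?L" using kL by blast
  \<comment> \<open>The generator of \<open>F\<close> over \<open>k\<close> also generates it over
    \<open>L\<close>, so F/L is a simple algebraic extension and therefore finite.\<close>
  have "F = adj ?L v0"
  proof
    show "F \<subseteq> adj ?L v0" unfolding F_def adj_def using polys_mono[OF kL0] by blast
    show "adj ?L v0 \<subseteq> F" by (rule adj_least[OF srF LF v0F])
  qed
  then have "finite_ext ?L F" using finite_ext_adj[OF L0 alg_mono[OF alv0 kL0]] by simp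
  moreover have "separable_ext ?L F"
    by (rule separable_extI[OF L0 sep_mono[OF _ kL0]]) (use sep_adj[OF k0 inf0 sv0] in \<open>auto simp: F_def\<close>)
  ultimately show ?thesis using F LF \<beta> restr by blast
qed

end
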